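(* Let $n\ge 1$. The Multi-Client Blind Quantum Computation protocol between $n$ clients and a server, in which the orchestrator is replaced by a classical secure multi-party computation (SMPC) resource between all other parties, perfectly constructs (i.e. $\varepsilon$-securely constructs with $\varepsilon=0$) the Multi-Client Blind Quantum Computation resource against malicious coalitions of at most the server and $n-1$ clients.
   Context: **Notation.** $\mathcal{A}=\{j\pi/4 : j=0,\dots,7\}$ (angles modulo $2\pi$). $R_z(\theta)=\begin{pmatrix}1&0\\0&e^{i\theta}\end{pmatrix}$, $|\pm_\theta\rangle=\tfrac{1}{\sqrt2}(|0\rangle\pm e^{i\theta}|1\rangle)$, $|+\rangle=|+_0\rangle$. $\mathsf{CZ}_{vw}$ is the controlled-$Z$ gate on qubits $v,w$. "$x\gets_R S$" means $x$ is sampled uniformly at random from the finite set $S$, independently of everything else. **Abstract Cryptography framework.** Protocols $\pi$ construct new resources from other resources; $\pi\mathcal{R}_0$ denotes the resource obtained by running $\pi$ with resource $\mathcal{R}_0$. Resources $\mathcal{R}_0,\mathcal{R}_1$ with matching input and output interfaces are $\varepsilon$-(statistically)-indistinguishable, written $\mathcal{R}_0\approx_\varepsilon\mathcal{R}_1$, if for all (computationally unbounded) distinguishers $\mathcal{D}$ $$\left|\Pr[b=1\mid b\gets\mathcal{D}\mathcal{R}_0]-\Pr[b=1\mid b\gets\mathcal{D}\mathcal{R}_1]\right|\le\varepsilon .$$ Let $\pi$ be an $N$-party protocol and let $P\subseteq\mathfrak{P}(\{1,\dots,N\})$ be a set of subsets of parties (the adversarial patterns). Then $\pi$ $\varepsilon$-securely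 constructs $\mathcal{R}_1$ from $\mathcal{R}_0$ against adversarial patterns $P$ if: (1) Correctness: $\pi\mathcal{R}_0\approx_\varepsilon\mathcal{R}_1\perp$, where $\perp$ filters all malicious interfaces (here it sets all flags $c,c_j$ to $0$ and blocks the other malicious interfaces); (2) Soundness: for every subset $M\in P$ of colluding corrupted parties there exists a simulator $\sigma_M$ such that $\pi_{M^c}\mathcal{R}_0\approx_\varepsilon\mathcal{R}_1\sigma_M$, where $\pi_{M^c}$ denotes the protocol run only by the parties not in $M$ (the interfaces of the parties in $M$ being open to the distinguisher), and $\sigma_M$ is attached to the interfaces of $M$. "Perfectly constructs" means $\varepsilon=0$. Malicious parties may deviate arbitrarily from the protocol. The source of the qubits and the server are treated as one single party, the "server". The parties are connected by secure classical and quantum channels. **Multi-Client Blind Quantum Computation resource.** Inputs: for $j=1,\dots,n$, client $j$ sends a classical bit string $x_j$, and also inputs $c_j\in\{0,1\}$ as a filtered interface; the server inputs a flag $c\in\{0,1\}$; all malicious parties, that is all clients with $c_j=1$, and the server if $c=1$, jointly send a quantum state $\psi$ and the description of a map $\mathcal{E}$. Computation: 1. If $c_j=c=0$ for all $j=1,\dots,n$, the resource computes the correct output $y=\mathcal{U}\left(\bigotimes_{j=1}^n|x_j\rangle\langle x_j|\right)$ and sends it to the clients. 2. Otherwise, it computes the corrupted output $y=\mathcal{E}\left(\bigotimes_{j=1}^n|x_j\rangle\langle x_j|\otimes\psi\right)$ and sends it to the clients. Here $\mathcal{U}$ is the target quantum map; it may be a universal quantum map, with the description of the target computation (the angles and the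 flow in the protocol below) encoded in the clients' inputs. **Blind Quantum Computation (BQC) protocol** (between a client and a server). Public information: a graph $G=(V,E,I,O)$ with input vertices $I$ and output vertices $O$, and a partial order $\preceq$ on $V$. Inputs: the client has a bit string $x\in\{0,1\}^{|I|}$, a set of angles $(\phi_v)_{v\in V}$ (also written $\phi(v)$, in $\mathcal{A}$), and a flow $f$ on $G$ compatible with $\preceq$; the server has no inputs. ($x(v)$ is the bit of $x$ for $v\in I$, and $x(v)=0$ for $v\notin I$. A flow in the usual sense of measurement-based quantum computation is an injective map $f:V\setminus O\to V\setminus I$ with $f(v)$ adjacent to $v$, $v\prec f(v)$, and $v\prec w$ for every neighbour $w\ne v$ of $f(v)$.) Steps: 1. For all $v\in V$, the client samples $\theta(v)\gets_R\mathcal{A}$, prepares $|+_{\theta(v)}\rangle$ and sends it to the server. 2. For every edge $\{v,w\}\in E$, the server applies $\mathsf{CZ}_{vw}$. 3. For all $v\in V\setminus O$, in an order respecting $\preceq$: (a) the client uses the previous corrected measurement outcomes to compute the corrected angle $\phi'(v)$ from $\phi(v)$ according to the flow $f$, i.e. by the standard rule $\phi'(v)=(-1)^{s_X(v)}\phi(v)+s_Z(v)\pi$, with $s_X(v)=m'(f^{-1}(v))$ ($0$ if $v\notin f(V\setminus O)$) and $s_Z(v)=\bigoplus_{w\ne v:\,v\in N_G(f(w))}m'(w)$; (b) the client samples $r(v)\gets_R\{0,1\}$, calculates $\delta(v)=\phi'(v)+\theta(v)+(r(v)+x(v))\pi$ and sends $\delta(v)$ to the server; (c) the server measures qubit $v$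 in the basis $\{|\pm_{\delta(v)}\rangle\}$ and returns the outcome $m(v)$; (d) the client calculates $m'(v)=m(v)\oplus r(v)$. 4. The client outputs $(m'(v))_{v\in V\setminus O}$. The server further sends the qubits in $O$ to the client, who decrypts them (using $\theta(v)$, $r(v)$, $m'(v)$ as keys) and keeps them as additional output. **Collaborative Remote State Rotation (CRSR) protocol** (between $n$ clients, an orchestrator and a server). Inputs: the clients have none; the orchestrator has $\theta\in\mathcal{A}$; the server has a single-qubit state $\rho$. Steps: (1) for $j=1,\dots,n$, client $j$ samples $\theta_j\gets_R\mathcal{A}$ and sends it to the orchestrator; (2) the server sends $\rho$ to client 1; (3) for $j=1,\dots,n$, client $j$ applies $R_z(\theta_j)$ to the received state and forwards it to the next client, client $n$ forwarding the final state to the server; (4) the orchestrator computes $\theta'=\theta-\sum_{j=1}^n\theta_j\pmod{2\pi}$ and sends $\theta'$ to the server; (5) the server applies $R_z(\theta')$ to the state received from client $n$ and keeps the result as its output. **Multi-Client Blind Quantum Computation protocol** (between $n$ clients, an orchestrator and a server). Public information: a graph $G=(V,E,I,O)$ with input and output vertices $I$ and $O$; a partition $(I_j)_{j\in\{1,\dots,n\}}$ of $I$, where $I_j$ belongs to client $j$; a partial order $\preceq$ on $V$. Inputs: client $j$ has a bit string $x_j\in\{0,1\}^{|I_j|}$; the $n$ clients collaboratively input a set of angles $(\phi_v)_{v\in V}$ and a flow $f$ on $G$ compatible with $\preceq$; the orchestrator and the server have no inputs. Steps: 1. The $n$ clients send all of their inputs to the orchestrator. 2. The orchestrator (in the role of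 the client) and the server perform the BQC protocol. For every $|+_\theta\rangle$-state that the orchestrator would need to send to the server, they instead perform the following: (a) the server prepares a $|+\rangle$-state; (b) all parties perform one execution of the CRSR protocol, where the server uses the $|+\rangle$-state as input and the orchestrator inputs the angle $\theta$; (c) the server uses the output state in the BQC protocol. 3. The orchestrator distributes the classical output among the clients. The server sends the output qubits in $O$ to the designated clients, with the orchestrator providing the decryption keys. **Replacing the orchestrator.** The orchestrator is an entirely classical party. Replacing it by a classical SMPC resource between all other parties means that an ideal classical multi-party resource, with interfaces to the $n$ clients and the server, carries out exactly the orchestrator's classical instructions, so that no party is assumed to be trusted. *)

theory Defs
  imports Complex_Main "HOL-Library.Disjoint_Sets"
begin

section \<open>Qubit registers and quantum instruments\<close>

text \<open>
  The global quantum system is a family of qubits named by a type \<open>'r\<close>.  A computational basis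
  state is named by the finite set of qubits that are in state 1; a pure state is a finitely
  supported amplitude function on these sets.  A classically labelled quantum operation is a
  finite list of Kraus operators, each with the classical outcome it announces.  Mixed states are
  represented by the list of unnormalised pure states that the Kraus operators produce; the
  probability of an outcome is the sum of the squared norms of the corresponding branches.
\<close>

type_synonym 'r ket = "'r set \<Rightarrow> complex"
type_synonym ('r, 'o) instrument = "('o \<times> ('r ket \<Rightarrow> 'r ket)) list"

definition basis_ket :: "'r set \<Rightarrow> 'r ket" where
  "basis_ket b = (\<lambda>a. if a = b then 1 else 0)"

definition norm2 :: "'r ket \<Rightarrow> real" where
  "norm2 \<psi> = (\<Sum>b\<in>{b. \<psi> b \<noteq> 0}. (cmod (\<psi> b))\<^sup>2)"

text \<open>
  The operator with matrix \<open>k\<close> on the qubits in \<open>F\<close>, tensored with the identity on all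
  other qubits.
\<close>

definition op_on :: "'r set \<Rightarrow> ('r set \<Rightarrow> 'r set \<Rightarrow> complex) \<Rightarrow> 'r ket \<Rightarrow> 'r ket" where
  "op_on F k \<psi> = (\<lambda>b. \<Sum>S\<in>Pow F. k (b \<inter> F) S * \<psi> ((b - F) \<union> S))"

text \<open>
  Arbitrary finite-dimensional quantum instruments on qubits in \<open>R\<close>.  The last conjunct is the
  completeness relation: the sum of all \<open>K\<^sup>\<dagger>K\<close> is the identity.
\<close>

definition instrument_on :: "'r set \<Rightarrow> ('r, 'o) instrument \<Rightarrow> bool" where
  "instrument_on R I \<longleftrightarrow> (\<exists>F\<subseteq>R. finite F \<and> (\<forall>(o', K)\<in>set I. \<exists>k. K = op_on F k) \<and>
     (\<forall>\<psi>. finite {b. \<psi> b \<noteq> 0} \<longrightarrow> (\<Sum>(o', K)\<leftarrow>I. norm2 (K \<psi>)) = norm2 \<psi>))"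

definition ireturn :: "'o \<Rightarrow> ('r, 'o) instrument" where
  "ireturn x = [(x, \<lambda>\<psi>. \<psi>)]"

definition ibind :: "('r, 'a) instrument \<Rightarrow> ('a \<Rightarrow> ('r, 'b) instrument) \<Rightarrow> ('r, 'b) instrument" where
  "ibind I J = concat (map (\<lambda>(x, K). map (\<lambda>(y, L). (y, L \<circ> K)) (J x)) I)"

primrec for_each :: "'a list \<Rightarrow> ('a \<Rightarrow> ('r, unit) instrument) \<Rightarrow> ('r, unit) instrument" where
  "for_each [] g = ireturn ()"
| "for_each (x # xs) g = ibind (g x) (\<lambda>_. for_each xs g)"

definition gate :: "('r ket \<Rightarrow> 'r ket) \<Rightarrow> ('r, unit) instrument" where
  "gate U = [((), U)]"

definition sample :: "'a list \<Rightarrow> ('r, 'a) instrument" where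
  "sample xs = map (\<lambda>x. (x, \<lambda>\<psi> b. \<psi> b / complex_of_real (sqrt (real (length xs))))) xs"


subsection \<open>The gates of the protocol\<close>

text \<open>
  The integer \<open>a\<close> stands for the angle \<open>a\<pi>/4\<close>, so that arithmetic of angles is arithmetic
  modulo 8 and the angle \<open>\<pi>\<close> is 4.
\<close>

definition phase :: "int \<Rightarrow> complex" where
  "phase a = cis (of_int a * pi / 4)"

definition angles :: "int list" where
  "angles = [0..7]"

definition Rz :: "int \<Rightarrow> 'r \<Rightarrow> 'r ket \<Rightarrow> 'r ket" where
  "Rz a q \<psi> = (\<lambda>b. if q \<in> b then phase a * \<psi> b else \<psi> b)"

definition set_qubit :: "'r \<Rightarrow> bool \<Rightarrow> 'r set \<Rightarrow> 'r set" where
  "set_qubit q s b = (if s then insert q b else b - {q})"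

definition X_gate :: "'r \<Rightarrow> 'r ket \<Rightarrow> 'r ket" where
  "X_gate q \<psi> = (\<lambda>b. \<psi> (set_qubit q (q \<notin> b) b))"

text \<open>The product of the controlled-Z gates over all (two-element) sets in \<open>E\<close>.\<close>

definition CZ_all :: "'r set set \<Rightarrow> 'r ket \<Rightarrow> 'r ket" where
  "CZ_all E \<psi> = (\<lambda>b. (-1) ^ card {e\<in>E. e \<subseteq> b} * \<psi> b)"

text \<open>Amplitude at \<open>s\<close> of \<open>|+\<^sub>a\<rangle>\<close> (for \<open>m = False\<close>) or \<open>|-\<^sub>a\<rangle>\<close> (for \<open>m = True\<close>).\<close>

definition pm_amp :: "bool \<Rightarrow> int \<Rightarrow> bool \<Rightarrow> complex" where
  "pm_amp m a s = (if s then (if m then -1 else 1) * phase a else 1) / complex_of_real (sqrt 2)"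

definition prepare :: "int \<Rightarrow> 'r \<Rightarrow> ('r, unit) instrument" where
  "prepare a q =
     map (\<lambda>s. ((), \<lambda>\<psi> b. pm_amp False a (q \<in> b) * \<psi> (set_qubit q s b))) [False, True]"

definition measure_pm :: "int \<Rightarrow> 'r \<Rightarrow> ('r, bool) instrument" where
  "measure_pm a q = map (\<lambda>m. (m, \<lambda>\<psi> b. pm_amp m a (q \<in> b) *
     (cnj (pm_amp m a False) * \<psi> (set_qubit q False b) +
      cnj (pm_amp m a True) * \<psi> (set_qubit q True b)))) [False, True]"


section \<open>Abstract cryptography\<close>

text \<open>
  Resources run in synchronous rounds.  In round \<open>t\<close> every party \<open>p\<close> hands to the resource a
  classical message (\<open>None\<close> is silence) and the qubits in \<open>in_port t p\<close>, and then obtains a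
  classical message and the qubits in \<open>out_port t p\<close>.  Besides the wires on which qubits are
  exchanged, distinguishers and simulators have private quantum memory of unlimited size.
\<close>

datatype 'w reg = Wire 'w | SimMem nat | DistMem nat

record ('p, 'w, 'x, 's) resource =
  rounds :: nat
  in_port :: "nat \<Rightarrow> 'p \<Rightarrow> 'w set"
  out_port :: "nat \<Rightarrow> 'p \<Rightarrow> 'w set"
  res_init :: 's
  res_step :: "nat \<Rightarrow> 's \<Rightarrow> ('p \<rightharpoonup> 'x) \<Rightarrow> ('w reg, 's \<times> ('p \<rightharpoonup> 'x)) instrument"

text \<open>
  A converter is attached to the interfaces of a set of parties; \<open>pre\<close> treats what goes from the
  outside to the resource, and \<open>post\<close> what comes back.
\<close>

record ('p, 'w, 'x, 's) converter =
  conv_in :: "nat \<Rightarrow> 'p \<Rightarrow> 'w set"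
  conv_out :: "nat \<Rightarrow> 'p \<Rightarrow> 'w set"
  conv_init :: 's
  conv_pre :: "nat \<Rightarrow> 's \<Rightarrow> ('p \<rightharpoonup> 'x) \<Rightarrow> ('w reg, 's \<times> ('p \<rightharpoonup> 'x)) instrument"
  conv_post :: "nat \<Rightarrow> 's \<Rightarrow> ('p \<rightharpoonup> 'x) \<Rightarrow> ('w reg, 's \<times> ('p \<rightharpoonup> 'x)) instrument"

definition attach ::
  "'p set \<Rightarrow> ('p, 'w, 'x, 'c) converter \<Rightarrow> ('p, 'w, 'x, 's) resource \<Rightarrow> ('p, 'w, 'x, 'c \<times> 's) resource"
where
  "attach S C R = \<lparr>
     rounds = rounds R,
     in_port = (\<lambda>t p. if p \<in> S then conv_in C t p else in_port R t p),
     out_port = (\<lambda>t p. if p \<in> S then conv_out C t p else out_port R t p),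
     res_init = (conv_init C, res_init R),
     res_step = (\<lambda>t (c, s) m.
       ibind (conv_pre C t c (m |` S)) (\<lambda>(c1, m1).
       ibind (res_step R t s (override_on m m1 S)) (\<lambda>(s', m2).
       ibind (conv_post C t c1 (m2 |` S)) (\<lambda>(c2, m3).
       ireturn ((c2, s'), override_on m2 m3 S))))) \<rparr>"

text \<open>The instructions of one party, and the parallel composition of those of several parties.\<close>

record ('w, 'x, 's) party_protocol =
  party_in :: "nat \<Rightarrow> 'w set"
  party_out :: "nat \<Rightarrow> 'w set"
  party_init :: 's
  party_pre :: "nat \<Rightarrow> 's \<Rightarrow> 'x option \<Rightarrow> ('w reg, 's \<times> 'x option) instrument"
  party_post :: "nat \<Rightarrow> 's \<Rightarrow> 'x option \<Rightarrow> ('w reg, 's \<times> 'x option) instrument"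

primrec run_parties ::
  "'p list \<Rightarrow> ('p \<Rightarrow> 's \<Rightarrow> 'x option \<Rightarrow> ('r, 's \<times> 'x option) instrument) \<Rightarrow>
   ('p \<Rightarrow> 's) \<Rightarrow> ('p \<rightharpoonup> 'x) \<Rightarrow> ('r, ('p \<Rightarrow> 's) \<times> ('p \<rightharpoonup> 'x)) instrument"
where
  "run_parties [] g s m = ireturn (s, m)"
| "run_parties (p # ps) g s m =
     ibind (g p (s p) (m p)) (\<lambda>(s', x). run_parties ps g (s(p := s')) (m(p := x)))"

definition parallel ::
  "'p list \<Rightarrow> ('p \<Rightarrow> ('w, 'x, 's) party_protocol) \<Rightarrow> ('p, 'w, 'x, 'p \<Rightarrow> 's) converter"
where
  "parallel ps \<pi> = \<lparr>
     conv_in = (\<lambda>t p. party_in (\<pi> p) t),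
     conv_out = (\<lambda>t p. party_out (\<pi> p) t),
     conv_init = (\<lambda>p. party_init (\<pi> p)),
     conv_pre = (\<lambda>t. run_parties ps (\<lambda>p. party_pre (\<pi> p) t)),
     conv_post = (\<lambda>t. run_parties ps (\<lambda>p. party_post (\<pi> p) t)) \<rparr>"

definition run_by ::
  "'p list \<Rightarrow> ('p \<Rightarrow> ('w, 'x, 'c) party_protocol) \<Rightarrow> ('p, 'w, 'x, 's) resource \<Rightarrow>
   ('p, 'w, 'x, ('p \<Rightarrow> 'c) \<times> 's) resource"
where
  "run_by ps \<pi> R = attach (set ps) (parallel ps \<pi>) R"


subsection \<open>Distinguishers\<close>

text \<open>
  A distinguisher controls all open interfaces.  Its operation may depend on the whole classical
  history: for each past round the messages it sent, its own measurement outcome, and the messages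
  it received.  After the last round it acts once more, and its output bit is 1 iff the outcome is 1.
\<close>

type_synonym ('p, 'x) history = "(('p \<rightharpoonup> 'x) \<times> nat \<times> ('p \<rightharpoonup> 'x)) list"
type_synonym ('p, 'w, 'x) distinguisher =
  "('p, 'x) history \<Rightarrow> ('w reg, ('p \<rightharpoonup> 'x) \<times> nat) instrument"

text \<open>Qubits held by the environment between the rounds \<open>t - 1\<close> and \<open>t\<close>.\<close>

definition open_wires :: "('p, 'w, 'x, 's) resource \<Rightarrow> nat \<Rightarrow> 'w set" where
  "open_wires A t = (if t < rounds A then \<Union>p. in_port A t p else {}) \<union>
     (if t = 0 then {} else \<Union>p. out_port A (t - 1) p)"

definition is_distinguisher ::
  "('p, 'w, 'x, 's) resource \<Rightarrow> ('p, 'w, 'x) distinguisher \<Rightarrow> bool" where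
  "is_distinguisher A D \<longleftrightarrow> (\<forall>h. length h \<le> rounds A \<longrightarrow>
     instrument_on (range DistMem \<union> Wire ` open_wires A (length h)) (D h))"

primrec play ::
  "('p, 'w, 'x) distinguisher \<Rightarrow> ('p, 'w, 'x, 's) resource \<Rightarrow> nat \<Rightarrow> ('p, 'x) history \<Rightarrow> 's \<Rightarrow>
   ('w reg, bool) instrument"
where
  "play D A 0 h s = map (\<lambda>((m, l), K). (l = 1, K)) (D h)"
| "play D A (Suc k) h s =
     ibind (D h) (\<lambda>(m, l).
     ibind (res_step A (length h) s m) (\<lambda>(s', m').
     play D A k (h @ [(m, l, m')]) s'))"

definition prob_one :: "('p, 'w, 'x) distinguisher \<Rightarrow> ('p, 'w, 'x, 's) resource \<Rightarrow> real" where
  "prob_one D A = (\<Sum>(b, K)\<leftarrow>play D A (rounds A) [] (res_init A).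
     if b then norm2 (K (basis_ket {})) else 0)"

definition matching :: "('p, 'w, 'x, 's) resource \<Rightarrow> ('p, 'w, 'x, 'u) resource \<Rightarrow> bool" where
  "matching A B \<longleftrightarrow> rounds A = rounds B \<and>
     (\<forall>t<rounds A. in_port A t = in_port B t \<and> out_port A t = out_port B t)"

definition indistinguishable ::
  "real \<Rightarrow> ('p, 'w, 'x, 's) resource \<Rightarrow> ('p, 'w, 'x, 'u) resource \<Rightarrow> bool" where
  "indistinguishable \<epsilon> A B \<longleftrightarrow> matching A B \<and>
     (\<forall>D. is_distinguisher A D \<longrightarrow> \<bar>prob_one D A - prob_one D B\<bar> \<le> \<epsilon>)"


subsection \<open>Secure construction\<close>

text \<open>
  A simulator for the coalition \<open>M\<close> is an arbitrary joint converter at the interfaces of \<open>M\<close>.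
  Its classical memory is a list of messages; its quantum memory consists of the qubits \<open>SimMem k\<close>.
\<close>

definition is_simulator ::
  "'p set \<Rightarrow> ('p, 'w, 'x, 's) resource \<Rightarrow> ('p, 'w, 'x, 'x list) converter \<Rightarrow> bool" where
  "is_simulator M R \<sigma> \<longleftrightarrow> (\<forall>t<rounds R. \<forall>c m.
     instrument_on (range SimMem \<union> Wire ` (\<Union>p\<in>M. conv_in \<sigma> t p \<union> in_port R t p))
       (conv_pre \<sigma> t c m) \<and>
     instrument_on (range SimMem \<union> Wire ` (\<Union>p\<in>M. conv_out \<sigma> t p \<union> out_port R t p))
       (conv_post \<sigma> t c m))"

text \<open>
  \<open>filt\<close> is the filter \<open>\<bottom>\<close>; in the soundness condition it covers the interfaces of the honest
  parties, whose malicious inputs are not available to the distinguisher.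
\<close>

definition securely_constructs ::
  "real \<Rightarrow> 'p list \<Rightarrow> 'p set set \<Rightarrow> ('p \<Rightarrow> ('w, 'x, 'c) party_protocol) \<Rightarrow>
   ('p, 'w, 'x, 's) resource \<Rightarrow> ('p, 'w, 'x, 'u) resource \<Rightarrow>
   ('p \<Rightarrow> ('w, 'x, 'f) party_protocol) \<Rightarrow> bool"
where
  "securely_constructs \<epsilon> ps Adv \<pi> R\<^sub>0 R\<^sub>1 filt \<longleftrightarrow>
     indistinguishable \<epsilon> (run_by ps \<pi> R\<^sub>0) (run_by ps filt R\<^sub>1) \<and>
     (\<forall>M\<in>Adv. let hs = filter (\<lambda>p. p \<notin> M) ps in
        \<exists>\<sigma>. is_simulator M (run_by hs filt R\<^sub>1) \<sigma> \<and>
          indistinguishable \<epsilon> (run_by hs \<pi> R\<^sub>0) (attach M \<sigma> (run_by hs filt R\<^sub>1)))"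


section \<open>Multi-client blind quantum computation\<close>

datatype party = Server | Client nat

text \<open>
  Public information.  Client \<open>j\<close> (for \<open>j < clients\<close>) owns the inputs \<open>ins j\<close>, obtains the
  output qubits \<open>outs j\<close>, and obtains the classical outcomes of the vertices \<open>results j\<close>.
  The function \<open>describe\<close> maps the descriptions contributed by the clients (one bit string per
  client) to the angles and the flow on which the clients thereby agree.
\<close>

record 'v public_info =
  clients :: nat
  verts :: "'v set"
  edges :: "'v set set"
  ins :: "nat \<Rightarrow> 'v set"
  outs :: "nat \<Rightarrow> 'v set"
  results :: "nat \<Rightarrow> 'v set"
  prec :: "'v rel"
  prep_order :: "'v list"
  meas_order :: "'v list"
  describe :: "bool list list \<Rightarrow> ('v \<Rightarrow> int) \<times> ('v \<Rightarrow> 'v)"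

definition in_verts :: "'v public_info \<Rightarrow> 'v set" where
  "in_verts P = (\<Union>j<clients P. ins P j)"

definition out_verts :: "'v public_info \<Rightarrow> 'v set" where
  "out_verts P = (\<Union>j<clients P. outs P j)"

definition is_flow :: "'v public_info \<Rightarrow> ('v \<Rightarrow> 'v) \<Rightarrow> bool" where
  "is_flow P f \<longleftrightarrow>
     f ` (verts P - out_verts P) \<subseteq> verts P - in_verts P \<and>
     inj_on f (verts P - out_verts P) \<and>
     (\<forall>v\<in>verts P - out_verts P.
        {v, f v} \<in> edges P \<and> v \<noteq> f v \<and> (v, f v) \<in> prec P \<and>
        (\<forall>w. {w, f v} \<in> edges P \<and> w \<noteq> v \<longrightarrow> (v, w) \<in> prec P))"

definition well_formed :: "'v public_info \<Rightarrow> bool" where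
  "well_formed P \<longleftrightarrow>
     finite (verts P) \<and>
     (\<forall>e\<in>edges P. e \<subseteq> verts P \<and> card e = 2) \<and>
     in_verts P \<subseteq> verts P \<and> disjoint_family_on (ins P) {..<clients P} \<and>
     out_verts P \<subseteq> verts P \<and> disjoint_family_on (outs P) {..<clients P} \<and>
     (\<Union>j<clients P. results P j) = verts P - out_verts P \<and>
     partial_order_on (verts P) (prec P) \<and>
     distinct (prep_order P) \<and> set (prep_order P) = verts P \<and>
     distinct (meas_order P) \<and> set (meas_order P) = verts P - out_verts P \<and>
     sorted_wrt (\<lambda>v w. (w, v) \<notin> prec P) (meas_order P) \<and>
     (\<forall>ds. length ds = clients P \<longrightarrow> is_flow P (snd (describe P ds)))"

definition parties :: "'v public_info \<Rightarrow> party list" where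
  "parties P = Server # map Client [0..<clients P]"


subsection \<open>Messages\<close>

text \<open>
  The wire \<open>Qubit v\<close> carries the qubit of the vertex \<open>v\<close> from party to party; the wires
  \<open>Psi p k\<close> carry the share of party \<open>p\<close> of the state that malicious parties send to the ideal
  resource.
\<close>

datatype 'v wire = Qubit 'v | Psi party nat

abbreviation vq :: "'v \<Rightarrow> 'v wire reg" where
  "vq v \<equiv> Wire (Qubit v)"

text \<open>Input of one client: its bits, and its contribution to the description of the computation.\<close>

type_synonym 'v client_input = "('v \<Rightarrow> bool) \<times> bool list"

text \<open>
  The map \<open>\<E>\<close>: for every basis state \<open>x\<close> of the classical inputs, an instrument on \<open>\<psi>\<close>
  whose outcome consists of the classical output strings of the clients.
\<close>

type_synonym 'v attack_map =
  "(nat \<Rightarrow> 'v client_input) \<Rightarrow> ('v wire reg, nat \<Rightarrow> bool list) instrument"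

datatype 'v msg =
    Input "'v client_input"
  | Angle int
  | Bit bool
  | Result "bool list" "'v \<Rightarrow> int \<times> bool"
  | Output "bool list"
  | FlaggedInput bool "'v client_input"
  | Flag bool
  | Attack "'v attack_map"

text \<open>Messages of the wrong form are replaced by default values.\<close>

definition angle_of :: "'v msg option \<Rightarrow> int" where
  "angle_of x = (case x of Some (Angle a) \<Rightarrow> a | _ \<Rightarrow> 0)"

definition bit_of :: "'v msg option \<Rightarrow> bool" where
  "bit_of x = (case x of Some (Bit b) \<Rightarrow> b | _ \<Rightarrow> False)"

definition input_of :: "'v msg option \<Rightarrow> 'v client_input" where
  "input_of x = (case x of Some (Input i) \<Rightarrow> i | _ \<Rightarrow> (\<lambda>_. False, []))"

definition restrict_input :: "'v public_info \<Rightarrow> nat \<Rightarrow> 'v client_input \<Rightarrow> 'v client_input" where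
  "restrict_input P j i = (\<lambda>v. v \<in> ins P j \<and> fst i v, snd i)"

definition input_bit :: "'v public_info \<Rightarrow> (nat \<Rightarrow> 'v client_input) \<Rightarrow> 'v \<Rightarrow> bool" where
  "input_bit P x v \<longleftrightarrow> (\<exists>j<clients P. v \<in> ins P j \<and> fst (x j) v)"

definition description ::
  "'v public_info \<Rightarrow> (nat \<Rightarrow> 'v client_input) \<Rightarrow> ('v \<Rightarrow> int) \<times> ('v \<Rightarrow> 'v)" where
  "description P x = describe P (map (\<lambda>j. snd (x j)) [0..<clients P])"


subsection \<open>The target computation\<close>

definition s_X :: "'v public_info \<Rightarrow> ('v \<Rightarrow> 'v) \<Rightarrow> ('v \<Rightarrow> bool) \<Rightarrow> 'v \<Rightarrow> bool" where
  "s_X P f m v \<longleftrightarrow> v \<in> f ` (verts P - out_verts P) \<and>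
     m (inv_into (verts P - out_verts P) f v)"

definition s_Z :: "'v public_info \<Rightarrow> ('v \<Rightarrow> 'v) \<Rightarrow> ('v \<Rightarrow> bool) \<Rightarrow> 'v \<Rightarrow> bool" where
  "s_Z P f m v \<longleftrightarrow>
     odd (card {w \<in> verts P - out_verts P. w \<noteq> v \<and> {v, f w} \<in> edges P \<and> m w})"

definition corrected_angle ::
  "'v public_info \<Rightarrow> ('v \<Rightarrow> int) \<Rightarrow> ('v \<Rightarrow> 'v) \<Rightarrow> ('v \<Rightarrow> bool) \<Rightarrow> 'v \<Rightarrow> int" where
  "corrected_angle P \<phi> f m v =
     (if s_X P f m v then - \<phi> v else \<phi> v) + (if s_Z P f m v then 4 else 0)"

definition entangle :: "'v public_info \<Rightarrow> ('v wire reg, unit) instrument" where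
  "entangle P = gate (CZ_all ((`) vq ` edges P))"

definition classical_output :: "'v public_info \<Rightarrow> nat \<Rightarrow> ('v \<Rightarrow> bool) \<Rightarrow> bool list" where
  "classical_output P j m = map m (filter (\<lambda>v. v \<in> results P j) (meas_order P))"

primrec measure_pattern ::
  "'v public_info \<Rightarrow> ('v \<Rightarrow> int) \<Rightarrow> ('v \<Rightarrow> 'v) \<Rightarrow> 'v list \<Rightarrow> ('v \<Rightarrow> bool) \<Rightarrow>
   ('v wire reg, 'v \<Rightarrow> bool) instrument"
where
  "measure_pattern P \<phi> f [] m = ireturn m"
| "measure_pattern P \<phi> f (v # vs) m =
     ibind (measure_pm (corrected_angle P \<phi> f m v) (vq v)) (\<lambda>b.
     measure_pattern P \<phi> f vs (m(v := b)))"

text \<open>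
  The map \<open>\<U>\<close>: the measurement pattern with the given angles and flow, applied to the input state
  in which vertex \<open>v\<close> is \<open>|+\<rangle>\<close> or \<open>|-\<rangle>\<close> according to its input bit.  It produces the
  classical outcomes and the byproduct-corrected qubits of the output vertices.
\<close>

definition target_map ::
  "'v public_info \<Rightarrow> (nat \<Rightarrow> 'v client_input) \<Rightarrow> ('v wire reg, nat \<Rightarrow> bool list) instrument"
where
  "target_map P x = (case description P x of (\<phi>, f) \<Rightarrow>
     ibind (for_each (prep_order P) (\<lambda>v. prepare (if input_bit P x v then 4 else 0) (vq v))) (\<lambda>_.
     ibind (entangle P) (\<lambda>_.
     ibind (measure_pattern P \<phi> f (meas_order P) (\<lambda>_. False)) (\<lambda>m.
     ibind (for_each (filter (\<lambda>v. v \<in> out_verts P) (prep_order P)) (\<lambda>v. gate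
        ((if s_X P f m v then X_gate (vq v) else id) \<circ> Rz (if s_Z P f m v then 4 else 0) (vq v)))) (\<lambda>_.
     ireturn (\<lambda>j. classical_output P j m))))))"


subsection \<open>Schedule of the rounds\<close>

text \<open>
  \<open>Shares v\<close>, \<open>Send v\<close>, \<open>Hop v 0\<close>, ..., \<open>Correction v\<close> form the collaborative remote
  state rotation that produces the qubit of \<open>v\<close>.  In the last round the server sends the output
  qubits while the classical outputs and the decryption keys are distributed.
\<close>

datatype 'v round_kind =
    Inputs
  | Shares 'v
  | Send 'v
  | Hop 'v nat
  | Correction 'v
  | Entangle
  | Delta 'v
  | Outcome 'v
  | Outputs

definition schedule :: "'v public_info \<Rightarrow> 'v round_kind list" where
  "schedule P = [Inputs] @
     concat (map (\<lambda>v. [Shares v, Send v] @ map (Hop v) [0..<clients P] @ [Correction v])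
       (prep_order P)) @
     [Entangle] @
     concat (map (\<lambda>v. [Delta v, Outcome v]) (meas_order P)) @
     [Outputs]"


subsection \<open>The real resource: classical SMPC and secure channels\<close>

text \<open>
  The instructions of the orchestrator, carried out by the SMPC resource.  The quantum channels
  appear in the ports only: a qubit that enters at the sender leaves at the receiver.
\<close>

record 'v smpc_state =
  smpc_input :: "nat \<Rightarrow> 'v client_input"
  smpc_theta :: "'v \<Rightarrow> int"
  smpc_sum :: "'v \<Rightarrow> int"
  smpc_r :: "'v \<Rightarrow> bool"
  smpc_m :: "'v \<Rightarrow> bool"

definition smpc_init :: "'v smpc_state" where
  "smpc_init = \<lparr> smpc_input = (\<lambda>_. (\<lambda>_. False, [])), smpc_theta = (\<lambda>_. 0), smpc_sum = (\<lambda>_. 0),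
     smpc_r = (\<lambda>_. False), smpc_m = (\<lambda>_. False) \<rparr>"

definition smpc_delta :: "'v public_info \<Rightarrow> 'v smpc_state \<Rightarrow> bool \<Rightarrow> 'v \<Rightarrow> int" where
  "smpc_delta P s r v = (case description P (smpc_input s) of (\<phi>, f) \<Rightarrow>
     (corrected_angle P \<phi> f (smpc_m s) v + smpc_theta s v +
      (of_bool r + of_bool (input_bit P (smpc_input s) v)) * 4) mod 8)"

text \<open>
  The key of an output vertex is an angle to be rotated back and a bit that tells whether \<open>X\<close> is
  to be applied.  The bit \<open>x(v)\<close> matters for vertices that are both input and output; they are not
  measured, so that \<open>x(v)\<close> does not enter through \<open>\<delta>(v)\<close>.
\<close>

definition smpc_key :: "'v public_info \<Rightarrow> 'v smpc_state \<Rightarrow> 'v \<Rightarrow> int \<times> bool" where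
  "smpc_key P s v = (case description P (smpc_input s) of (\<phi>, f) \<Rightarrow>
     ((smpc_theta s v +
       (of_bool (s_Z P f (smpc_m s) v) + of_bool (input_bit P (smpc_input s) v)) * 4) mod 8,
      s_X P f (smpc_m s) v))"

definition smpc_step ::
  "'v public_info \<Rightarrow> nat \<Rightarrow> 'v smpc_state \<Rightarrow> (party \<rightharpoonup> 'v msg) \<Rightarrow>
   ('v wire reg, 'v smpc_state \<times> (party \<rightharpoonup> 'v msg)) instrument"
where
  "smpc_step P t s msg = (case schedule P ! t of
     Inputs \<Rightarrow>
       ireturn (s\<lparr>smpc_input := \<lambda>j. restrict_input P j (input_of (msg (Client j)))\<rparr>, Map.empty)
   | Shares v \<Rightarrow> ibind (sample angles) (\<lambda>a.
       ireturn (s\<lparr>smpc_theta := (smpc_theta s)(v := a),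
         smpc_sum := (smpc_sum s)(v := \<Sum>j<clients P. angle_of (msg (Client j)))\<rparr>, Map.empty))
   | Correction v \<Rightarrow>
       ireturn (s, [Server \<mapsto> Angle ((smpc_theta s v - smpc_sum s v) mod 8)])
   | Delta v \<Rightarrow> ibind (sample [False, True]) (\<lambda>r.
       ireturn (s\<lparr>smpc_r := (smpc_r s)(v := r)\<rparr>, [Server \<mapsto> Angle (smpc_delta P s r v)]))
   | Outcome v \<Rightarrow>
       ireturn (s\<lparr>smpc_m := (smpc_m s)(v := (bit_of (msg Server) \<noteq> smpc_r s v))\<rparr>, Map.empty)
   | Outputs \<Rightarrow>
       ireturn (s, \<lambda>p. case p of
           Client j \<Rightarrow> if j < clients P
             then Some (Result (classical_output P j (smpc_m s))
               (\<lambda>v. if v \<in> outs P j then smpc_key P s v else (0, False)))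
             else None
         | Server \<Rightarrow> None)
   | _ \<Rightarrow> ireturn (s, Map.empty))"

definition channel_in :: "'v public_info \<Rightarrow> nat \<Rightarrow> party \<Rightarrow> 'v wire set" where
  "channel_in P t p = (case schedule P ! t of
     Send v \<Rightarrow> if p = Server then {Qubit v} else {}
   | Hop v j \<Rightarrow> if p = Client j then {Qubit v} else {}
   | Outputs \<Rightarrow> if p = Server then Qubit ` out_verts P else {}
   | _ \<Rightarrow> {})"

definition output_wires :: "'v public_info \<Rightarrow> party \<Rightarrow> 'v wire set" where
  "output_wires P p =
     (case p of Client j \<Rightarrow> if j < clients P then Qubit ` outs P j else {} | Server \<Rightarrow> {})"

definition channel_out :: "'v public_info \<Rightarrow> nat \<Rightarrow> party \<Rightarrow> 'v wire set" where
  "channel_out P t p = (case schedule P ! t of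
     Send v \<Rightarrow> if p = Client 0 then {Qubit v} else {}
   | Hop v j \<Rightarrow> if p = (if Suc j < clients P then Client (Suc j) else Server) then {Qubit v} else {}
   | Outputs \<Rightarrow> output_wires P p
   | _ \<Rightarrow> {})"

definition smpc_resource :: "'v public_info \<Rightarrow> (party, 'v wire, 'v msg, 'v smpc_state) resource" where
  "smpc_resource P = \<lparr>
     rounds = length (schedule P),
     in_port = channel_in P,
     out_port = channel_out P,
     res_init = smpc_init,
     res_step = smpc_step P \<rparr>"


subsection \<open>The protocol\<close>

record 'v local_state =
  share :: "'v \<Rightarrow> int"
  outcome :: "'v \<Rightarrow> bool"

definition output_port :: "'v public_info \<Rightarrow> party \<Rightarrow> nat \<Rightarrow> 'v wire set" where
  "output_port P p t = (if schedule P ! t = Outputs then output_wires P p else {})"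

definition client_pre ::
  "'v public_info \<Rightarrow> nat \<Rightarrow> nat \<Rightarrow> 'v local_state \<Rightarrow> 'v msg option \<Rightarrow>
   ('v wire reg, 'v local_state \<times> 'v msg option) instrument"
where
  "client_pre P j t s x = (case schedule P ! t of
     Inputs \<Rightarrow> ireturn (s, Some (Input (input_of x)))
   | Shares v \<Rightarrow> ibind (sample angles) (\<lambda>a.
       ireturn (s\<lparr>share := (share s)(v := a)\<rparr>, Some (Angle a)))
   | Hop v i \<Rightarrow>
       if i = j then ibind (gate (Rz (share s v) (vq v))) (\<lambda>_. ireturn (s, None))
       else ireturn (s, None)
   | _ \<Rightarrow> ireturn (s, None))"

definition client_post ::
  "'v public_info \<Rightarrow> nat \<Rightarrow> nat \<Rightarrow> 'v local_state \<Rightarrow> 'v msg option \<Rightarrow>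
   ('v wire reg, 'v local_state \<times> 'v msg option) instrument"
where
  "client_post P j t s x = (case (schedule P ! t, x) of
     (Outputs, Some (Result y key)) \<Rightarrow>
       ibind (for_each (filter (\<lambda>v. v \<in> outs P j) (prep_order P)) (\<lambda>v. gate
         ((if snd (key v) then X_gate (vq v) else id) \<circ> Rz (- fst (key v)) (vq v)))) (\<lambda>_.
       ireturn (s, Some (Output y)))
   | _ \<Rightarrow> ireturn (s, None))"

definition server_pre ::
  "'v public_info \<Rightarrow> nat \<Rightarrow> 'v local_state \<Rightarrow> 'v msg option \<Rightarrow>
   ('v wire reg, 'v local_state \<times> 'v msg option) instrument"
where
  "server_pre P t s x = (case schedule P ! t of
     Send v \<Rightarrow> ibind (prepare 0 (vq v)) (\<lambda>_. ireturn (s, None))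
   | Entangle \<Rightarrow> ibind (entangle P) (\<lambda>_. ireturn (s, None))
   | Outcome v \<Rightarrow> ireturn (s, Some (Bit (outcome s v)))
   | _ \<Rightarrow> ireturn (s, None))"

definition server_post ::
  "'v public_info \<Rightarrow> nat \<Rightarrow> 'v local_state \<Rightarrow> 'v msg option \<Rightarrow>
   ('v wire reg, 'v local_state \<times> 'v msg option) instrument"
where
  "server_post P t s x = (case schedule P ! t of
     Correction v \<Rightarrow> ibind (gate (Rz (angle_of x) (vq v))) (\<lambda>_. ireturn (s, None))
   | Delta v \<Rightarrow> ibind (measure_pm (angle_of x) (vq v)) (\<lambda>b.
       ireturn (s\<lparr>outcome := (outcome s)(v := b)\<rparr>, None))
   | _ \<Rightarrow> ireturn (s, None))"

definition mcbqc_protocol ::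
  "'v public_info \<Rightarrow> party \<Rightarrow> ('v wire, 'v msg, 'v local_state) party_protocol" where
  "mcbqc_protocol P p = \<lparr>
     party_in = (\<lambda>_. {}),
     party_out = output_port P p,
     party_init = \<lparr>share = (\<lambda>_. 0), outcome = (\<lambda>_. False)\<rparr>,
     party_pre = (case p of Server \<Rightarrow> server_pre P | Client j \<Rightarrow> client_pre P j),
     party_post = (case p of Server \<Rightarrow> server_post P | Client j \<Rightarrow> client_post P j) \<rparr>"


subsection \<open>The ideal resource\<close>

record 'v ideal_state =
  ideal_input :: "nat \<Rightarrow> 'v client_input"
  malicious :: "party set"

definition flag_of :: "'v msg option \<Rightarrow> bool" where
  "flag_of x = (case x of Some (FlaggedInput c i) \<Rightarrow> c | Some (Flag c) \<Rightarrow> c | _ \<Rightarrow> False)"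

definition flagged_input_of :: "'v msg option \<Rightarrow> 'v client_input" where
  "flagged_input_of x = (case x of Some (FlaggedInput c i) \<Rightarrow> i | _ \<Rightarrow> (\<lambda>_. False, []))"

text \<open>
  Admissible maps \<open>\<E>\<close>: quantum operations that act on the state sent by the malicious parties and
  on the output qubits of the clients; the classical output of an honest client has the right
  length, that of a malicious client is arbitrary.
\<close>

definition valid_attack :: "'v public_info \<Rightarrow> party set \<Rightarrow> 'v attack_map \<Rightarrow> bool" where
  "valid_attack P mal E \<longleftrightarrow> (\<forall>x.
     instrument_on (Wire ` ({Psi p k | p k. p \<in> mal} \<union> Qubit ` out_verts P)) (E x) \<and>
     (\<forall>(y, K)\<in>set (E x). \<forall>j<clients P. Client j \<notin> mal \<longrightarrow>
        length (y j) = length (classical_output P j (\<lambda>_. False))))"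

text \<open>
  The malicious parties act jointly: the map is read from the first of them (in the order of
  \<open>parties\<close>) that sends one.  If none sends an admissible map, the correct output is computed.
\<close>

definition joint_attack :: "'v public_info \<Rightarrow> party set \<Rightarrow> (party \<rightharpoonup> 'v msg) \<Rightarrow> 'v attack_map" where
  "joint_attack P mal msg =
     (case concat (map (\<lambda>p. case msg p of Some (Attack E) \<Rightarrow> if p \<in> mal then [E] else [] | _ \<Rightarrow> [])
        (parties P)) of
        E # _ \<Rightarrow> if valid_attack P mal E then E else target_map P
      | [] \<Rightarrow> target_map P)"

definition mcbqc_step ::
  "'v public_info \<Rightarrow> nat \<Rightarrow> 'v ideal_state \<Rightarrow> (party \<rightharpoonup> 'v msg) \<Rightarrow>
   ('v wire reg, 'v ideal_state \<times> (party \<rightharpoonup> 'v msg)) instrument"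
where
  "mcbqc_step P t s msg = (case schedule P ! t of
     Inputs \<Rightarrow>
       ireturn (\<lparr>ideal_input = (\<lambda>j. restrict_input P j (flagged_input_of (msg (Client j)))),
         malicious = {p \<in> set (parties P). flag_of (msg p)}\<rparr>, Map.empty)
   | Outputs \<Rightarrow>
       ibind ((if malicious s = {} then target_map P else joint_attack P (malicious s) msg)
         (ideal_input s)) (\<lambda>y.
       ireturn (s, \<lambda>p. case p of
           Client j \<Rightarrow> if j < clients P then Some (Output (y j)) else None
         | Server \<Rightarrow> None))
   | _ \<Rightarrow> ireturn (s, Map.empty))"

definition mcbqc_resource ::
  "'v public_info \<Rightarrow> (party, 'v wire, 'v msg, 'v ideal_state) resource" where
  "mcbqc_resource P = \<lparr>
     rounds = length (schedule P),
     in_port = (\<lambda>t p. if schedule P ! t = Outputs \<and> p \<in> set (parties P) then range (Psi p) else {}),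
     out_port = (\<lambda>t p. output_port P p t),
     res_init = \<lparr>ideal_input = (\<lambda>_. (\<lambda>_. False, [])), malicious = {}\<rparr>,
     res_step = mcbqc_step P \<rparr>"

definition filter_pre ::
  "'v public_info \<Rightarrow> party \<Rightarrow> nat \<Rightarrow> unit \<Rightarrow> 'v msg option \<Rightarrow>
   ('v wire reg, unit \<times> 'v msg option) instrument"
where
  "filter_pre P p t s x = ireturn ((), case (schedule P ! t, p) of
     (Inputs, Client j) \<Rightarrow> Some (FlaggedInput False (input_of x))
   | (Inputs, Server) \<Rightarrow> Some (Flag False)
   | _ \<Rightarrow> None)"

definition mcbqc_filter :: "'v public_info \<Rightarrow> party \<Rightarrow> ('v wire, 'v msg, unit) party_protocol" where
  "mcbqc_filter P p = \<lparr>
     party_in = (\<lambda>_. {}),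
     party_out = output_port P p,
     party_init = (),
     party_pre = filter_pre P p,
     party_post = (\<lambda>t s x. ireturn ((), x)) \<rparr>"


subsection \<open>Adversarial patterns\<close>

definition server_and_all_but_one_client :: "'v public_info \<Rightarrow> party set set" where
  "server_and_all_but_one_client P =
     {M. M \<subseteq> set (parties P) \<and> card (M - {Server}) \<le> clients P - 1}"

end

theory Submission
  imports Defs "HOL-Library.Countable_Set" "HOL-Library.Multiset"
begin

text \<open>
  Against a coalition \<open>M\<close> fix an honest client \<open>h\<close>.  The correction angle \<open>\<theta> - \<Sum>\<theta>\<^sub>j\<close> is
  masked by \<open>\<theta>\<close>, so it can be drawn first; what remains secret about a vertex is the random rotation
  applied by \<open>h\<close>.  This rotation dephases the qubit just as a controlled-X onto a fresh
  ancilla does, the angle being the outcome of a later measurement of the ancilla.  Since \<open>\<delta>\<close> is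
  masked by this angle, it can be sent as a uniformly random number, and the ancilla can be measured
  at the very end, in a basis that depends on \<open>\<phi>\<close>, \<open>x\<close> and \<open>\<delta>\<close>; the outcome is \<open>r\<close>.  Before the last
  round the resulting game does not look at the honest inputs, hence a simulator can play it, and it
  leaves the last round to the map \<open>\<E>\<close>, which knows the inputs.

  If nobody is malicious, the phases by which the qubits differ from those of the plain measurement
  pattern are known at every time; taking them off turns the protocol into the plain pattern,
  all of whose gates can be postponed to the last round.
\<close>

text \<open>Every change of game is an instance of one simulation argument: one game owes the other
  an instrument that avoids all registers within reach of the distinguisher, hence commutes with its
  moves, and that is carried along from round to round. The ancillas cannot be postponed all at
  once, because the angle of a vertex depends on the true outcomes of earlier vertices. They are
  postponed one at a time, from the last measured vertex to the first. When the turn of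
  \<open>v\<close> comes, the vertices whose angles depend on its outcome no longer evaluate them
  before the last round, while the outcomes on which \<open>v\<close> depends are still final on
  time. A late evaluation must return the angle of the proper round, so it reads only outcomes of
  earlier vertices. The hybrid games act on the wires of the vertices, but a simulator reaches only
  its own memory and the open ports of the coalition. Qubits in honest hands are therefore swapped
  into that memory, and in the last round into the state \<open>\<psi>\<close> on which the attack
  map acts.\<close>

section \<open>Instruments as expectation transformers\<close>

text \<open>The functional \<open>f\<close> receives the outcome together with the unnormalised
  branch, so the whole rest of a game can be plugged in for it. Comparing these values instead of
  lists is blind to the order and the splitting of Kraus operators.\<close>

definition expect :: "('r, 'o) instrument \<Rightarrow> ('o \<Rightarrow> 'r ket \<Rightarrow> real) \<Rightarrow> 'r ket \<Rightarrow> real" where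
  "expect I f \<psi> = (\<Sum>(x, K)\<leftarrow>I. f x (K \<psi>))"

definition imap :: "('a \<Rightarrow> 'b) \<Rightarrow> ('r, 'a) instrument \<Rightarrow> ('r, 'b) instrument" where
  "imap g I = map (\<lambda>(x, K). (g x, K)) I"

lemma expect_Nil [simp]: "expect [] f = (\<lambda>_. 0)"
  and expect_Cons [simp]: "expect ((x, K) # I) f \<psi> = f x (K \<psi>) + expect I f \<psi>"
  and expect_append [simp]: "expect (I @ J) f \<psi> = expect I f \<psi> + expect J f \<psi>"
  by (simp_all add: expect_def fun_eq_iff)

lemma expect_ireturn [simp]: "expect (ireturn x) f = f x"
  by (simp add: expect_def ireturn_def fun_eq_iff)

lemma expect_gate [simp]: "expect (gate U) f = (\<lambda>\<psi>. f () (U \<psi>))"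
  by (simp add: expect_def gate_def fun_eq_iff)

lemma ibind_Nil [simp]: "ibind [] J = []"
  and ibind_Cons: "ibind ((x, K) # I) J = map (\<lambda>(y, L). (y, L \<circ> K)) (J x) @ ibind I J"
  by (simp_all add: ibind_def)

lemma expect_ibind [simp]: "expect (ibind I J) f = expect I (\<lambda>x. expect (J x) f)"
proof (rule ext, induction I)
  case (Cons a I)
  obtain x K where a: "a = (x, K)" by (cases a)
  have "expect (map (\<lambda>(y, L). (y, L \<circ> K)) M) f \<psi> = expect M f (K \<psi>)" for M \<psi>
    by (induction M) auto
  then show ?case using Cons by (simp add: a ibind_Cons)
qed simp

lemma expect_imap [simp]: "expect (imap g I) f = expect I (\<lambda>x. f (g x))"
  by (rule ext, induct I) (auto simp: imap_def)

lemma expect_cong: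
  "(\<And>x K. (x, K) \<in> set I \<Longrightarrow> f x (K \<psi>) = g x (K \<psi>)) \<Longrightarrow> expect I f \<psi> = expect I g \<psi>"
  by (induction I) auto

lemma expect_cong_pair:
  assumes "\<And>x y K. ((x, y), K) \<in> set I \<Longrightarrow> f x y (K \<psi>) = g x y (K \<psi>)"
  shows "expect I (\<lambda>(x, y). f x y) \<psi> = expect I (\<lambda>(x, y). g x y) \<psi>"
  using assms by (intro expect_cong) (auto split: prod.splits)

lemma expect_add: "expect I (\<lambda>x \<phi>. f x \<phi> + g x \<phi>) \<psi> = expect I f \<psi> + expect I g \<psi>"
  by (induction I) auto

lemma expect_zero: "expect I (\<lambda>x \<phi>. 0) \<psi> = 0"
  by (induction I) auto

section \<open>Monad laws for instruments\<close>

lemma ibind_ireturn_left [simp]: "ibind (ireturn x) J = J x"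
  by (simp add: ibind_def ireturn_def comp_def)

lemma ibind_ireturn_right [simp]: "ibind I ireturn = I"
  by (induction I) (auto simp: ibind_def ireturn_def comp_def)

lemma ibind_append: "ibind (I @ I') J = ibind I J @ ibind I' J"
  by (simp add: ibind_def)

lemma ibind_assoc: "ibind (ibind I J) L = ibind I (\<lambda>x. ibind (J x) L)"
proof (induction I)
  case (Cons a I)
  obtain x K where a: "a = (x, K)" by (cases a)
  have "ibind (map (\<lambda>(y, K'). (y, K' \<circ> K)) M) L = map (\<lambda>(y, K'). (y, K' \<circ> K)) (ibind M L)" for M
    by (induction M) (auto simp: ibind_Cons comp_def)
  then show ?case using Cons by (simp add: a ibind_Cons ibind_append)
qed simp

lemma imap_eq_ibind: "imap g I = ibind I (\<lambda>x. ireturn (g x))"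
  by (induction I) (auto simp: ibind_def imap_def ireturn_def comp_def)

lemma imap_ibind: "imap g (ibind I J) = ibind I (\<lambda>x. imap g (J x))"
  by (simp add: imap_eq_ibind ibind_assoc)

lemma ibind_imap: "ibind (imap g I) J = ibind I (\<lambda>x. J (g x))"
  by (simp add: imap_eq_ibind ibind_assoc)

lemma imap_ireturn [simp]: "imap g (ireturn x) = ireturn (g x)"
  by (simp add: imap_eq_ibind)

lemma fst_set_imap [simp]: "fst ` set (imap g I) = g ` fst ` set I"
  by (force simp: imap_def)

lemma ibind_cong: "I = I' \<Longrightarrow> (\<And>x. x \<in> fst ` set I' \<Longrightarrow> J x = J' x) \<Longrightarrow> ibind I J = ibind I' J'"
  unfolding ibind_def by (force intro!: arg_cong[where f = concat])

lemma set_ibind: "(z, L) \<in> set (ibind I J) \<longleftrightarrow>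
    (\<exists>x K L'. (x, K) \<in> set I \<and> (z, L') \<in> set (J x) \<and> L = L' \<circ> K)"
  unfolding ibind_def by force

lemma fst_set_ibind: "fst ` set (ibind I J) = (\<Union>x\<in>fst ` set I. fst ` set (J x))"
  unfolding ibind_def by force

lemma fst_set_ireturn [simp]: "fst ` set (ireturn x) = {x}"
  by (simp add: ireturn_def)

lemma fst_set_sample [simp]: "fst ` set (sample xs) = set xs"
  unfolding sample_def by force

section \<open>Local operators\<close>

abbreviation finsupp :: "'r ket \<Rightarrow> bool" where
  "finsupp \<psi> \<equiv> finite {b. \<psi> b \<noteq> 0}"

definition local_op :: "'r set \<Rightarrow> ('r ket \<Rightarrow> 'r ket) \<Rightarrow> bool" where
  "local_op R K \<longleftrightarrow> (\<exists>F k. F \<subseteq> R \<and> finite F \<and> K = op_on F k)"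

definition local_instr :: "'r set \<Rightarrow> ('r, 'o) instrument \<Rightarrow> bool" where
  "local_instr R I \<longleftrightarrow> (\<forall>(x, K)\<in>set I. local_op R K)"

definition complete :: "('r, 'o) instrument \<Rightarrow> bool" where
  "complete I \<longleftrightarrow> (\<forall>\<psi>. finsupp \<psi> \<longrightarrow> expect I (\<lambda>_. norm2) \<psi> = norm2 \<psi>)"

section \<open>Matrices acting on finitely many qubits\<close>

lemma op_on_compose:
  "op_on F k (op_on F l \<psi>) = op_on F (\<lambda>b R. \<Sum>S\<in>Pow F. k b S * l S R) \<psi>"
proof
  fix b
  have "op_on F k (op_on F l \<psi>) b =
      (\<Sum>S\<in>Pow F. k (b \<inter> F) S * (\<Sum>R\<in>Pow F. l S R * \<psi> ((b - F) \<union> R)))"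
    unfolding op_on_def
  proof (intro sum.cong refl arg_cong2[where f = "(*)"])
    fix S R assume "S \<in> Pow F" "R \<in> Pow F"
    then have "(b - F \<union> S) \<inter> F = S" "b - F \<union> S - F = b - F" by auto
    then show "l ((b - F \<union> S) \<inter> F) R = l S R" "\<psi> (b - F \<union> S - F \<union> R) = \<psi> (b - F \<union> R)"
      by simp_all
  qed
  also have "\<dots> = (\<Sum>R\<in>Pow F. (\<Sum>S\<in>Pow F. k (b \<inter> F) S * l S R) * \<psi> ((b - F) \<union> R))"
    by (simp add: sum_distrib_left sum_distrib_right mult.assoc) (rule sum.swap)
  finally show "op_on F k (op_on F l \<psi>) b = op_on F (\<lambda>b R. \<Sum>S\<in>Pow F. k b S * l S R) \<psi> b"
    by (simp add: op_on_def)
qed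

text \<open>The larger matrix is the tensor product of \<open>k\<close> with the identity on
  \<open>G - F\<close>, whence the condition that row and column agree outside
  \<open>F\<close>.\<close>

lemma op_on_extend:
  assumes "F \<subseteq> G" "finite G"
  shows "op_on F k = op_on G (\<lambda>b S. if b - F = S - F then k (b \<inter> F) (S \<inter> F) else 0)"
proof (intro ext)
  fix \<psi> b
  \<comment> \<open>Only columns that agree with \<open>b\<close> on \<open>G - F\<close>
    contribute; they are exactly the values of \<open>?g\<close>.\<close>
  let ?g = "\<lambda>S. (b \<inter> G - F) \<union> S"
  have inj: "inj_on ?g (Pow F)" by (rule inj_onI) auto
  have sub: "?g ` Pow F \<subseteq> Pow G" using assms by auto
  have "op_on G (\<lambda>b S. if b - F = S - F then k (b \<inter> F) (S \<inter> F) else 0) \<psi> b =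
     (\<Sum>S\<in>Pow G. (if b \<inter> G - F = S - F then k (b \<inter> G \<inter> F) (S \<inter> F) else 0) * \<psi> (b - G \<union> S))"
    by (simp add: op_on_def)
  also have "\<dots> = (\<Sum>S\<in>?g ` Pow F.
       (if b \<inter> G - F = S - F then k (b \<inter> G \<inter> F) (S \<inter> F) else 0) * \<psi> (b - G \<union> S))"
  proof (rule sum.mono_neutral_right)
    show "\<forall>S\<in>Pow G - ?g ` Pow F.
        (if b \<inter> G - F = S - F then k (b \<inter> G \<inter> F) (S \<inter> F) else 0) * \<psi> (b - G \<union> S) = 0"
    proof
      fix S assume S: "S \<in> Pow G - ?g ` Pow F"
      have "b \<inter> G - F \<noteq> S - F"
      proof
        assume "b \<inter> G - F = S - F"
        then have "S = ?g (S \<inter> F)" by auto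
        then show False using S by blast
      qed
      then show "(if b \<inter> G - F = S - F then k (b \<inter> G \<inter> F) (S \<inter> F) else 0) * \<psi> (b - G \<union> S) = 0"
        by simp
    qed
  qed (use assms sub in auto)
  also have "\<dots> = (\<Sum>S\<in>Pow F. k (b \<inter> F) S * \<psi> (b - F \<union> S))"
  proof (subst sum.reindex[OF inj], rule sum.cong[OF refl])
    fix S assume S: "S \<in> Pow F"
    then have "?g S - F = b \<inter> G - F" "?g S \<inter> F = S" "b - G \<union> ?g S = b - F \<union> S"
      "b \<inter> G \<inter> F = b \<inter> F" using assms by auto
    then show "((\<lambda>S. (if b \<inter> G - F = S - F then k (b \<inter> G \<inter> F) (S \<inter> F) else 0) *
        \<psi> (b - G \<union> S)) \<circ> ?g) S = k (b \<inter> F) S * \<psi> (b - F \<union> S)"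
      by simp
  qed
  finally show "op_on F k \<psi> b =
      op_on G (\<lambda>b S. if b - F = S - F then k (b \<inter> F) (S \<inter> F) else 0) \<psi> b"
    by (simp add: op_on_def)
qed

lemma op_on_commute:
  assumes "F \<inter> G = {}"
  shows "op_on F k (op_on G l \<psi>) = op_on G l (op_on F k \<psi>)"
proof
  fix b
  have "op_on F k (op_on G l \<psi>) b = (\<Sum>S\<in>Pow F. \<Sum>R\<in>Pow G.
      k (b \<inter> F) S * (l (b \<inter> G) R * \<psi> (b - F - G \<union> S \<union> R)))"
    unfolding op_on_def sum_distrib_left
  proof (intro sum.cong refl arg_cong2[where f = "(*)"])
    fix S R assume "S \<in> Pow F" "R \<in> Pow G"
    then have "(b - F \<union> S) \<inter> G = b \<inter> G" "b - F \<union> S - G = b - F - G \<union> S" using assms by auto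
    then show "l ((b - F \<union> S) \<inter> G) R = l (b \<inter> G) R"
      "\<psi> (b - F \<union> S - G \<union> R) = \<psi> (b - F - G \<union> S \<union> R)" by simp_all
  qed
  also have "\<dots> = (\<Sum>R\<in>Pow G. \<Sum>S\<in>Pow F.
      l (b \<inter> G) R * (k (b \<inter> F) S * \<psi> (b - F - G \<union> S \<union> R)))"
    by (subst sum.swap) (simp add: mult.left_commute)
  also have "\<dots> = op_on G l (op_on F k \<psi>) b"
    unfolding op_on_def sum_distrib_left
  proof (intro sum.cong refl arg_cong2[where f = "(*)"])
    fix S R assume "S \<in> Pow F" "R \<in> Pow G"
    then have "(b - G \<union> R) \<inter> F = b \<inter> F" "b - G \<union> R - F \<union> S = b - F - G \<union> S \<union> R"
      using assms by auto
    then show "k (b \<inter> F) S = k ((b - G \<union> R) \<inter> F) S"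
      "\<psi> (b - F - G \<union> S \<union> R) = \<psi> (b - G \<union> R - F \<union> S)" by simp_all
  qed
  finally show "op_on F k (op_on G l \<psi>) b = op_on G l (op_on F k \<psi>) b" .
qed

lemma finsupp_op_on:
  assumes "finite F" "finsupp \<psi>"
  shows "finsupp (op_on F k \<psi>)"
proof (rule finite_subset)
  show "{b. op_on F k \<psi> b \<noteq> 0} \<subseteq> (\<lambda>(c, T). (c - F) \<union> T) ` ({b. \<psi> b \<noteq> 0} \<times> Pow F)"
  proof
    fix b assume "b \<in> {b. op_on F k \<psi> b \<noteq> 0}"
    then obtain S where S: "S \<in> Pow F" "\<psi> (b - F \<union> S) \<noteq> 0"
      unfolding op_on_def by (force elim: sum.not_neutral_contains_not_neutral)
    then have "b = (b - F \<union> S - F) \<union> (b \<inter> F)" by auto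
    then show "b \<in> (\<lambda>(c, T). (c - F) \<union> T) ` ({b. \<psi> b \<noteq> 0} \<times> Pow F)"
      using S by (intro image_eqI[of _ _ "(b - F \<union> S, b \<inter> F)"]) auto
  qed
qed (use assms in auto)

lemma op_on_scale: "op_on F k (\<lambda>b. c * \<psi> b) = (\<lambda>b. c * op_on F k \<psi> b)"
  by (simp add: op_on_def sum_distrib_left mult.left_commute)

lemma local_op_mono: "local_op R K \<Longrightarrow> R \<subseteq> S \<Longrightarrow> local_op S K"
  unfolding local_op_def by blast

lemma local_op_compose:
  assumes "local_op R K" "local_op R L"
  shows "local_op R (K \<circ> L)"
proof -
  obtain F k G l where *: "F \<subseteq> R" "finite F" "K = op_on F k" "G \<subseteq> R" "finite G" "L = op_on G l"
    using assms unfolding local_op_def by blast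
  obtain k' where k': "K = op_on (F \<union> G) k'" using * op_on_extend[of F "F \<union> G" k] by auto
  obtain l' where l': "L = op_on (F \<union> G) l'" using * op_on_extend[of G "F \<union> G" l] by auto
  have "K \<circ> L = op_on (F \<union> G) (\<lambda>b R. \<Sum>S\<in>Pow (F \<union> G). k' b S * l' S R)"
    by (auto simp: k' l' op_on_compose)
  moreover have "F \<union> G \<subseteq> R" "finite (F \<union> G)" using * by auto
  ultimately show ?thesis unfolding local_op_def by blast
qed

lemma local_op_commute:
  "local_op R K \<Longrightarrow> local_op S L \<Longrightarrow> R \<inter> S = {} \<Longrightarrow> K (L \<psi>) = L (K \<psi>)"
  unfolding local_op_def by (auto intro!: op_on_commute)

lemma local_op_finsupp: "local_op R K \<Longrightarrow> finsupp \<psi> \<Longrightarrow> finsupp (K \<psi>)"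
  unfolding local_op_def by (auto intro!: finsupp_op_on)

lemma local_op_scale: "local_op R K \<Longrightarrow> K (\<lambda>b. c * \<psi> b) = (\<lambda>b. c * K \<psi> b)"
  unfolding local_op_def by (auto simp: op_on_scale)

lemma local_op_const: "local_op R (\<lambda>\<psi> b. c * \<psi> b)"
  unfolding local_op_def
  by (intro exI[of _ "{}"] exI[of _ "\<lambda>_ _. c"]) (auto simp: op_on_def fun_eq_iff)

lemma local_op_id: "local_op R (\<lambda>\<psi>. \<psi>)"
  using local_op_const[of R 1] by simp

section \<open>Instruments made of local operators\<close>

lemma local_instrI: "(\<And>x K. (x, K) \<in> set I \<Longrightarrow> local_op R K) \<Longrightarrow> local_instr R I"
  unfolding local_instr_def by auto

lemma local_instrD: "local_instr R I \<Longrightarrow> (x, K) \<in> set I \<Longrightarrow> local_op R K"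
  unfolding local_instr_def by auto

lemma local_instr_mono: "local_instr R I \<Longrightarrow> R \<subseteq> S \<Longrightarrow> local_instr S I"
  unfolding local_instr_def by (auto intro: local_op_mono)

lemma local_instr_ireturn [simp]: "local_instr R (ireturn x)"
  by (simp add: local_instr_def ireturn_def local_op_id)

lemma local_instr_gate [simp]: "local_instr R (gate U) \<longleftrightarrow> local_op R U"
  by (simp add: local_instr_def gate_def)

lemma local_instr_ibind:
  assumes "local_instr R I" "\<And>x. x \<in> fst ` set I \<Longrightarrow> local_instr R (J x)"
  shows "local_instr R (ibind I J)"
proof (rule local_instrI)
  fix z L assume "(z, L) \<in> set (ibind I J)"
  then obtain x K L' where *: "(x, K) \<in> set I" "(z, L') \<in> set (J x)" "L = L' \<circ> K"
    by (auto simp: set_ibind)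
  then have "local_instr R (J x)" using assms(2) by force
  then show "local_op R L"
    using * assms(1) by (auto intro!: local_op_compose dest: local_instrD)
qed

lemma local_instr_imap [simp]: "local_instr R (imap g I) \<longleftrightarrow> local_instr R I"
  unfolding local_instr_def imap_def by auto

lemma local_instr_sample [simp]: "local_instr (R :: 'b set) (sample xs)"
proof (rule local_instrI)
  fix x and K :: "'b ket \<Rightarrow> 'b ket" assume "(x, K) \<in> set (sample xs)"
  then have "K = (\<lambda>\<psi> b. (1 / complex_of_real (sqrt (real (length xs)))) * \<psi> b)"
    by (auto simp: sample_def)
  then show "local_op R K" by (simp only: local_op_const)
qed

text \<open>Each Kraus operator of one list commutes with each of the other, so the two finite sums
  can be exchanged. This is what allows work to be postponed past the moves of a
  distinguisher.\<close>

lemma expect_commute: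
  assumes "local_instr R I" "local_instr S J" "R \<inter> S = {}"
  shows "expect I (\<lambda>x. expect J (g x)) \<psi> = expect J (\<lambda>y. expect I (\<lambda>x. g x y)) \<psi>"
  using assms(1)
proof (induction I)
  case (Cons a I)
  obtain x K where a: "a = (x, K)" by (cases a)
  have K: "local_op R K" and I: "local_instr R I" using Cons.prems by (auto simp: a local_instr_def)
  have "expect J (g x) (K \<psi>) = expect J (\<lambda>y \<phi>. g x y (K \<phi>)) \<psi>"
    using assms(2)
  proof (induction J)
    case (Cons c J)
    then show ?case using local_op_commute[OF K _ assms(3)]
      by (cases c) (auto simp: local_instr_def)
  qed simp
  then show ?case using Cons.IH[OF I] by (simp add: a expect_add)
qed (simp add: expect_zero)

text \<open>An instrument has finitely many Kraus operators, so the union of their separate supports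
  is a common finite one, to which \<open>op_on_extend\<close> pads each matrix. The two halves
  serve different ends: locality for commuting operations, completeness for discarding them.\<close>

lemma instrument_on_iff: "instrument_on R I \<longleftrightarrow> local_instr R I \<and> complete I"
proof
  assume "instrument_on R I"
  then obtain F where F: "F \<subseteq> R" "finite F" "\<forall>(x, K)\<in>set I. \<exists>k. K = op_on F k"
    and c: "\<forall>\<psi>. finsupp \<psi> \<longrightarrow> (\<Sum>(x, K)\<leftarrow>I. norm2 (K \<psi>)) = norm2 \<psi>"
    unfolding instrument_on_def by blast
  have "local_op R K" if xK: "(x, K) \<in> set I" for x K
  proof -
    obtain k where "K = op_on F k" using F(3) xK by auto
    then show ?thesis using F(1,2) unfolding local_op_def by blast
  qed
  then show "local_instr R I \<and> complete I"
    using c unfolding complete_def expect_def by (simp add: local_instrI)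
next
  assume *: "local_instr R I \<and> complete I"
  have "\<exists>F\<subseteq>R. finite F \<and> (\<forall>(x, K)\<in>set I. \<exists>k. K = op_on F k)"
    using conjunct1[OF *]
  proof (induction I)
    case (Cons a I)
    obtain x K where a: "a = (x, K)" by (cases a)
    from Cons obtain F where F: "F \<subseteq> R" "finite F" "\<forall>(x, K)\<in>set I. \<exists>k. K = op_on F k"
      by (auto simp: local_instr_def)
    from Cons.prems obtain G l where G: "G \<subseteq> R" "finite G" "K = op_on G l"
      by (auto simp: a local_instr_def local_op_def)
    have "\<exists>k. L = op_on (F \<union> G) k" if "(y, L) \<in> set (a # I)" for y L
    proof (cases "(y, L) = a")
      case True
      then show ?thesis using G op_on_extend[of G "F \<union> G" l] F by (auto simp: a)
    next
      case False
      then have "(y, L) \<in> set I" using that by auto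
      then obtain k where "L = op_on F k" using F(3) by blast
      then show ?thesis using F G op_on_extend[of F "F \<union> G" k] by auto
    qed
    then show ?case using F G by (intro exI[of _ "F \<union> G"]) auto
  qed auto
  moreover have "\<forall>\<psi>. finsupp \<psi> \<longrightarrow> (\<Sum>(x, K)\<leftarrow>I. norm2 (K \<psi>)) = norm2 \<psi>"
    using conjunct2[OF *] unfolding complete_def expect_def .
  ultimately show "instrument_on R I"
    unfolding instrument_on_def by simp
qed

section \<open>Trace preservation\<close>

lemma completeD: "complete I \<Longrightarrow> finsupp \<psi> \<Longrightarrow> expect I (\<lambda>_. norm2) \<psi> = norm2 \<psi>"
  by (simp add: complete_def)

lemma complete_ireturn [simp]: "complete (ireturn x)"
  by (simp add: complete_def)

lemma complete_imap [simp]: "complete (imap g I) \<longleftrightarrow> complete I"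
  by (simp add: complete_def)

text \<open>Completeness speaks about finitely supported kets only; locality ensures that the first
  instrument keeps the support finite.\<close>

lemma complete_ibind:
  assumes "local_instr UNIV I" "complete I" "\<And>x. x \<in> fst ` set I \<Longrightarrow> complete (J x)"
  shows "complete (ibind I J)"
  unfolding complete_def
proof (intro allI impI)
  fix \<psi> :: "'a ket" assume "finsupp \<psi>"
  then have "expect (ibind I J) (\<lambda>_. norm2) \<psi> = expect I (\<lambda>_. norm2) \<psi>"
    unfolding expect_ibind
  proof (intro expect_cong)
    fix x K assume "(x, K) \<in> set I"
    then have "x \<in> fst ` set I" "finsupp (K \<psi>)"
      using local_op_finsupp[OF local_instrD[OF assms(1)]] \<open>finsupp \<psi>\<close> by force+
    then show "expect (J x) (\<lambda>_. norm2) (K \<psi>) = norm2 (K \<psi>)"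
      by (intro completeD assms(3))
  qed
  then show "expect (ibind I J) (\<lambda>_. norm2) \<psi> = norm2 \<psi>"
    using completeD[OF assms(2) \<open>finsupp \<psi>\<close>] by (rule trans)
qed

lemma instrument_on_ireturn [simp]: "instrument_on R (ireturn x)"
  by (simp add: instrument_on_iff)

lemma instrument_on_imap [simp]: "instrument_on R (imap g I) \<longleftrightarrow> instrument_on R I"
  by (simp add: instrument_on_iff)

lemma instrument_on_ibind:
  assumes "instrument_on R I" "\<And>x. x \<in> fst ` set I \<Longrightarrow> instrument_on R (J x)"
  shows "instrument_on R (ibind I J)"
proof -
  have "local_instr UNIV I"
    using assms(1) by (auto simp: instrument_on_iff intro: local_instr_mono[OF _ subset_UNIV])
  then show ?thesis
    using assms by (simp add: instrument_on_iff local_instr_ibind complete_ibind)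
qed

lemma instrument_on_mono: "instrument_on R I \<Longrightarrow> R \<subseteq> S \<Longrightarrow> instrument_on S I"
  unfolding instrument_on_iff using local_instr_mono by blast

lemma instrument_on_for_each:
  "(\<And>x. x \<in> set xs \<Longrightarrow> instrument_on R (g x)) \<Longrightarrow> instrument_on R (for_each xs g)"
  by (induction xs) (auto intro!: instrument_on_ibind)

subsection \<open>Quadratic functionals\<close>

text \<open>Sampling scales the ket by the square root of a probability. A functional that scales
  with the squared modulus turns this into the probability itself, so that a random choice that is
  never read disappears (\<open>expect_sample_const\<close>). The success probability of a
  distinguisher, seen from any intermediate point, is of this kind.\<close>

definition quadratic :: "('r ket \<Rightarrow> real) \<Rightarrow> bool" where
  "quadratic f \<longleftrightarrow> (\<forall>c \<psi>. f (\<lambda>b. c * \<psi> b) = (cmod c)\<^sup>2 * f \<psi>)"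

lemma norm2_scale: "norm2 (\<lambda>b. c * \<psi> b) = (cmod c)\<^sup>2 * norm2 \<psi>"
proof (cases "c = 0")
  case False
  then show ?thesis
    by (simp add: norm2_def norm_mult power_mult_distrib sum_distrib_left)
qed (simp add: norm2_def)

lemma quadratic_norm2 [simp]: "quadratic norm2"
  by (simp add: quadratic_def norm2_scale)

lemma quadratic_expect:
  assumes "local_instr R I" "\<And>x. x \<in> fst ` set I \<Longrightarrow> quadratic (f x)"
  shows "quadratic (expect I f)"
  unfolding quadratic_def
proof (intro allI)
  fix c \<psi>
  show "expect I f (\<lambda>b. c * \<psi> b) = (cmod c)\<^sup>2 * expect I f \<psi>"
    using assms
  proof (induction I)
    case (Cons a I)
    obtain x K where a: "a = (x, K)" by (cases a)
    have "local_op R K" using Cons.prems by (auto simp: a local_instr_def)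
    then have "f x (K (\<lambda>b. c * \<psi> b)) = (cmod c)\<^sup>2 * f x (K \<psi>)"
      using Cons.prems(2)[of x] by (simp add: a local_op_scale quadratic_def)
    then show ?case using Cons by (simp add: a local_instr_def distrib_left)
  qed simp
qed

lemma expect_sample:
  "expect (sample xs) f \<psi> =
    (\<Sum>x\<leftarrow>xs. f x (\<lambda>b. \<psi> b / complex_of_real (sqrt (real (length xs)))))"
  by (simp add: sample_def expect_def comp_def)

lemma expect_sample_const:
  assumes "quadratic f" "xs \<noteq> []"
  shows "expect (sample xs) (\<lambda>_. f) \<psi> = f \<psi>"
proof -
  have "f (\<lambda>b. \<psi> b / complex_of_real (sqrt (real (length xs)))) = f \<psi> / real (length xs)"
    using assms(1)[unfolded quadratic_def, rule_format, of "1 / complex_of_real (sqrt (real (length xs)))" \<psi>]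
    by (simp add: norm_divide power_divide)
  then show ?thesis using assms(2) by (simp add: expect_sample sum_list_triv)
qed

lemma complete_sample: "xs \<noteq> [] \<Longrightarrow> complete (sample xs)"
  by (simp add: complete_def expect_sample_const)

lemma instrument_on_sample [simp]: "xs \<noteq> [] \<Longrightarrow> instrument_on R (sample xs)"
  by (simp add: instrument_on_iff complete_sample)

section \<open>Simulating one resource by another\<close>

definition val :: "('p, 'w, 'x) distinguisher \<Rightarrow> ('p, 'w, 'x, 's) resource \<Rightarrow> nat \<Rightarrow> ('p, 'x) history \<Rightarrow>
    's \<Rightarrow> 'w reg ket \<Rightarrow> real" where
  "val D A k h s = expect (play D A k h s) (\<lambda>b \<phi>. if b then norm2 \<phi> else 0)"

lemma prob_one_val: "prob_one D A = val D A (rounds A) [] (res_init A) (basis_ket {})"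
  by (simp add: prob_one_def val_def expect_def)

lemma val_0: "val D A 0 h s \<psi> = expect (D h) (\<lambda>(m, l) \<phi>. if l = 1 then norm2 \<phi> else 0) \<psi>"
proof -
  have "play D A 0 h s = imap (\<lambda>(m, l). l = 1) (D h)"
    by (auto simp: imap_def)
  then show ?thesis by (simp add: val_def case_prod_beta')
qed

lemma val_Suc: "val D A (Suc k) h s \<psi> = expect (D h) (\<lambda>(m, l).
    expect (res_step A (length h) s m) (\<lambda>(s', m'). val D A k (h @ [(m, l, m')]) s')) \<psi>"
  unfolding val_def by (simp add: case_prod_beta')

lemma quadratic_val:
  assumes "\<And>h. length h \<le> T \<Longrightarrow> local_instr UNIV (D h)"
    and "\<And>t s m. t < T \<Longrightarrow> local_instr UNIV (res_step A t s m)"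
  shows "k + length h = T \<Longrightarrow> quadratic (val D A k h s)"
proof (induction k arbitrary: h s)
  case 0
  have "quadratic (expect (D h) (\<lambda>(m, l) \<phi>. if l = 1 then norm2 \<phi> else 0))"
    using assms(1)[of h] 0 by (intro quadratic_expect) (auto simp: quadratic_def norm2_scale)
  then show ?case by (simp add: val_0[abs_def])
next
  case (Suc k)
  have "quadratic (expect (D h) (\<lambda>(m, l).
    expect (res_step A (length h) s m) (\<lambda>(s', m'). val D A k (h @ [(m, l, m')]) s')))"
  proof (rule quadratic_expect[OF assms(1)])
    fix x assume "x \<in> fst ` set (D h)"
    show "quadratic (case x of (m, l) \<Rightarrow> expect (res_step A (length h) s m)
        (\<lambda>(s', m'). val D A k (h @ [(m, l, m')]) s'))"
      using Suc by (auto split: prod.split intro!: quadratic_expect[OF assms(2)])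
  qed (use Suc in simp)
  then show ?case by (simp add: val_Suc[abs_def])
qed

definition observable :: "(nat \<Rightarrow> 'w set) \<Rightarrow> nat \<Rightarrow> 'w reg set" where
  "observable ow t = range DistMem \<union> Wire ` ow t"

text \<open>
  \<open>Kf t s\<close> is the part of the work of \<open>A\<close> that \<open>B\<close>, being in state \<open>s\<close>, has
  postponed; it must not touch what the distinguisher can access at that time.
\<close>

locale simulation =
  fixes T :: nat and ow :: "nat \<Rightarrow> 'w set"
    and B :: "('p, 'w, 'x, 's) resource" and A :: "('p, 'w, 'x, 'u) resource"
    and Kf :: "nat \<Rightarrow> 's \<Rightarrow> ('w reg, 'u) instrument" and inv :: "nat \<Rightarrow> 's \<Rightarrow> bool"
  assumes Kf_local: "t \<le> T \<Longrightarrow> inv t s \<Longrightarrow> local_instr (- observable ow t) (Kf t s)"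
    and Kf_complete: "inv T s \<Longrightarrow> complete (Kf T s)"
    and A_local: "t < T \<Longrightarrow> local_instr UNIV (res_step A t u m)"
    and B_local: "t < T \<Longrightarrow> local_instr UNIV (res_step B t s m)"
    and inv_step: "t < T \<Longrightarrow> inv t s \<Longrightarrow> (s', m') \<in> fst ` set (res_step B t s m) \<Longrightarrow> inv (Suc t) s'"
    and step: "t < T \<Longrightarrow> inv t s \<Longrightarrow> (\<And>x. quadratic (f x)) \<Longrightarrow>
      (Suc t = T \<Longrightarrow> \<forall>u u' m'. f (u, m') = f (u', m')) \<Longrightarrow>
      expect (res_step B t s m) (\<lambda>(s', m'). expect (Kf (Suc t) s') (\<lambda>u. f (u, m'))) \<psi> =
      expect (Kf t s) (\<lambda>u. expect (res_step A t u m) f) \<psi>"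
begin

text \<open>Induction on the number of remaining rounds. The owed work commutes past each move of
  the distinguisher because it avoids the observable registers; \<open>step\<close> then carries it
  through the round. After the last round it is complete and drops out of the norm.\<close>

lemma val_eq:
  assumes D: "\<And>h. length h \<le> T \<Longrightarrow> local_instr (observable ow (length h)) (D h)"
  shows "k + length h = T \<Longrightarrow> inv (length h) s \<Longrightarrow> finsupp \<psi> \<Longrightarrow>
    val D B k h s \<psi> = expect (Kf (length h) s) (\<lambda>u. val D A k h u) \<psi>"
proof (induction k arbitrary: h s \<psi>)
  case 0
  let ?g = "\<lambda>(m, l) \<phi>. if l = 1 then norm2 \<phi> else (0 :: real)"
  have Dl: "local_instr (observable ow T) (D h)" using D[of h] 0 by simp
  have "expect (Kf T s) (\<lambda>u. val D A 0 h u) \<psi> = expect (Kf T s) (\<lambda>u. expect (D h) ?g) \<psi>"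
    by (simp add: val_0[abs_def])
  also have "\<dots> = expect (D h) (\<lambda>x. expect (Kf T s) (\<lambda>u. ?g x)) \<psi>"
    by (rule expect_commute[OF _ Dl]) (use Kf_local 0 in auto)
  also have "\<dots> = expect (D h) ?g \<psi>"
  proof (rule expect_cong)
    fix x K assume "(x, K) \<in> set (D h)"
    then have "finsupp (K \<psi>)" using local_op_finsupp[OF local_instrD[OF Dl]] 0(3) by blast
    then show "expect (Kf T s) (\<lambda>u. ?g x) (K \<psi>) = ?g x (K \<psi>)"
      using completeD[OF Kf_complete[of s]] 0 by (cases x) (simp add: expect_zero)
  qed
  finally have "expect (Kf T s) (\<lambda>u. val D A 0 h u) \<psi> = val D B 0 h s \<psi>"
    by (simp only: val_0)
  with 0 show ?case by simp
next
  case (Suc k)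
  let ?t = "length h"
  have t: "?t < T" using Suc by simp
  have Dl: "local_instr (observable ow ?t) (D h)" using D[of h] t by simp
  have Du: "length h' \<le> T \<Longrightarrow> local_instr UNIV (D h')" for h'
    by (rule local_instr_mono[OF D subset_UNIV])
  have "val D B (Suc k) h s \<psi> = expect (D h) (\<lambda>(m, l).
     expect (res_step B ?t s m) (\<lambda>(s', m'). val D B k (h @ [(m, l, m')]) s')) \<psi>"
    by (rule val_Suc)
  also have "\<dots> = expect (D h) (\<lambda>(m, l). expect (Kf ?t s) (\<lambda>u.
      expect (res_step A ?t u m) (\<lambda>(u', m'). val D A k (h @ [(m, l, m')]) u'))) \<psi>"
  proof (rule expect_cong_pair)
    fix m l K assume K: "((m, l), K) \<in> set (D h)"
    then have fin: "finsupp (K \<psi>)" using local_op_finsupp[OF local_instrD[OF Dl]] Suc.prems(3) by blast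
    have "expect (res_step B ?t s m) (\<lambda>(s', m'). val D B k (h @ [(m, l, m')]) s') (K \<psi>) =
      expect (res_step B ?t s m) (\<lambda>(s', m'). expect (Kf (Suc ?t) s')
        (\<lambda>u. (\<lambda>(u, m'). val D A k (h @ [(m, l, m')]) u) (u, m'))) (K \<psi>)"
    proof (rule expect_cong_pair)
      fix s' m' L assume L: "((s', m'), L) \<in> set (res_step B ?t s m)"
      have "finsupp (L (K \<psi>))" using local_op_finsupp[OF local_instrD[OF B_local[OF t] L] fin] .
      moreover have "inv (Suc ?t) s'" using inv_step[OF t Suc.prems(2)] L by (metis fst_conv image_eqI)
      ultimately show "val D B k (h @ [(m, l, m')]) s' (L (K \<psi>)) = expect (Kf (Suc ?t) s')
          (\<lambda>u. (\<lambda>(u, m'). val D A k (h @ [(m, l, m')]) u) (u, m')) (L (K \<psi>))"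
        using Suc.IH[of "h @ [(m, l, m')]" s' "L (K \<psi>)"] Suc.prems by simp
    qed
    also have "\<dots> = expect (Kf ?t s) (\<lambda>u.
        expect (res_step A ?t u m) (\<lambda>(u', m'). val D A k (h @ [(m, l, m')]) u')) (K \<psi>)"
    proof (rule step[OF t Suc.prems(2)])
      show "quadratic ((\<lambda>(u', m'). val D A k (h @ [(m, l, m')]) u') x)" for x
        using quadratic_val[of T D A, OF Du A_local] Suc.prems by (cases x) auto
      \<comment> \<open>With no round left, \<open>val\<close> only asks the distinguisher once
        more, so the state of the game is not read.\<close>
      show "Suc ?t = T \<Longrightarrow> \<forall>u u' m'. (\<lambda>(u', m'). val D A k (h @ [(m, l, m')]) u') (u, m') =
         (\<lambda>(u', m'). val D A k (h @ [(m, l, m')]) u') (u', m')"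
        using Suc.prems by (auto simp: val_0[abs_def])
    qed
    finally show "expect (res_step B ?t s m) (\<lambda>(s', m'). val D B k (h @ [(m, l, m')]) s') (K \<psi>) =
      expect (Kf ?t s) (\<lambda>u.
        expect (res_step A ?t u m) (\<lambda>(u', m'). val D A k (h @ [(m, l, m')]) u')) (K \<psi>)" .
  qed
  also have "\<dots> = expect (D h) (\<lambda>x. expect (Kf ?t s) (\<lambda>u. case x of (m, l) \<Rightarrow>
      expect (res_step A ?t u m) (\<lambda>(u', m'). val D A k (h @ [(m, l, m')]) u'))) \<psi>"
    by (intro expect_cong) auto
  also have "\<dots> = expect (Kf ?t s) (\<lambda>u. expect (D h) (\<lambda>x. case x of (m, l) \<Rightarrow>
      expect (res_step A ?t u m) (\<lambda>(u', m'). val D A k (h @ [(m, l, m')]) u'))) \<psi>"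
    by (rule expect_commute[OF Dl Kf_local]) (use t Suc.prems in auto)
  also have "\<dots> = expect (Kf ?t s) (\<lambda>u. val D A (Suc k) h u) \<psi>"
    by (simp add: val_Suc[abs_def])
  finally show ?case .
qed

text \<open>The owed work may already be nontrivial at the start, for instance the reset of an
  ancilla. The last two hypotheses ask that on the vacuum it has the effect of doing nothing, up to
  branches that vanish.\<close>

lemma prob_eq:
  assumes "\<And>h. length h \<le> T \<Longrightarrow> local_instr (observable ow (length h)) (D h)"
    and "rounds A = T" "rounds B = T" "inv 0 (res_init B)"
    and "\<And>f. quadratic f \<Longrightarrow> expect (Kf 0 (res_init B)) (\<lambda>u. if u = res_init A then f else (\<lambda>_. 0)) (basis_ket {}) = f (basis_ket {})"
    and "\<And>u. u \<in> fst ` set (Kf 0 (res_init B)) \<Longrightarrow> u = res_init A"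
  shows "prob_one D B = prob_one D A"
proof -
  have fin: "finsupp (basis_ket {} :: 'w reg ket)"
    by (rule finite_subset[of _ "{{}}"]) (auto simp: basis_ket_def)
  have q: "quadratic (val D A T [] (res_init A))"
    by (rule quadratic_val[of T]) (simp_all add: A_local local_instr_mono[OF assms(1) subset_UNIV])
  have "prob_one D B = expect (Kf 0 (res_init B)) (\<lambda>u. val D A T [] u) (basis_ket {})"
    using val_eq[OF assms(1), of T "[]" "res_init B"] assms(3,4) fin by (simp add: prob_one_val)
  also have "\<dots> = expect (Kf 0 (res_init B)) (\<lambda>u. if u = res_init A then val D A T [] (res_init A)
      else (\<lambda>_. 0)) (basis_ket {})"
  proof (rule expect_cong)
    fix u K assume "(u, K) \<in> set (Kf 0 (res_init B))"
    then have "u = res_init A" using assms(6) by (metis fst_conv image_eqI)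
    then show "val D A T [] u (K (basis_ket {})) =
        (if u = res_init A then val D A T [] (res_init A) else (\<lambda>_. 0)) (K (basis_ket {}))"
      by simp
  qed
  also have "\<dots> = val D A T [] (res_init A) (basis_ket {})"
    by (rule assms(5)[OF q])
  finally show ?thesis by (simp add: prob_one_val assms(2))
qed

end

section \<open>Single-qubit operations, permutations and phases\<close>

lemma phase_add: "phase (a + b) = phase a * phase b"
  by (simp add: phase_def cis_mult add_divide_distrib distrib_right)

lemma phase_0 [simp]: "phase 0 = 1"
  by (simp add: phase_def)

lemma phase_4 [simp]: "phase 4 = -1"
  by (simp add: phase_def)

lemma cmod_phase [simp]: "cmod (phase a) = 1"
  by (simp add: phase_def)

lemma phase_nonzero [simp]: "phase a \<noteq> 0"
  using cmod_phase[of a] by force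

lemma phase_minus: "phase (- a) = cnj (phase a)"
  by (simp add: phase_def cis_cnj)

lemma phase_cancel: "phase (- a) * phase a = 1" "phase a * phase (- a) = 1"
  using phase_add[of "- a" a] phase_add[of a "- a"] by simp_all

lemma phase_mult_8: "phase (8 * k) = 1"
proof -
  have "phase (8 * k) = cis (2 * pi * of_int k)"
    by (simp add: phase_def mult_ac)
  then show ?thesis by (simp add: cis_multiple_2pi)
qed

lemma phase_cong: "a mod 8 = b mod 8 \<Longrightarrow> phase a = phase b"
proof -
  assume "a mod 8 = b mod 8"
  then obtain k where "a = b + 8 * k" by (metis mod_eqE)
  then show ?thesis by (simp add: phase_add phase_mult_8)
qed

lemma phase_add_4: "phase (a + 4) = - phase a"
  by (simp add: phase_add)

lemma phase_diff_4: "phase (a - 4) = - phase a"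
  using phase_add_4[of "a - 4"] by simp

subsection \<open>Norms\<close>

lemma norm2_eq_sum:
  "finite B \<Longrightarrow> (\<And>b. \<psi> b \<noteq> 0 \<Longrightarrow> b \<in> B) \<Longrightarrow> norm2 \<psi> = (\<Sum>b\<in>B. (cmod (\<psi> b))\<^sup>2)"
  unfolding norm2_def by (rule sum.mono_neutral_left) auto

lemma norm2_reindex:
  assumes "bij g"
  shows "norm2 (\<lambda>b. \<psi> (g b)) = norm2 \<psi>"
  unfolding norm2_def
proof (rule sum.reindex_bij_betw)
  have "g ` (g -` {b. \<psi> b \<noteq> 0}) = {b. \<psi> b \<noteq> 0}"
    using assms by (intro surj_image_vimage_eq bij_is_surj)
  then show "bij_betw g {b. \<psi> (g b) \<noteq> 0} {b. \<psi> b \<noteq> 0}"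
    using assms by (auto simp: bij_betw_def vimage_def bij_def intro: inj_on_subset)
qed

lemma norm2_phases:
  assumes "\<And>b. cmod (c b) = 1"
  shows "norm2 (\<lambda>b. c b * \<psi> b) = norm2 \<psi>"
proof -
  have "c b \<noteq> 0" for b using assms[of b] by auto
  then show ?thesis by (simp add: norm2_def norm_mult assms)
qed

lemma complete_gate [simp]: "complete (gate U) \<longleftrightarrow> (\<forall>\<psi>. finsupp \<psi> \<longrightarrow> norm2 (U \<psi>) = norm2 \<psi>)"
  by (simp add: complete_def)

text \<open>One finite set of base points serves all branches of an instrument on \<open>q\<close>:
  kets are grouped into pairs that differ at \<open>q\<close> only, and completeness becomes an
  identity between two amplitudes.\<close>

lemma norm2_split:
  assumes "finsupp \<psi>"
  obtains B where "finite B" "\<And>b. b \<in> B \<Longrightarrow> q \<notin> b"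
    "\<And>\<phi>. (\<And>b. \<phi> b \<noteq> 0 \<Longrightarrow> \<psi> (b - {q}) \<noteq> 0 \<or> \<psi> (insert q b) \<noteq> 0) \<Longrightarrow>
      norm2 \<phi> = (\<Sum>b\<in>B. (cmod (\<phi> b))\<^sup>2 + (cmod (\<phi> (insert q b)))\<^sup>2)"
proof
  let ?B = "(\<lambda>b. b - {q}) ` {b. \<psi> b \<noteq> 0}"
  show fin: "finite ?B" using assms by simp
  show nq: "\<And>b. b \<in> ?B \<Longrightarrow> q \<notin> b" by auto
  fix \<phi> :: "'a ket" assume *: "\<And>b. \<phi> b \<noteq> 0 \<Longrightarrow> \<psi> (b - {q}) \<noteq> 0 \<or> \<psi> (insert q b) \<noteq> 0"
  have inj: "inj_on (insert q) ?B" by (rule inj_onI) (use nq in blast)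
  have "norm2 \<phi> = (\<Sum>b\<in>?B \<union> insert q ` ?B. (cmod (\<phi> b))\<^sup>2)"
  proof (rule norm2_eq_sum)
    fix b assume "\<phi> b \<noteq> 0"
    then have "\<psi> (b - {q}) \<noteq> 0 \<or> \<psi> (insert q b) \<noteq> 0" by (rule *)
    then have "b - {q} \<in> ?B"
    proof
      assume "\<psi> (b - {q}) \<noteq> 0" then show ?thesis by (intro image_eqI[of _ _ "b - {q}"]) auto
    next
      assume "\<psi> (insert q b) \<noteq> 0" then show ?thesis by (intro image_eqI[of _ _ "insert q b"]) auto
    qed
    then show "b \<in> ?B \<union> insert q ` ?B"
    proof (cases "q \<in> b")
      case True
      then show ?thesis using imageI[OF \<open>b - {q} \<in> ?B\<close>, of "insert q"]
        by (simp only: insert_Diff Un_iff simp_thms)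
    next
      case False
      then show ?thesis using \<open>b - {q} \<in> ?B\<close> by (simp only: Diff_empty Diff_insert0 Un_iff simp_thms)
    qed
  qed (use fin in simp)
  also have "\<dots> = (\<Sum>b\<in>?B. (cmod (\<phi> b))\<^sup>2) + (\<Sum>b\<in>insert q ` ?B. (cmod (\<phi> b))\<^sup>2)"
    using fin by (intro sum.union_disjoint) (simp, simp, blast dest: nq)
  also have "(\<Sum>b\<in>insert q ` ?B. (cmod (\<phi> b))\<^sup>2) = (\<Sum>b\<in>?B. (cmod (\<phi> (insert q b)))\<^sup>2)"
    by (subst sum.reindex[OF inj]) simp
  finally show "norm2 \<phi> = (\<Sum>b\<in>?B. (cmod (\<phi> b))\<^sup>2 + (cmod (\<phi> (insert q b)))\<^sup>2)"
    by (simp add: sum.distrib)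
qed

subsection \<open>Single qubits\<close>

lemma set_qubit_simps [simp]:
  "set_qubit q True b = insert q b" "set_qubit q False b = b - {q}"
  by (simp_all add: set_qubit_def)

lemma op_on_singleton:
  "op_on {q} k \<psi> b = k (b \<inter> {q}) {} * \<psi> (b - {q}) + k (b \<inter> {q}) {q} * \<psi> (insert q b)"
proof -
  have "Pow {q} = {{}, {q}}" by auto
  then show ?thesis by (simp add: op_on_def)
qed

text \<open>A 2x2 matrix on \<open>q\<close>, of which \<open>c\<close> and \<open>d\<close> are the
  columns for the values 0 and 1.\<close>

lemma local_op_qubit:
  assumes "q \<in> R"
    and "\<And>\<psi> b. K \<psi> b = c (q \<in> b) * \<psi> (b - {q}) + d (q \<in> b) * \<psi> (insert q b)"
  shows "local_op R K"
  unfolding local_op_def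
proof (intro exI conjI)
  show "K = op_on {q} (\<lambda>b S. (if S = {} then c else d) (q \<in> b))"
    by (intro ext) (simp add: assms(2) op_on_singleton)
qed (use assms(1) in auto)

lemma local_op_Rz: "q \<in> R \<Longrightarrow> local_op R (Rz a q)"
  by (rule local_op_qubit[where c = "\<lambda>s. if s then 0 else 1" and d = "\<lambda>s. if s then phase a else 0"])
    (auto simp: Rz_def insert_absorb)

lemma local_op_X: "q \<in> R \<Longrightarrow> local_op R (X_gate q)"
  by (rule local_op_qubit[where c = "\<lambda>s. if s then 1 else 0" and d = "\<lambda>s. if s then 0 else 1"])
    (auto simp: X_gate_def)

lemma norm2_Rz [simp]: "norm2 (Rz a q \<psi>) = norm2 \<psi>"
proof -
  have "Rz a q \<psi> = (\<lambda>b. (if q \<in> b then phase a else 1) * \<psi> b)" by (auto simp: Rz_def)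
  then show ?thesis by (simp add: norm2_phases)
qed

lemma bij_involution: "(\<And>x. g (g x) = x) \<Longrightarrow> bij g"
  by (rule bijI') metis+

lemma norm2_X [simp]: "norm2 (X_gate q \<psi>) = norm2 \<psi>"
proof -
  have "bij (\<lambda>b. set_qubit q (q \<notin> b) b)"
    by (rule bij_involution) (auto simp: set_qubit_def)
  then show ?thesis unfolding X_gate_def by (rule norm2_reindex)
qed

lemma instrument_on_Rz [simp]: "q \<in> R \<Longrightarrow> instrument_on R (gate (Rz a q))"
  by (simp add: instrument_on_iff local_op_Rz)

lemma local_instr_prepare: "q \<in> R \<Longrightarrow> local_instr R (prepare a q)"
proof (rule local_instrI)
  fix x K assume "q \<in> R" "(x, K) \<in> set (prepare a q)"
  then obtain s where K: "K = (\<lambda>\<psi> b. pm_amp False a (q \<in> b) * \<psi> (set_qubit q s b))"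
    by (auto simp: prepare_def simp del: set_qubit_simps)
  show "local_op R K"
    by (rule local_op_qubit[OF \<open>q \<in> R\<close>, where c = "\<lambda>t. if s then 0 else pm_amp False a t"
          and d = "\<lambda>t. if s then pm_amp False a t else 0"]) (auto simp: K)
qed

lemma complete_prepare: "complete (prepare a q)"
  unfolding complete_def
proof (intro allI impI)
  fix \<psi> :: "'a ket" assume fin: "finsupp \<psi>"
  let ?K = "\<lambda>s b. pm_amp False a (q \<in> b) * \<psi> (set_qubit q s b)"
  obtain B where B: "finite B" "\<And>b. b \<in> B \<Longrightarrow> q \<notin> b"
    and split: "\<And>\<phi>. (\<And>b. \<phi> b \<noteq> 0 \<Longrightarrow> \<psi> (b - {q}) \<noteq> 0 \<or> \<psi> (insert q b) \<noteq> 0) \<Longrightarrow>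
      norm2 \<phi> = (\<Sum>b\<in>B. (cmod (\<phi> b))\<^sup>2 + (cmod (\<phi> (insert q b)))\<^sup>2)"
    by (rule norm2_split[OF fin, of q]) blast
  have "expect (prepare a q) (\<lambda>_. norm2) \<psi> = norm2 (?K False) + norm2 (?K True)"
    by (simp add: prepare_def)
  also have "\<dots> = (\<Sum>b\<in>B. (cmod (?K False b))\<^sup>2 + (cmod (?K False (insert q b)))\<^sup>2) +
      (\<Sum>b\<in>B. (cmod (?K True b))\<^sup>2 + (cmod (?K True (insert q b)))\<^sup>2)"
    by (subst (1 2) split) auto
  also have "\<dots> = (\<Sum>b\<in>B. (cmod (\<psi> b))\<^sup>2 + (cmod (\<psi> (insert q b)))\<^sup>2)"
    unfolding sum.distrib[symmetric]
    by (rule sum.cong[OF refl])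
      (simp add: B(2) pm_amp_def norm_mult norm_divide power_mult_distrib power_divide)
  also have "\<dots> = norm2 \<psi>"
    by (rule split[symmetric]) (metis Diff_empty Diff_insert0 insert_absorb)
  finally show "expect (prepare a q) (\<lambda>_. norm2) \<psi> = norm2 \<psi>" .
qed

lemma instrument_on_prepare [simp]: "q \<in> R \<Longrightarrow> instrument_on R (prepare a q)"
  by (simp add: instrument_on_iff local_instr_prepare complete_prepare)

text \<open>This is the completeness of a measurement in an equatorial basis, for a single pair of
  amplitudes.\<close>

lemma parallelogram: "(cmod (x + y))\<^sup>2 + (cmod (x - y))\<^sup>2 = 2 * (cmod x)\<^sup>2 + 2 * (cmod y)\<^sup>2"
  unfolding cmod_power2 by (simp add: power2_eq_square algebra_simps)

lemma local_instr_measure_pm: "q \<in> R \<Longrightarrow> local_instr R (measure_pm a q)"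
proof (rule local_instrI)
  fix x K assume "q \<in> R" "(x, K) \<in> set (measure_pm a q)"
  then obtain m where K: "K = (\<lambda>\<psi> b. pm_amp m a (q \<in> b) *
     (cnj (pm_amp m a False) * \<psi> (set_qubit q False b) +
      cnj (pm_amp m a True) * \<psi> (set_qubit q True b)))"
    by (auto simp: measure_pm_def simp del: set_qubit_simps)
  show "local_op R K"
    by (rule local_op_qubit[OF \<open>q \<in> R\<close>, where c = "\<lambda>t. pm_amp m a t * cnj (pm_amp m a False)"
          and d = "\<lambda>t. pm_amp m a t * cnj (pm_amp m a True)"]) (simp add: K algebra_simps)
qed

lemma complete_measure_pm: "complete (measure_pm a q)"
  unfolding complete_def
proof (intro allI impI)
  fix \<psi> :: "'a ket" assume fin: "finsupp \<psi>"
  let ?K = "\<lambda>m b. pm_amp m a (q \<in> b) * (cnj (pm_amp m a False) * \<psi> (set_qubit q False b) +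
      cnj (pm_amp m a True) * \<psi> (set_qubit q True b))"
  obtain B where B: "finite B" "\<And>b. b \<in> B \<Longrightarrow> q \<notin> b"
    and split: "\<And>\<phi>. (\<And>b. \<phi> b \<noteq> 0 \<Longrightarrow> \<psi> (b - {q}) \<noteq> 0 \<or> \<psi> (insert q b) \<noteq> 0) \<Longrightarrow>
      norm2 \<phi> = (\<Sum>b\<in>B. (cmod (\<phi> b))\<^sup>2 + (cmod (\<phi> (insert q b)))\<^sup>2)"
    by (rule norm2_split[OF fin, of q]) blast
  have "expect (measure_pm a q) (\<lambda>_. norm2) \<psi> = norm2 (?K False) + norm2 (?K True)"
    by (simp add: measure_pm_def)
  also have "\<dots> = (\<Sum>b\<in>B. (cmod (?K False b))\<^sup>2 + (cmod (?K False (insert q b)))\<^sup>2) +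
      (\<Sum>b\<in>B. (cmod (?K True b))\<^sup>2 + (cmod (?K True (insert q b)))\<^sup>2)"
    by (subst (1 2) split) auto
  also have "\<dots> = (\<Sum>b\<in>B. (cmod (\<psi> b))\<^sup>2 + (cmod (\<psi> (insert q b)))\<^sup>2)"
    unfolding sum.distrib[symmetric]
  proof (rule sum.cong[OF refl])
    fix b assume b: "b \<in> B"
    \<comment> \<open>With the phase of the basis absorbed into the second amplitude, the two
      outcomes see the sum and the difference.\<close>
    let ?x = "\<psi> b" and ?y = "cnj (phase a) * \<psi> (insert q b)"
    have 1: "(cmod (?K False b))\<^sup>2 = (cmod (?x + ?y))\<^sup>2 / 4"
      "(cmod (?K False (insert q b)))\<^sup>2 = (cmod (?x + ?y))\<^sup>2 / 4"
      by (auto simp: pm_amp_def B(2)[OF b] norm_mult norm_divide power_mult_distrib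
          power_divide add_divide_distrib[symmetric])
    have 2: "(cmod (?K True b))\<^sup>2 = (cmod (?x - ?y))\<^sup>2 / 4"
      "(cmod (?K True (insert q b)))\<^sup>2 = (cmod (?x - ?y))\<^sup>2 / 4"
      by (auto simp: pm_amp_def B(2)[OF b] norm_mult norm_divide power_mult_distrib
          power_divide diff_divide_distrib[symmetric])
    have "cmod ?y = cmod (\<psi> (insert q b))" by (simp add: norm_mult)
    then show "(cmod (?K False b))\<^sup>2 + (cmod (?K False (insert q b)))\<^sup>2 +
      ((cmod (?K True b))\<^sup>2 + (cmod (?K True (insert q b)))\<^sup>2) =
      (cmod (\<psi> b))\<^sup>2 + (cmod (\<psi> (insert q b)))\<^sup>2"
      unfolding 1 2 using parallelogram[of ?x ?y] by (simp add: field_simps)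
  qed
  also have "\<dots> = norm2 \<psi>"
    by (rule split[symmetric]) (metis Diff_empty Diff_insert0 insert_absorb)
  finally show "expect (measure_pm a q) (\<lambda>_. norm2) \<psi> = norm2 \<psi>" .
qed

lemma instrument_on_measure_pm [simp]: "q \<in> R \<Longrightarrow> instrument_on R (measure_pm a q)"
  by (simp add: instrument_on_iff local_instr_measure_pm complete_measure_pm)

subsection \<open>Ancillas\<close>

text \<open>The Kraus operator |0><s| on \<open>q\<close>; the two of them together return the qubit
  to 0 whatever its state.\<close>

definition clear_qubit :: "'r \<Rightarrow> bool \<Rightarrow> 'r ket \<Rightarrow> 'r ket" where
  "clear_qubit q s \<psi> = (\<lambda>b. if q \<in> b then 0 else \<psi> (set_qubit q s b))"

definition reset :: "'r \<Rightarrow> ('r, unit) instrument" where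
  "reset q = map (\<lambda>s. ((), clear_qubit q s)) [False, True]"

definition cnot :: "'r \<Rightarrow> 'r \<Rightarrow> 'r ket \<Rightarrow> 'r ket" where
  "cnot q a \<psi> = (\<lambda>b. \<psi> (if q \<in> b then set_qubit a (a \<notin> b) b else b))"

text \<open>Projection of the qubit onto \<open>|+\<^bsub>-a\<^esub>\<rangle>\<close>, after which it is returned to \<open>|0\<rangle>\<close>.\<close>

definition bra :: "int \<Rightarrow> 'r \<Rightarrow> 'r ket \<Rightarrow> 'r ket" where
  "bra a q \<psi> = (\<lambda>b. if q \<in> b then 0
     else (\<psi> (b - {q}) + phase a * \<psi> (insert q b)) / complex_of_real (sqrt 2))"

text \<open>Subtracting 4, the angle pi, selects the other vector of the basis. The sign is chosen
  so that outcome \<open>r\<close> corresponds to the rotation angle \<open>a - 4 r\<close> of the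
  client.\<close>

definition measure_out :: "int \<Rightarrow> 'r \<Rightarrow> ('r, bool) instrument" where
  "measure_out a q = map (\<lambda>r. (r, bra (a - (if r then 4 else 0)) q)) [False, True]"

lemma local_op_clear_qubit: "q \<in> R \<Longrightarrow> local_op R (clear_qubit q s)"
  by (rule local_op_qubit[where c = "\<lambda>t. if \<not> t \<and> \<not> s then 1 else 0"
        and d = "\<lambda>t. if \<not> t \<and> s then 1 else 0"]) (auto simp: clear_qubit_def)

lemma local_op_bra: "q \<in> R \<Longrightarrow> local_op R (bra a q)"
  by (rule local_op_qubit[where c = "\<lambda>t. if t then 0 else 1 / complex_of_real (sqrt 2)"
        and d = "\<lambda>t. if t then 0 else phase a / complex_of_real (sqrt 2)"])
    (auto simp: bra_def add_divide_distrib)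

lemma instrument_on_reset: "q \<in> R \<Longrightarrow> instrument_on R (reset q)"
  unfolding instrument_on_iff
proof
  show "local_instr R (reset q)" if "q \<in> R"
    using that by (auto intro!: local_instrI local_op_clear_qubit simp: reset_def)
  show "complete (reset q)"
    unfolding complete_def
  proof (intro allI impI)
    fix \<psi> :: "'a ket" assume fin: "finsupp \<psi>"
    obtain B where B: "finite B" "\<And>b. b \<in> B \<Longrightarrow> q \<notin> b"
      and split: "\<And>\<phi>. (\<And>b. \<phi> b \<noteq> 0 \<Longrightarrow> \<psi> (b - {q}) \<noteq> 0 \<or> \<psi> (insert q b) \<noteq> 0) \<Longrightarrow>
        norm2 \<phi> = (\<Sum>b\<in>B. (cmod (\<phi> b))\<^sup>2 + (cmod (\<phi> (insert q b)))\<^sup>2)"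
      by (rule norm2_split[OF fin, of q]) blast
    have "expect (reset q) (\<lambda>_. norm2) \<psi> =
        norm2 (clear_qubit q False \<psi>) + norm2 (clear_qubit q True \<psi>)"
      by (simp add: reset_def)
    also have "\<dots> = (\<Sum>b\<in>B. (cmod (clear_qubit q False \<psi> b))\<^sup>2 +
          (cmod (clear_qubit q False \<psi> (insert q b)))\<^sup>2) +
        (\<Sum>b\<in>B. (cmod (clear_qubit q True \<psi> b))\<^sup>2 +
          (cmod (clear_qubit q True \<psi> (insert q b)))\<^sup>2)"
      by (subst (1 2) split) (auto simp: clear_qubit_def split: if_splits)
    also have "\<dots> = (\<Sum>b\<in>B. (cmod (\<psi> b))\<^sup>2 + (cmod (\<psi> (insert q b)))\<^sup>2)"
      unfolding sum.distrib[symmetric]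
      by (rule sum.cong[OF refl]) (simp add: B(2) clear_qubit_def)
    also have "\<dots> = norm2 \<psi>"
      by (rule split[symmetric]) (metis Diff_empty Diff_insert0 insert_absorb)
    finally show "expect (reset q) (\<lambda>_. norm2) \<psi> = norm2 \<psi>" .
  qed
qed

lemma instrument_on_measure_out: "q \<in> R \<Longrightarrow> instrument_on R (measure_out a q)"
  unfolding instrument_on_iff
proof
  show "local_instr R (measure_out a q)" if "q \<in> R"
    using that by (auto intro!: local_instrI local_op_bra simp: measure_out_def)
  show "complete (measure_out a q)"
    unfolding complete_def
  proof (intro allI impI)
    fix \<psi> :: "'a ket" assume fin: "finsupp \<psi>"
    obtain B where B: "finite B" "\<And>b. b \<in> B \<Longrightarrow> q \<notin> b"
      and split: "\<And>\<phi>. (\<And>b. \<phi> b \<noteq> 0 \<Longrightarrow> \<psi> (b - {q}) \<noteq> 0 \<or> \<psi> (insert q b) \<noteq> 0) \<Longrightarrow>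
        norm2 \<phi> = (\<Sum>b\<in>B. (cmod (\<phi> b))\<^sup>2 + (cmod (\<phi> (insert q b)))\<^sup>2)"
      by (rule norm2_split[OF fin, of q]) blast
    have "expect (measure_out a q) (\<lambda>_. norm2) \<psi> = norm2 (bra a q \<psi>) + norm2 (bra (a - 4) q \<psi>)"
      by (simp add: measure_out_def)
    also have "\<dots> = (\<Sum>b\<in>B. (cmod (bra a q \<psi> b))\<^sup>2 + (cmod (bra a q \<psi> (insert q b)))\<^sup>2) +
        (\<Sum>b\<in>B. (cmod (bra (a - 4) q \<psi> b))\<^sup>2 + (cmod (bra (a - 4) q \<psi> (insert q b)))\<^sup>2)"
      by (subst (1 2) split) (auto simp: bra_def split: if_splits)
    also have "\<dots> = (\<Sum>b\<in>B. (cmod (\<psi> b))\<^sup>2 + (cmod (\<psi> (insert q b)))\<^sup>2)"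
      unfolding sum.distrib[symmetric]
    proof (rule sum.cong[OF refl])
      fix b assume b: "b \<in> B"
      let ?y = "phase a * \<psi> (insert q b)"
      have "cmod ?y = cmod (\<psi> (insert q b))" by (simp add: norm_mult)
      then show "(cmod (bra a q \<psi> b))\<^sup>2 + (cmod (bra a q \<psi> (insert q b)))\<^sup>2 +
        ((cmod (bra (a - 4) q \<psi> b))\<^sup>2 + (cmod (bra (a - 4) q \<psi> (insert q b)))\<^sup>2) =
        (cmod (\<psi> b))\<^sup>2 + (cmod (\<psi> (insert q b)))\<^sup>2"
        using parallelogram[of "\<psi> b" ?y]
        by (simp add: bra_def B(2)[OF b] phase_diff_4 norm_divide power_divide field_simps)
    qed
    also have "\<dots> = norm2 \<psi>"
      by (rule split[symmetric]) (metis Diff_empty Diff_insert0 insert_absorb)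
    finally show "expect (measure_out a q) (\<lambda>_. norm2) \<psi> = norm2 \<psi>" .
  qed
qed

lemma local_op_basis_map:
  assumes "finite F" "F \<subseteq> R" "\<And>b. g b = (b - F) \<union> h (b \<inter> F)" "\<And>b. h b \<subseteq> F"
  shows "local_op R (\<lambda>\<psi> b. \<psi> (g b))"
  unfolding local_op_def
proof (intro exI conjI)
  show "(\<lambda>\<psi> b. \<psi> (g b)) = op_on F (\<lambda>b S. if S = h b then 1 else 0)"
  proof (intro ext)
    fix \<psi> :: "'a ket" and b
    have "op_on F (\<lambda>b S. if S = h b then 1 else 0) \<psi> b =
        (\<Sum>S\<in>Pow F. if S = h (b \<inter> F) then \<psi> (b - F \<union> S) else 0)"
      unfolding op_on_def by (intro sum.cong) auto
    then show "\<psi> (g b) = op_on F (\<lambda>b S. if S = h b then 1 else 0) \<psi> b"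
      using assms by (simp add: sum.delta)
  qed
qed (use assms in auto)

lemma instrument_on_cnot:
  assumes "q \<in> R" "a \<in> R" "q \<noteq> a"
  shows "instrument_on R (gate (cnot q a))"
proof -
  have "local_op R (\<lambda>\<psi> b. \<psi> (if q \<in> b then set_qubit a (a \<notin> b) b else b))"
    by (rule local_op_basis_map[where F = "{q, a}" and
          h = "\<lambda>b. if q \<in> b then (set_qubit a (a \<notin> b) b) \<inter> {q, a} else b \<inter> {q, a}"])
      (use assms in \<open>auto simp: set_qubit_def\<close>)
  moreover have "bij (\<lambda>b. if q \<in> b then set_qubit a (a \<notin> b) b else b)"
    by (rule bij_involution) (use assms in \<open>auto simp: set_qubit_def\<close>)
  ultimately show ?thesis
    using norm2_reindex[of "\<lambda>b. if q \<in> b then set_qubit a (a \<notin> b) b else b"]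
    by (simp add: instrument_on_iff cnot_def[abs_def] del: set_qubit_simps)
qed

lemma local_op_diagonal:
  assumes "finite F" "F \<subseteq> R" "\<And>b. c b = c (b \<inter> F)"
  shows "local_op R (\<lambda>\<psi> b. c b * \<psi> b)"
  unfolding local_op_def
proof (intro exI conjI)
  show "(\<lambda>\<psi> b. c b * \<psi> b) = op_on F (\<lambda>b S. if S = b then c b else 0)"
  proof (intro ext)
    fix \<psi> :: "'a ket" and b
    have "op_on F (\<lambda>b S. if S = b then c b else 0) \<psi> b =
        (\<Sum>S\<in>Pow F. if S = b \<inter> F then c (b \<inter> F) * \<psi> (b - F \<union> S) else 0)"
      unfolding op_on_def by (intro sum.cong) auto
    also have "\<dots> = c (b \<inter> F) * \<psi> (b - F \<union> b \<inter> F)"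
      using assms(1) by (simp add: sum.delta)
    also have "\<dots> = c b * \<psi> b"
      using assms(3)[of b] by (simp add: Un_Diff_Int)
    finally show "c b * \<psi> b = op_on F (\<lambda>b S. if S = b then c b else 0) \<psi> b" by simp
  qed
qed (use assms in auto)

lemma instrument_on_CZ_all:
  assumes "finite F" "F \<subseteq> R" "\<And>e. e \<in> E \<Longrightarrow> e \<subseteq> F"
  shows "instrument_on R (gate (CZ_all E))"
proof -
  have "{e \<in> E. e \<subseteq> b} = {e \<in> E. e \<subseteq> b \<inter> F}" for b using assms(3) by auto
  then have "local_op R (\<lambda>\<psi> b. (-1) ^ card {e \<in> E. e \<subseteq> b} * \<psi> b)"
    using assms(1,2) by (intro local_op_diagonal) auto
  moreover have "norm2 (\<lambda>b. (-1) ^ card {e \<in> E. e \<subseteq> b} * \<psi> b) = norm2 \<psi>" for \<psi>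
    by (rule norm2_phases) (simp add: norm_power)
  ultimately show ?thesis
    by (simp add: instrument_on_iff CZ_all_def[abs_def])
qed

subsection \<open>Renaming of qubits\<close>

text \<open>Relabelling of qubits: for a bijection \<open>\<tau>\<close>, the content of qubit
  \<open>x\<close> is afterwards found at \<open>\<tau> x\<close>.\<close>

definition rename :: "('r \<Rightarrow> 'r) \<Rightarrow> 'r ket \<Rightarrow> 'r ket" where
  "rename \<tau> \<psi> = (\<lambda>b. \<psi> (\<tau> -` b))"

lemma rename_rename: "rename \<tau> (rename \<rho> \<psi>) = rename (\<tau> \<circ> \<rho>) \<psi>"
  by (simp add: rename_def vimage_comp)

lemma rename_id [simp]: "rename id = (\<lambda>\<psi>. \<psi>)" "rename (\<lambda>x. x) = (\<lambda>\<psi>. \<psi>)"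
  by (simp_all add: rename_def fun_eq_iff)

lemma norm2_rename:
  assumes "bij \<tau>"
  shows "norm2 (rename \<tau> \<psi>) = norm2 \<psi>"
proof -
  have "bij (\<lambda>b. \<tau> -` b)"
    by (rule o_bij[where g = "\<lambda>b. \<tau> ` b"])
      (use assms in \<open>auto simp: fun_eq_iff bij_def surj_image_vimage_eq inj_vimage_image_eq\<close>)
  then show ?thesis unfolding rename_def by (rule norm2_reindex)
qed

lemma local_op_rename:
  assumes "bij \<tau>" "finite F" "F \<subseteq> R" "\<And>x. x \<notin> F \<Longrightarrow> \<tau> x = x"
  shows "local_op R (rename \<tau>)"
  unfolding rename_def
proof (rule local_op_basis_map[where F = F and h = "\<lambda>b. \<tau> -` b \<inter> F"])
  fix b
  have "\<tau> x \<in> F \<longleftrightarrow> x \<in> F" for x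
    using assms(4)[of x] assms(4)[of "\<tau> x"] assms(1) by (metis bij_pointE)
  then have "x \<in> \<tau> -` b \<longleftrightarrow> x \<in> b - F \<union> \<tau> -` (b \<inter> F) \<inter> F" for x
    by (cases "x \<in> F") (simp_all add: assms(4))
  then show "\<tau> -` b = b - F \<union> \<tau> -` (b \<inter> F) \<inter> F" by blast
qed (use assms in auto)

lemma instrument_on_rename:
  assumes "bij \<tau>" "finite F" "F \<subseteq> R" "\<And>x. x \<notin> F \<Longrightarrow> \<tau> x = x"
  shows "instrument_on R (gate (rename \<tau>))"
  by (simp add: instrument_on_iff norm2_rename assms(1) local_op_rename[OF assms])

text \<open>The instrument \<open>I\<close> carried out on relabelled qubits. It lets the simulator
  play a step of a game on registers other than those that the game names.\<close>

definition conjugate :: "('r \<Rightarrow> 'r) \<Rightarrow> ('r, 'o) instrument \<Rightarrow> ('r, 'o) instrument" where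
  "conjugate \<tau> I = map (\<lambda>(x, K). (x, rename \<tau> \<circ> K \<circ> rename (inv \<tau>))) I"

lemma expect_conjugate:
  "expect (conjugate \<tau> I) f \<psi> = expect I (\<lambda>x \<phi>. f x (rename \<tau> \<phi>)) (rename (inv \<tau>) \<psi>)"
  by (induction I) (auto simp: conjugate_def)

lemma fst_set_conjugate [simp]: "fst ` set (conjugate \<tau> I) = fst ` set I"
  by (force simp: conjugate_def)

lemma rename_op_on:
  assumes "bij \<tau>"
  shows "rename \<tau> (op_on F k (rename (inv \<tau>) \<psi>)) =
    op_on (\<tau> ` F) (\<lambda>b S. k (\<tau> -` b) (\<tau> -` S)) \<psi>"
proof
  fix b
  have v: "inv \<tau> -` X = \<tau> ` X" for X using assms by (simp add: bij_vimage_eq_inv_image inv_inv_eq bij_imp_bij_inv)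
  have i: "\<tau> -` (\<tau> ` X) = X" for X using assms by (simp add: bij_def inj_vimage_image_eq)
  have j: "\<tau> ` (\<tau> -` X) = X" for X using assms by (simp add: bij_def surj_image_vimage_eq)
  have 1: "\<tau> -` b \<inter> F = \<tau> -` (b \<inter> \<tau> ` F)" using i[of F] by auto
  have 2: "\<tau> ` (\<tau> -` b - F \<union> S) = b - \<tau> ` F \<union> \<tau> ` S" for S
    using assms by (simp add: image_Un bij_def image_set_diff j)
  have "op_on (\<tau> ` F) (\<lambda>b S. k (\<tau> -` b) (\<tau> -` S)) \<psi> b =
     (\<Sum>S\<in>Pow (\<tau> ` F). k (\<tau> -` (b \<inter> \<tau> ` F)) (\<tau> -` S) * \<psi> (b - \<tau> ` F \<union> S))"
    by (simp add: op_on_def)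
  also have "Pow (\<tau> ` F) = (\<lambda>S. \<tau> ` S) ` Pow F" by (simp add: image_Pow_surj)
  also have "(\<Sum>S\<in>(\<lambda>S. \<tau> ` S) ` Pow F. k (\<tau> -` (b \<inter> \<tau> ` F)) (\<tau> -` S) * \<psi> (b - \<tau> ` F \<union> S)) =
      (\<Sum>S\<in>Pow F. k (\<tau> -` (b \<inter> \<tau> ` F)) S * \<psi> (b - \<tau> ` F \<union> \<tau> ` S))"
  proof (subst sum.reindex)
    show "inj_on (\<lambda>S. \<tau> ` S) (Pow F)" by (rule inj_onI) (metis i)
  qed (simp add: i)
  also have "\<dots> = rename \<tau> (op_on F k (rename (inv \<tau>) \<psi>)) b"
    by (simp add: rename_def op_on_def v 1 2)
  finally show "rename \<tau> (op_on F k (rename (inv \<tau>) \<psi>)) b =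
    op_on (\<tau> ` F) (\<lambda>b S. k (\<tau> -` b) (\<tau> -` S)) \<psi> b" by simp
qed

lemma local_op_conjugate:
  assumes "bij \<tau>" "local_op R K"
  shows "local_op (\<tau> ` R) (rename \<tau> \<circ> K \<circ> rename (inv \<tau>))"
proof -
  obtain F k where F: "F \<subseteq> R" "finite F" "K = op_on F k" using assms(2) unfolding local_op_def by blast
  then have "rename \<tau> \<circ> K \<circ> rename (inv \<tau>) = op_on (\<tau> ` F) (\<lambda>b S. k (\<tau> -` b) (\<tau> -` S))"
    by (intro ext) (simp add: rename_op_on[OF assms(1)])
  then show ?thesis unfolding local_op_def using F by (intro exI[of _ "\<tau> ` F"]) auto
qed

lemma finsupp_rename:
  assumes "bij \<tau>" "finsupp \<psi>"
  shows "finsupp (rename \<tau> \<psi>)"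
proof -
  have "{b. rename \<tau> \<psi> b \<noteq> 0} \<subseteq> (\<lambda>b. \<tau> ` b) ` {b. \<psi> b \<noteq> 0}"
  proof
    fix b assume "b \<in> {b. rename \<tau> \<psi> b \<noteq> 0}"
    then have "\<psi> (\<tau> -` b) \<noteq> 0" by (simp add: rename_def)
    moreover have "b = \<tau> ` (\<tau> -` b)" using assms(1) by (simp add: bij_def surj_image_vimage_eq)
    ultimately show "b \<in> (\<lambda>b. \<tau> ` b) ` {b. \<psi> b \<noteq> 0}" by blast
  qed
  then show ?thesis by (rule finite_subset) (use assms(2) in simp)
qed

lemma instrument_on_conjugate:
  assumes "bij \<tau>" "instrument_on R I" "\<tau> ` R \<subseteq> S"
  shows "instrument_on S (conjugate \<tau> I)"
  unfolding instrument_on_iff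
proof
  show "local_instr S (conjugate \<tau> I)"
    using assms local_op_mono[OF local_op_conjugate[OF assms(1)] assms(3)]
    by (auto simp: instrument_on_iff local_instr_def conjugate_def)
  show "complete (conjugate \<tau> I)"
    unfolding complete_def
  proof (intro allI impI)
    fix \<psi> :: "'a ket" assume "finsupp \<psi>"
    then have "expect I (\<lambda>_. norm2) (rename (inv \<tau>) \<psi>) = norm2 (rename (inv \<tau>) \<psi>)"
      using assms by (intro completeD finsupp_rename) (auto simp: instrument_on_iff bij_imp_bij_inv)
    then show "expect (conjugate \<tau> I) (\<lambda>_. norm2) \<psi> = norm2 \<psi>"
      using assms(1) by (simp add: expect_conjugate norm2_rename bij_imp_bij_inv)
  qed
qed

section \<open>The order of the rounds\<close>

text \<open>
  The stage of a vertex: 0 before its shares are drawn, 1 after that, \<open>j + 2\<close> when its qubit is on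
  the way to client \<open>j\<close> (for \<open>j = clients P\<close>: to the server), then \<open>clients P + 3\<close>, \<open>+ 4\<close>, \<open>+ 5\<close>
  after the rounds \<open>Correction\<close>, \<open>Delta\<close>, \<open>Outcome\<close>.
\<close>

fun advance :: "nat \<Rightarrow> 'v round_kind \<Rightarrow> ('v \<Rightarrow> nat) \<Rightarrow> 'v \<Rightarrow> nat" where
  "advance n (Shares v) q = q(v := 1)"
| "advance n (Send v) q = q(v := 2)"
| "advance n (Hop v j) q = q(v := j + 3)"
| "advance n (Correction v) q = q(v := n + 3)"
| "advance n (Delta v) q = q(v := n + 4)"
| "advance n (Outcome v) q = q(v := n + 5)"
| "advance n _ q = q"

definition earlier :: "'v public_info \<Rightarrow> 'v \<Rightarrow> 'v set" where
  "earlier P v = set (takeWhile (\<lambda>u. u \<noteq> v) (meas_order P))"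

text \<open>The rotations of different vertices do not interleave: while \<open>v\<close> is being
  rotated, every other qubit is either not begun or finished.\<close>

definition idle :: "'v public_info \<Rightarrow> 'v \<Rightarrow> ('v \<Rightarrow> nat) \<Rightarrow> bool" where
  "idle P v q \<longleftrightarrow> v \<in> verts P \<and> (\<forall>u. u \<noteq> v \<longrightarrow> q u = 0 \<or> q u = clients P + 3)"

text \<open>Together with \<open>accepts\<close> this is an automaton that the schedule runs
  through. Later case distinctions on the kind of a round read off from it where each vertex
  stands.\<close>

fun expected :: "'v public_info \<Rightarrow> 'v round_kind \<Rightarrow> ('v \<Rightarrow> nat) \<Rightarrow> bool" where
  "expected P Inputs q \<longleftrightarrow> q = (\<lambda>_. 0)"
| "expected P (Shares v) q \<longleftrightarrow> idle P v q \<and> q v = 0"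
| "expected P (Send v) q \<longleftrightarrow> idle P v q \<and> q v = 1"
| "expected P (Hop v j) q \<longleftrightarrow> idle P v q \<and> j < clients P \<and> q v = j + 2"
| "expected P (Correction v) q \<longleftrightarrow> idle P v q \<and> q v = clients P + 2"
| "expected P Entangle q \<longleftrightarrow> (\<forall>v\<in>verts P. q v = clients P + 3)"
| "expected P (Delta v) q \<longleftrightarrow> v \<in> set (meas_order P) \<and>
    (\<forall>u\<in>verts P. q u = clients P + (if u \<in> earlier P v then 5 else 3))"
| "expected P (Outcome v) q \<longleftrightarrow> v \<in> set (meas_order P) \<and>
    (\<forall>u\<in>verts P. q u = clients P + (if u = v then 4 else if u \<in> earlier P v then 5 else 3))"
| "expected P Outputs q \<longleftrightarrow>
    (\<forall>u\<in>verts P. q u = clients P + (if u \<in> set (meas_order P) then 5 else 3))"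

fun accepts :: "'v public_info \<Rightarrow> 'v round_kind list \<Rightarrow> ('v \<Rightarrow> nat) \<Rightarrow> bool" where
  "accepts P [] q \<longleftrightarrow> True"
| "accepts P (k # ks) q \<longleftrightarrow> expected P k q \<and> (\<forall>v. q v \<noteq> 0 \<longrightarrow> v \<in> verts P) \<and>
    accepts P ks (advance (clients P) k q)"

abbreviation advances :: "'v public_info \<Rightarrow> 'v round_kind list \<Rightarrow> ('v \<Rightarrow> nat) \<Rightarrow> 'v \<Rightarrow> nat" where
  "advances P \<equiv> fold (advance (clients P))"

lemma accepts_append:
  "accepts P (xs @ ys) q \<longleftrightarrow> accepts P xs q \<and> accepts P ys (advances P xs q)"
  by (induction xs arbitrary: q) auto

definition stage :: "'v public_info \<Rightarrow> nat \<Rightarrow> 'v \<Rightarrow> nat" where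
  "stage P t = advances P (take t (schedule P)) (\<lambda>_. 0)"

lemma stage_0: "stage P 0 = (\<lambda>_. 0)"
  by (simp add: stage_def)

lemma stage_Suc:
  "t < length (schedule P) \<Longrightarrow> stage P (Suc t) = advance (clients P) (schedule P ! t) (stage P t)"
  by (simp add: stage_def take_Suc_conv_app_nth)

lemma accepts_nth:
  assumes "accepts P ks q" "t < length ks"
  shows "expected P (ks ! t) (advances P (take t ks) q)"
    and "advances P (take t ks) q v \<noteq> 0 \<Longrightarrow> v \<in> verts P"
  using assms
proof (induction ks arbitrary: q t)
  case (Cons k ks)
  { case 1 then show ?case using Cons.IH(1)[of _ "t - 1"] by (cases t) auto }
  { case 2 then show ?case using Cons.IH(2)[of "t - 1"] by (cases t) auto }
qed auto

definition rotation_rounds :: "'v public_info \<Rightarrow> 'v \<Rightarrow> 'v round_kind list" where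
  "rotation_rounds P v = [Shares v, Send v] @ map (Hop v) [0..<clients P] @ [Correction v]"

lemma schedule_eq:
  "schedule P = Inputs # (concat (map (rotation_rounds P) (prep_order P)) @ [Entangle] @
    concat (map (\<lambda>v. [Delta v, Outcome v]) (meas_order P))) @ [Outputs]"
  by (simp add: schedule_def rotation_rounds_def[abs_def])

lemma accepts_hops:
  assumes "idle P v q" "q v = 2" "\<forall>v. q v \<noteq> 0 \<longrightarrow> v \<in> verts P" "k \<le> clients P"
  shows "accepts P (map (Hop v) [0..<k]) q \<and> advances P (map (Hop v) [0..<k]) q = q(v := k + 2)"
  using assms(4)
proof (induction k)
  case 0
  then show ?case using assms(2) by (auto simp: fun_eq_iff)
next
  case (Suc k)
  then show ?case using assms(1,3) by (auto simp: accepts_append idle_def)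
qed

lemma accepts_rotation_rounds:
  assumes "idle P v q" "q v = 0" "\<forall>v. q v \<noteq> 0 \<longrightarrow> v \<in> verts P"
  shows "accepts P (rotation_rounds P v) q \<and> advances P (rotation_rounds P v) q = q(v := clients P + 3)"
proof -
  have "accepts P (map (Hop v) [0..<clients P]) (q(v := 2)) \<and>
      advances P (map (Hop v) [0..<clients P]) (q(v := 2)) = q(v := clients P + 2)"
    using accepts_hops[of P v "q(v := 2)" "clients P"] assms by (auto simp: idle_def)
  then show ?thesis
    using assms by (auto simp: rotation_rounds_def accepts_append idle_def)
qed

lemma accepts_all_rotation_rounds:
  assumes "distinct vs" "set vs \<subseteq> verts P" "\<forall>v\<in>set vs. q v = 0" "\<forall>v. q v = 0 \<or> q v = clients P + 3"
    "\<forall>v. q v \<noteq> 0 \<longrightarrow> v \<in> verts P"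
  shows "accepts P (concat (map (rotation_rounds P) vs)) q \<and>
    advances P (concat (map (rotation_rounds P) vs)) q =
      (\<lambda>u. if u \<in> set vs then clients P + 3 else q u)"
  using assms
proof (induction vs arbitrary: q)
  case (Cons v vs)
  let ?q = "q(v := clients P + 3)"
  have 1: "accepts P (rotation_rounds P v) q \<and> advances P (rotation_rounds P v) q = ?q"
    using Cons.prems by (intro accepts_rotation_rounds) (auto simp: idle_def)
  have 2: "accepts P (concat (map (rotation_rounds P) vs)) ?q \<and>
    advances P (concat (map (rotation_rounds P) vs)) ?q =
      (\<lambda>u. if u \<in> set vs then clients P + 3 else ?q u)"
    using Cons.prems by (intro Cons.IH) auto
  show ?case using 1 2 by (auto simp: accepts_append)
qed auto

lemma earlier_append: "distinct (us @ v # vs) \<Longrightarrow> meas_order P = us @ v # vs \<Longrightarrow> earlier P v = set us"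
  by (auto simp: earlier_def takeWhile_append)

lemma accepts_measurement_rounds:
  assumes "meas_order P = us @ vs" "distinct (meas_order P)" "set (meas_order P) \<subseteq> verts P"
    "\<forall>u\<in>verts P. q u = clients P + (if u \<in> set us then 5 else 3)" "\<forall>v. q v \<noteq> 0 \<longrightarrow> v \<in> verts P"
  shows "accepts P (concat (map (\<lambda>v. [Delta v, Outcome v]) vs)) q \<and>
    advances P (concat (map (\<lambda>v. [Delta v, Outcome v]) vs)) q =
      (\<lambda>u. if u \<in> set vs then clients P + 5 else q u)"
  using assms(1,4,5)
proof (induction vs arbitrary: us q)
  case (Cons v vs)
  have e: "earlier P v = set us" using earlier_append[of us v vs P] Cons.prems assms(2) by auto
  have v: "v \<in> verts P" "v \<notin> set us" using assms(2,3) Cons.prems by auto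
  let ?q = "q(v := clients P + 5)"
  have "accepts P (concat (map (\<lambda>v. [Delta v, Outcome v]) vs)) ?q \<and>
    advances P (concat (map (\<lambda>v. [Delta v, Outcome v]) vs)) ?q =
      (\<lambda>u. if u \<in> set vs then clients P + 5 else ?q u)"
    using Cons.prems v by (intro Cons.IH[of "us @ [v]"]) auto
  moreover have "v \<notin> set vs" using assms(2) Cons.prems by auto
  ultimately show ?case using Cons.prems v by (auto simp: e)
qed auto

lemma accepts_schedule:
  assumes "well_formed P"
  shows "accepts P (schedule P) (\<lambda>_. 0)"
proof -
  let ?X = "concat (map (rotation_rounds P) (prep_order P))"
  let ?Y = "concat (map (\<lambda>v. [Delta v, Outcome v]) (meas_order P))"
  let ?q = "\<lambda>u. if u \<in> set (prep_order P) then clients P + 3 else 0"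
  have 1: "accepts P ?X (\<lambda>_. 0) \<and> advances P ?X (\<lambda>_. 0) = ?q"
    using assms by (intro accepts_all_rotation_rounds) (auto simp: well_formed_def)
  have 2: "accepts P ?Y ?q \<and> advances P ?Y ?q =
      (\<lambda>u. if u \<in> set (meas_order P) then clients P + 5 else ?q u)"
    using assms by (intro accepts_measurement_rounds[of P "[]"]) (auto simp: well_formed_def)
  show ?thesis
    using 1 2 assms by (auto simp: schedule_eq accepts_append well_formed_def)
qed

lemma expected_schedule:
  "well_formed P \<Longrightarrow> t < length (schedule P) \<Longrightarrow> expected P (schedule P ! t) (stage P t)"
  unfolding stage_def using accepts_nth(1)[OF accepts_schedule] .

lemma schedule_first: "schedule P ! 0 = Inputs"
  by (simp add: schedule_eq)

lemma schedule_last: "schedule P ! (length (schedule P) - 1) = Outputs"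
  by (simp add: schedule_eq nth_append)

lemma schedule_pos [simp]: "0 < length (schedule P)"
  by (simp add: schedule_eq)

lemma schedule_middle:
  assumes "0 < t" "Suc t < length (schedule P)"
  shows "schedule P ! t \<noteq> Inputs" "schedule P ! t \<noteq> Outputs"
proof -
  let ?X = "concat (map (rotation_rounds P) (prep_order P)) @ [Entangle] @
    concat (map (\<lambda>v. [Delta v, Outcome v]) (meas_order P))"
  have "schedule P = Inputs # ?X @ [Outputs]" by (rule schedule_eq)
  then have "schedule P ! t = ?X ! (t - 1)" "t - 1 < length ?X"
    using assms by (auto simp: nth_append nth_Cons' simp del: append_assoc)
  then have "schedule P ! t \<in> set ?X" by (metis nth_mem)
  then show "schedule P ! t \<noteq> Inputs" "schedule P ! t \<noteq> Outputs"
    by (auto simp: rotation_rounds_def)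
qed

lemma schedule_Outputs_iff:
  "t < length (schedule P) \<Longrightarrow> schedule P ! t = Outputs \<longleftrightarrow> Suc t = length (schedule P)"
  using schedule_middle[of t P] schedule_last[of P] schedule_first[of P]
  by (metis Suc_lessI diff_Suc_1 gr_zeroI round_kind.distinct(15))

lemma schedule_Inputs_iff:
  "t < length (schedule P) \<Longrightarrow> schedule P ! t = Inputs \<longleftrightarrow> t = 0"
  using schedule_middle[of t P] schedule_last[of P] schedule_first[of P]
  by (metis Suc_lessI diff_Suc_1 gr_zeroI round_kind.distinct(15))

section \<open>Hybrid games\<close>

text \<open>
  The qubit that the simulator keeps for a vertex while no malicious party holds it, and the ancilla of
  the vertex.
\<close>

definition home :: "'v public_info \<Rightarrow> 'v \<Rightarrow> 'v wire reg" where
  "home P v = SimMem (2 * to_nat_on (verts P) v)"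

definition anc :: "'v public_info \<Rightarrow> 'v \<Rightarrow> 'v wire reg" where
  "anc P v = SimMem (2 * to_nat_on (verts P) v + 1)"

lemma anc_neq_home [simp]: "anc P v \<noteq> home P u"
  by (simp add: home_def anc_def) presburger

text \<open>One record for the SMPC resource and all honest parties. For a postponed vertex
  \<open>hy_delta\<close> remembers the announced angle, and \<open>hy_m\<close> holds the reported
  outcome, which still lacks the flip by \<open>r\<close>. The outcomes measured by an honest server
  are in \<open>hy_b\<close>.\<close>

record 'v hybrid_state =
  hy_input :: "nat \<Rightarrow> 'v client_input"
  hy_share :: "nat \<Rightarrow> 'v \<Rightarrow> int"
  hy_theta :: "'v \<Rightarrow> int"
  hy_sum :: "'v \<Rightarrow> int"
  hy_delta :: "'v \<Rightarrow> int"
  hy_r :: "'v \<Rightarrow> bool"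
  hy_m :: "'v \<Rightarrow> bool"
  hy_b :: "'v \<Rightarrow> bool"

definition no_input :: "'v client_input" where
  "no_input = (\<lambda>_. False, [])"

definition hybrid_init :: "'v hybrid_state" where
  "hybrid_init = \<lparr>hy_input = \<lambda>_. no_input, hy_share = \<lambda>_ _. 0, hy_theta = \<lambda>_. 0, hy_sum = \<lambda>_. 0,
     hy_delta = \<lambda>_. 0, hy_r = \<lambda>_. False, hy_m = \<lambda>_. False, hy_b = \<lambda>_. False\<rparr>"

definition honest_clients :: "'v public_info \<Rightarrow> party set \<Rightarrow> nat list" where
  "honest_clients P M = filter (\<lambda>j. Client j \<notin> M) [0..<clients P]"

text \<open>The result is a whole table of shares. Entries outside the list keep their old value,
  which is 0 in the games, so a share that is not drawn adds nothing to the sum.\<close>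

primrec draw :: "nat list \<Rightarrow> (nat \<Rightarrow> int) \<Rightarrow> ('r, nat \<Rightarrow> int) instrument" where
  "draw [] g = ireturn g"
| "draw (j # js) g = ibind (sample angles) (\<lambda>a. draw js (g(j := a)))"

text \<open>If \<open>ex\<close> is false, only outcomes of vertices measured earlier are read. An
  evaluation in the last round, when later outcomes are present too, then still gives the angle of
  the proper round.\<close>

definition pattern_angle :: "'v public_info \<Rightarrow> bool \<Rightarrow> 'v hybrid_state \<Rightarrow> 'v \<Rightarrow> int" where
  "pattern_angle P ex s v = (case description P (hy_input s) of (\<phi>, f) \<Rightarrow>
     corrected_angle P \<phi> f (\<lambda>w. (ex \<or> w \<in> earlier P v) \<and> hy_m s w) v) +
     4 * of_bool (input_bit P (hy_input s) v)"

text \<open>While the share of client \<open>h\<close> is missing from \<open>hy_theta\<close>, the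
  equation \<delta> = pattern angle + \<theta> + share + 4 r determines the share as the measured
  angle minus 4 r. The lists used are in measurement order, as each angle needs the flipped outcomes
  before it.\<close>

primrec resolve :: "'v public_info \<Rightarrow> 'v list \<Rightarrow> 'v hybrid_state \<Rightarrow>
    ('v wire reg, 'v hybrid_state) instrument" where
  "resolve P [] s = ireturn s"
| "resolve P (w # ws) s =
     ibind (measure_out (hy_delta s w - pattern_angle P False s w - hy_theta s w) (anc P w))
       (\<lambda>r. resolve P ws (s\<lparr>hy_m := (hy_m s)(w := (hy_m s w \<noteq> r))\<rparr>))"

definition hybrid_key :: "'v public_info \<Rightarrow> 'v hybrid_state \<Rightarrow> 'v \<Rightarrow> int \<times> bool" where
  "hybrid_key P s v = (case description P (hy_input s) of (\<phi>, f) \<Rightarrow>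
     ((hy_theta s v + (of_bool (s_Z P f (hy_m s) v) + of_bool (input_bit P (hy_input s) v)) * 4) mod 8,
      s_X P f (hy_m s) v))"

definition decrypt :: "'v public_info \<Rightarrow> ('v \<Rightarrow> int \<times> bool) \<Rightarrow> nat \<Rightarrow> ('v wire reg, unit) instrument" where
  "decrypt P key j = for_each (filter (\<lambda>v. v \<in> outs P j) (prep_order P)) (\<lambda>v. gate
     ((if snd (key v) then X_gate (vq v) else id) \<circ> Rz (- fst (key v)) (vq v)))"

definition hybrid_output :: "'v public_info \<Rightarrow> party set \<Rightarrow> 'v hybrid_state \<Rightarrow> party \<rightharpoonup> 'v msg" where
  "hybrid_output P M s p = (case p of
     Client j \<Rightarrow> if j < clients P then Some (
         if Client j \<in> M then Result (classical_output P j (hy_m s))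
           (\<lambda>v. if v \<in> outs P j then hybrid_key P s v else (0, False))
         else Output (classical_output P j (hy_m s)))
       else None
   | Server \<Rightarrow> None)"

text \<open>
  The joint work of all honest parties and of the SMPC resource against the coalition \<open>M\<close>.
  For the vertices in \<open>W\<close> the rotation by client \<open>h\<close> is replaced by a controlled-X onto an ancilla,
  \<open>\<delta>(v)\<close> is drawn uniformly, and the ancilla is measured only in the last round, where the outcome
  plays the role of \<open>r(v)\<close>.  The flag \<open>ex\<close> selects the literal form of the protocol, in which
  \<open>\<theta>(v)\<close> is drawn directly; otherwise the correction angle of the rotation is drawn instead.
\<close>

definition hybrid_step :: "'v public_info \<Rightarrow> party set \<Rightarrow> nat \<Rightarrow> 'v list \<Rightarrow> bool \<Rightarrow> 'v round_kind \<Rightarrow>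
    'v hybrid_state \<Rightarrow> (party \<rightharpoonup> 'v msg) \<Rightarrow>
    ('v wire reg, 'v hybrid_state \<times> (party \<rightharpoonup> 'v msg)) instrument" where
  "hybrid_step P M h W ex k s m = (case k of
     Inputs \<Rightarrow> ireturn (s\<lparr>hy_input := \<lambda>j. if j < clients P
         then restrict_input P j (input_of (m (Client j))) else no_input\<rparr>, Map.empty)
   | Shares v \<Rightarrow>
       ibind (draw (if v \<in> set W then removeAll h (honest_clients P M) else honest_clients P M)
         (\<lambda>_. 0)) (\<lambda>g.
       ibind (sample angles) (\<lambda>c. let S = \<Sum>j<clients P.
           if Client j \<in> M then angle_of (m (Client j)) else g j in
       ireturn (s\<lparr>hy_share := \<lambda>j. (hy_share s j)(v := g j), hy_sum := (hy_sum s)(v := S),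
         hy_theta := (hy_theta s)(v := if ex then c else (c + S) mod 8)\<rparr>, Map.empty)))
   | Send v \<Rightarrow> ibind (if Server \<in> M then ireturn () else prepare 0 (vq v)) (\<lambda>_. ireturn (s, Map.empty))
   | Hop v j \<Rightarrow> ibind (if Client j \<in> M then ireturn ()
         else if j = h \<and> v \<in> set W then ibind (reset (anc P v)) (\<lambda>_. gate (cnot (vq v) (anc P v)))
         else gate (Rz (hy_share s j v) (vq v))) (\<lambda>_. ireturn (s, Map.empty))
   | Correction v \<Rightarrow> let c = (hy_theta s v - hy_sum s v) mod 8 in
       ibind (if Server \<in> M then ireturn () else gate (Rz c (vq v))) (\<lambda>_.
       ireturn (s, if Server \<in> M then [Server \<mapsto> Angle c] else Map.empty))
   | Entangle \<Rightarrow> ibind (if Server \<in> M then ireturn () else entangle P) (\<lambda>_. ireturn (s, Map.empty))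
   | Delta v \<Rightarrow>
       ibind (if v \<in> set W then imap (\<lambda>d. (False, d, d)) (sample angles)
         else imap (\<lambda>r. (r, (pattern_angle P ex s v + hy_theta s v + of_bool r * 4) mod 8, 0)) (sample [False, True])) (\<lambda>(r, d, d').
       ibind (if Server \<in> M then ireturn False else measure_pm d (vq v)) (\<lambda>b.
       ireturn (s\<lparr>hy_r := (hy_r s)(v := r), hy_delta := (hy_delta s)(v := d'),
         hy_b := (hy_b s)(v := b)\<rparr>, if Server \<in> M then [Server \<mapsto> Angle d] else Map.empty)))
   | Outcome v \<Rightarrow> ireturn (s\<lparr>hy_m := (hy_m s)(v :=
         ((if Server \<in> M then bit_of (m Server) else hy_b s v) \<noteq> hy_r s v))\<rparr>, Map.empty)
   | Outputs \<Rightarrow> ibind (resolve P W s) (\<lambda>s'.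
       ibind (for_each (honest_clients P M) (decrypt P (hybrid_key P s'))) (\<lambda>_.
       ireturn (s', hybrid_output P M s'))))"

definition hybrid :: "'v public_info \<Rightarrow> party set \<Rightarrow> nat \<Rightarrow> 'v list \<Rightarrow> bool \<Rightarrow>
    (party, 'v wire, 'v msg, 'v hybrid_state) resource" where
  "hybrid P M h W ex = \<lparr>rounds = length (schedule P), in_port = \<lambda>_ _. {}, out_port = \<lambda>_ _. {},
     res_init = hybrid_init, res_step = \<lambda>t. hybrid_step P M h W ex (schedule P ! t)\<rparr>"

subsection \<open>Locality\<close>

definition touched :: "'v public_info \<Rightarrow> party set \<Rightarrow> 'v round_kind \<Rightarrow> 'v wire reg set" where
  "touched P M k = (case k of
     Send v \<Rightarrow> if Server \<in> M then {} else {vq v}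
   | Hop v j \<Rightarrow> if Client j \<in> M then {} else {vq v, anc P v}
   | Outputs \<Rightarrow> vq ` out_verts P \<union> anc P ` verts P
   | _ \<Rightarrow> if Server \<in> M then {} else vq ` verts P)"

lemma instrument_on_draw [simp]: "instrument_on R (draw js g)"
  by (induction js arbitrary: g) (auto intro!: instrument_on_ibind simp: angles_def)

lemma instrument_on_resolve:
  "set ws \<subseteq> verts P \<Longrightarrow> anc P ` verts P \<subseteq> R \<Longrightarrow> instrument_on R (resolve P ws s)"
  by (induction ws arbitrary: s) (auto intro!: instrument_on_ibind instrument_on_measure_out)

lemma instrument_on_key_gate:
  assumes "q \<in> R"
  shows "instrument_on R (gate ((if b then X_gate q else id) \<circ> Rz a q))"
proof -
  have "local_op R (if b then X_gate q else id)"
    using assms by (simp add: local_op_X local_op_id[folded id_def])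
  then have "local_op R ((if b then X_gate q else id) \<circ> Rz a q)"
    using assms by (intro local_op_compose local_op_Rz)
  then show ?thesis by (simp add: instrument_on_iff)
qed

lemma instrument_on_decrypt:
  "j < clients P \<Longrightarrow> vq ` out_verts P \<subseteq> R \<Longrightarrow> instrument_on R (decrypt P key j)"
  unfolding decrypt_def
  by (intro instrument_on_for_each instrument_on_key_gate) (auto simp: out_verts_def)

lemma instrument_on_entangle:
  assumes "well_formed P"
  shows "instrument_on (vq ` verts P) (entangle P)"
  unfolding entangle_def
  by (rule instrument_on_CZ_all[of "vq ` verts P"]) (use assms in \<open>auto simp: well_formed_def\<close>)

lemma expected_vert:
  "expected P k q \<Longrightarrow> well_formed P \<Longrightarrow>
    k \<in> {Shares v, Send v, Hop v j, Correction v, Delta v, Outcome v} \<Longrightarrow> v \<in> verts P"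
  by (auto simp: idle_def well_formed_def)

lemma instrument_on_hybrid_step:
  assumes "well_formed P" "set W \<subseteq> verts P" "expected P k q"
  shows "instrument_on (touched P M k) (hybrid_step P M h W ex k s m)"
proof -
  note [intro!] = instrument_on_ibind instrument_on_for_each
  show ?thesis
  proof (cases k)
    case (Send v)
    then show ?thesis by (auto simp: hybrid_step_def touched_def)
  next
    case (Hop v j)
    have "vq v \<noteq> anc P v" by (simp add: anc_def)
    with Hop show ?thesis
      by (auto simp: hybrid_step_def touched_def intro!: instrument_on_reset instrument_on_cnot)
  next
    case (Correction v)
    then show ?thesis using expected_vert[OF assms(3,1), of v]
      by (auto simp: hybrid_step_def touched_def Let_def)
  next
    case Entangle
    then show ?thesis using instrument_on_entangle[OF assms(1)]
      by (auto simp: hybrid_step_def touched_def)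
  next
    case (Delta v)
    then show ?thesis using expected_vert[OF assms(3,1), of v]
      by (auto simp: hybrid_step_def touched_def angles_def)
  next
    case Outputs
    then show ?thesis using assms(2)
      by (auto simp: hybrid_step_def touched_def honest_clients_def
          intro!: instrument_on_resolve instrument_on_decrypt)
  qed (auto simp: hybrid_step_def touched_def Let_def angles_def)
qed

lemma local_hybrid:
  assumes "well_formed P" "set W \<subseteq> verts P" "t < length (schedule P)"
  shows "local_instr UNIV (res_step (hybrid P M h W ex) t s m)"
proof -
  have "local_instr (touched P M (schedule P ! t)) (hybrid_step P M h W ex (schedule P ! t) s m)"
    using instrument_on_hybrid_step[OF assms(1,2) expected_schedule[OF assms(1,3)]]
    by (simp add: instrument_on_iff)
  then show ?thesis unfolding hybrid_def using local_instr_mono subset_UNIV by fastforce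
qed

section \<open>The protocol as a hybrid game\<close>

lemma for_each_cong [fundef_cong]:
  "xs = ys \<Longrightarrow> (\<And>x. x \<in> set ys \<Longrightarrow> g x = g' x) \<Longrightarrow> for_each xs g = for_each ys g'"
  by (induction xs arbitrary: ys) auto

lemma for_each_ireturn [simp]: "for_each xs (\<lambda>_. ireturn ()) = ireturn ()"
  by (induction xs) auto

lemma for_each_append: "for_each (xs @ ys) g = ibind (for_each xs g) (\<lambda>_. for_each ys g)"
  by (induction xs) (auto simp: ibind_assoc)

lemma for_each_map: "for_each (map f xs) g = for_each xs (\<lambda>x. g (f x))"
  by (induction xs) auto

lemma for_each_single:
  "distinct xs \<Longrightarrow> x \<in> set xs \<Longrightarrow> for_each xs (\<lambda>y. if y = x then I else ireturn ()) = I"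
proof (induction xs)
  case (Cons a xs)
  have "a = x \<Longrightarrow> for_each xs (\<lambda>y. if y = x then I else ireturn ()) = for_each xs (\<lambda>_. ireturn ())"
    using Cons.prems by (intro for_each_cong) auto
  then show ?case using Cons by auto
qed simp

text \<open>If no new state and no message depends on a measurement outcome, the classical part of
  running the parties in turn can be pulled out of the quantum part.\<close>

lemma run_parties_seq:
  assumes "distinct ps"
    and "\<And>p. p \<in> set ps \<Longrightarrow> g p (s p) (m p) = ibind (I p) (\<lambda>_. ireturn (S p, X p))"
  shows "run_parties ps g s m = ibind (for_each ps I)
    (\<lambda>_. ireturn (\<lambda>p. if p \<in> set ps then S p else s p, \<lambda>p. if p \<in> set ps then X p else m p))"
  using assms
proof (induction ps arbitrary: s m)
  case (Cons p ps)
  have "run_parties ps g (s(p := S p)) (m(p := X p)) = ibind (for_each ps I)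
    (\<lambda>_. ireturn (\<lambda>q. if q \<in> set ps then S q else (s(p := S p)) q,
      \<lambda>q. if q \<in> set ps then X q else (m(p := X p)) q))"
    by (rule Cons.IH) (use Cons.prems in auto)
  also have "\<dots> = ibind (for_each ps I)
    (\<lambda>_. ireturn (\<lambda>q. if q \<in> set (p # ps) then S q else s q,
      \<lambda>q. if q \<in> set (p # ps) then X q else m q))"
    by (intro ibind_cong refl arg_cong[where f = ireturn]) (auto simp: fun_eq_iff)
  finally show ?case using Cons.prems(2)[of p] by (simp add: ibind_assoc)
qed simp

lemma run_parties_det:
  assumes "distinct ps" "\<And>p. p \<in> set ps \<Longrightarrow> g p (s p) (m p) = ireturn (S p, X p)"
  shows "run_parties ps g s m =
    ireturn (\<lambda>p. if p \<in> set ps then S p else s p, \<lambda>p. if p \<in> set ps then X p else m p)"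
  using run_parties_seq[of ps g s m "\<lambda>_. ireturn ()" S X] assms by simp

lemma run_parties_append:
  "run_parties (ps @ qs) g s m = ibind (run_parties ps g s m) (\<lambda>(s', m'). run_parties qs g s' m')"
  by (induction ps arbitrary: s m) (auto simp: ibind_assoc case_prod_beta' intro!: ibind_cong)

lemma draw_outcome: "g' \<in> fst ` set (draw js g :: ('r, nat \<Rightarrow> int) instrument) \<Longrightarrow> i \<notin> set js \<Longrightarrow> g' i = g i"
proof (induction js arbitrary: g)
  case (Cons j js)
  from Cons.prems(1) obtain a where "g' \<in> fst ` set (draw js (g(j := a)) :: ('r, nat \<Rightarrow> int) instrument)"
    unfolding draw.simps fst_set_ibind by blast
  from Cons.IH[OF this] show ?case using Cons.prems by auto
qed simp

lemma draw_outcome': "(g', K) \<in> set (draw js g) \<Longrightarrow> i \<notin> set js \<Longrightarrow> g' i = g i"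
  by (rule draw_outcome) force+

lemma imap_cong: "(\<And>x. x \<in> fst ` set I \<Longrightarrow> g x = g' x) \<Longrightarrow> imap g I = imap g' I"
  unfolding imap_def by (force intro!: map_cong)

text \<open>The separate draws of the honest clients become one draw of the table of shares, from
  which states and messages are computed afterwards. The initial table \<open>g0\<close> is
  arbitrary because every entry that is read has been overwritten.\<close>

lemma run_parties_draw:
  assumes "distinct js"
    and "\<And>j. j \<in> set js \<Longrightarrow> G (Client j) (s (Client j)) (m (Client j)) =
      ibind (sample angles) (\<lambda>a. ireturn (S j a, X a))"
  shows "run_parties (map Client js) G s m = imap (\<lambda>g.
      (\<lambda>p. case p of Server \<Rightarrow> s p | Client j \<Rightarrow> if j \<in> set js then S j (g j) else s p,
       \<lambda>p. case p of Server \<Rightarrow> m p | Client j \<Rightarrow> if j \<in> set js then X (g j) else m p)) (draw js g0 :: ('r, nat \<Rightarrow> int) instrument)"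
  using assms
proof (induction js arbitrary: s m g0)
  case Nil
  have "(\<lambda>p. case p of Server \<Rightarrow> s p | Client j \<Rightarrow> if j \<in> set [] then S j (g0 j) else s p) = s"
    "(\<lambda>p. case p of Server \<Rightarrow> m p | Client j \<Rightarrow> if j \<in> set [] then X (g0 j) else m p) = m"
    by (auto simp: fun_eq_iff split: party.splits)
  then show ?case by (simp only: list.map run_parties.simps draw.simps imap_ireturn)
next
  case (Cons j js)
  let ?s = "\<lambda>a. s(Client j := S j a)" and ?m = "\<lambda>a. m(Client j := X a)"
  have "run_parties (map Client (j # js)) G s m =
      ibind (sample angles) (\<lambda>a. run_parties (map Client js) G (?s a) (?m a))"
    using Cons.prems(2)[of j] by (simp add: ibind_assoc)
  also have "\<dots> = ibind (sample angles) (\<lambda>a. imap (\<lambda>g.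
      (\<lambda>p. case p of Server \<Rightarrow> ?s a p | Client i \<Rightarrow> if i \<in> set js then S i (g i) else ?s a p,
       \<lambda>p. case p of Server \<Rightarrow> ?m a p | Client i \<Rightarrow> if i \<in> set js then X (g i) else ?m a p))
        (draw js (g0(j := a))))"
    by (intro ibind_cong refl Cons.IH) (use Cons.prems in auto)
  also have "\<dots> = ibind (sample angles) (\<lambda>a. imap (\<lambda>g.
      (\<lambda>p. case p of Server \<Rightarrow> s p | Client i \<Rightarrow> if i \<in> set (j # js) then S i (g i) else s p,
       \<lambda>p. case p of Server \<Rightarrow> m p | Client i \<Rightarrow> if i \<in> set (j # js) then X (g i) else m p))
        (draw js (g0(j := a))))"
  proof (intro ibind_cong refl imap_cong)
    fix a g assume "g \<in> fst ` set (draw js (g0(j := a)) :: ('r, nat \<Rightarrow> int) instrument)"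
    then have "g j = a" using draw_outcome[of g js "g0(j := a)" j] Cons.prems(1) by auto
    then show "(\<lambda>p. case p of Server \<Rightarrow> ?s a p | Client i \<Rightarrow> if i \<in> set js then S i (g i) else ?s a p,
       \<lambda>p. case p of Server \<Rightarrow> ?m a p | Client i \<Rightarrow> if i \<in> set js then X (g i) else ?m a p) =
      (\<lambda>p. case p of Server \<Rightarrow> s p | Client i \<Rightarrow> if i \<in> set (j # js) then S i (g i) else s p,
       \<lambda>p. case p of Server \<Rightarrow> m p | Client i \<Rightarrow> if i \<in> set (j # js) then X (g i) else m p)"
      by (auto simp: fun_eq_iff split: party.splits)
  qed
  finally show ?case by (simp add: imap_ibind)
qed

definition honest :: "'v public_info \<Rightarrow> party set \<Rightarrow> party list" where
  "honest P M = filter (\<lambda>p. p \<notin> M) (parties P)"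

lemma honest_eq:
  "honest P M = (if Server \<in> M then [] else [Server]) @ map Client (honest_clients P M)"
  by (simp add: honest_def parties_def honest_clients_def filter_map comp_def)

lemma set_honest_clients: "set (honest_clients P M) = {j. j < clients P \<and> Client j \<notin> M}"
  by (auto simp: honest_clients_def)

lemma distinct_honest_clients [simp]: "distinct (honest_clients P M)"
  by (simp add: honest_clients_def)

lemma distinct_honest [simp]: "distinct (honest P M)"
  by (auto simp: honest_eq distinct_map intro: inj_onI)

lemma set_honest: "p \<in> set (honest P M) \<longleftrightarrow> p \<notin> M \<and> (case p of Server \<Rightarrow> True | Client j \<Rightarrow> j < clients P)"
  by (auto simp: honest_eq set_honest_clients split: party.splits if_splits)

abbreviation real_game :: "'v public_info \<Rightarrow> party set \<Rightarrow>
    (party, 'v wire, 'v msg, (party \<Rightarrow> 'v local_state) \<times> 'v smpc_state) resource" where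
  "real_game P M \<equiv> run_by (honest P M) (mcbqc_protocol P) (smpc_resource P)"

text \<open>What the hybrid game does not track, such as local states of malicious parties, is fixed
  to constants. The steps of the two games then become equal as lists of Kraus operators.\<close>

definition flatten :: "'v public_info \<Rightarrow> party set \<Rightarrow> (party \<Rightarrow> 'v local_state) \<times> 'v smpc_state \<Rightarrow>
    'v hybrid_state" where
  "flatten P M = (\<lambda>(l, s). \<lparr>hy_input = \<lambda>j. if j < clients P then smpc_input s j else no_input,
     hy_share = \<lambda>j. if j \<in> set (honest_clients P M) then share (l (Client j)) else (\<lambda>_. 0),
     hy_theta = smpc_theta s, hy_sum = smpc_sum s, hy_delta = \<lambda>_. 0, hy_r = smpc_r s,
     hy_m = smpc_m s, hy_b = if Server \<in> M then \<lambda>_. False else outcome (l Server)\<rparr>)"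

lemma description_cong:
  "(\<And>j. j < clients P \<Longrightarrow> x j = y j) \<Longrightarrow> description P x = description P y"
proof -
  assume "\<And>j. j < clients P \<Longrightarrow> x j = y j"
  then have "map (\<lambda>j. snd (x j)) [0..<clients P] = map (\<lambda>j. snd (y j)) [0..<clients P]" by simp
  then show ?thesis by (simp only: description_def)
qed

lemma input_bit_cong:
  "(\<And>j. j < clients P \<Longrightarrow> x j = y j) \<Longrightarrow> input_bit P x v = input_bit P y v"
  by (auto simp: input_bit_def)

lemma real_step:
  "res_step (real_game P M) t (l, s) m =
    ibind (run_parties (honest P M) (\<lambda>p. case p of Server \<Rightarrow> server_pre P t | Client j \<Rightarrow> client_pre P j t)
      l (m |` set (honest P M))) (\<lambda>(l1, m1).
    ibind (smpc_step P t s (override_on m m1 (set (honest P M)))) (\<lambda>(s', m2).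
    ibind (run_parties (honest P M) (\<lambda>p. case p of Server \<Rightarrow> server_post P t | Client j \<Rightarrow> client_post P j t)
      l1 (m2 |` set (honest P M))) (\<lambda>(l2, m3).
    ireturn ((l2, s'), override_on m2 m3 (set (honest P M))))))"
proof -
  have 1: "(\<lambda>p. party_pre (mcbqc_protocol P p) t) =
     (\<lambda>p. case p of Server \<Rightarrow> server_pre P t | Client j \<Rightarrow> client_pre P j t)"
    by (auto simp: mcbqc_protocol_def fun_eq_iff split: party.splits)
  have 2: "(\<lambda>p. party_post (mcbqc_protocol P p) t) =
     (\<lambda>p. case p of Server \<Rightarrow> server_post P t | Client j \<Rightarrow> client_post P j t)"
    by (auto simp: mcbqc_protocol_def fun_eq_iff split: party.splits)
  show ?thesis
    by (simp add: run_by_def attach_def parallel_def smpc_resource_def 1 2)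
qed

lemma run_idle:
  assumes "\<And>p. p \<in> set (honest P M) \<Longrightarrow> g p (s p) (m p) = ireturn (s p, None)"
    "\<And>p. p \<notin> set (honest P M) \<Longrightarrow> m p = None"
  shows "run_parties (honest P M) g s m = ireturn (s, Map.empty)"
proof -
  have "(\<lambda>p. if p \<in> set (honest P M) then None else m p) = Map.empty" using assms(2) by auto
  then show ?thesis
    using run_parties_det[of "honest P M" g s m s "\<lambda>_. None"] assms(1) by simp
qed

text \<open>At most one party \<open>q\<close> touches qubits in the round: the server, or the
  client whose hop it is.\<close>

lemma run_server:
  assumes "\<And>p. p \<in> set (honest P M) \<Longrightarrow> g p (s p) (m p) =
      ibind (if p = q then I else ireturn ()) (\<lambda>_. ireturn (s p, None))"
    "\<And>p. p \<notin> set (honest P M) \<Longrightarrow> m p = None"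
  shows "run_parties (honest P M) g s m =
    ibind (if q \<in> set (honest P M) then I else ireturn ()) (\<lambda>_. ireturn (s, Map.empty))"
proof -
  have "for_each (honest P M) (\<lambda>p. if p = q then I else ireturn ()) =
      (if q \<in> set (honest P M) then I else ireturn ())"
  proof (cases "q \<in> set (honest P M)")
    case False
    then have "for_each (honest P M) (\<lambda>p. if p = q then I else ireturn ()) =
      for_each (honest P M) (\<lambda>_. ireturn ())" by (intro for_each_cong) auto
    with False show ?thesis by simp
  qed (simp add: for_each_single)
  moreover have "(\<lambda>p. if p \<in> set (honest P M) then None else m p) = Map.empty"
    using assms(2) by auto
  ultimately show ?thesis
    using run_parties_seq[of "honest P M" g s m "\<lambda>p. if p = q then I else ireturn ()" s "\<lambda>_. None"]
      assms(1) by simp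
qed

lemma override_empty [simp]: "override_on Map.empty Map.empty A = Map.empty"
  by (auto simp: override_on_def)

lemma const_upd: "(\<lambda>_. c)(v := c) = (\<lambda>_. c)"
  by auto

text \<open>With no postponed vertex and \<open>ex\<close> true, the hybrid step does literally the
  work of the honest parties and of the SMPC resource, in the same order; hence an equality of
  instruments and not only of expectations.\<close>

lemma flatten_step:
  assumes wf: "well_formed P" and t: "t < length (schedule P)"
  shows "imap (\<lambda>(s', m'). (flatten P M s', m')) (res_step (real_game P M) t (l, s) m) =
    hybrid_step P M h [] True (schedule P ! t) (flatten P M (l, s)) m"
proof -
  let ?H = "set (honest P M)"
  have exp: "expected P (schedule P ! t) (stage P t)" by (rule expected_schedule[OF wf t])
  have srv: "Server \<in> ?H \<longleftrightarrow> Server \<notin> M" by (simp add: set_honest)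
  have cli: "Client j \<in> ?H \<longleftrightarrow> j < clients P \<and> Client j \<notin> M" for j by (auto simp: set_honest)
  have rnone: "p \<notin> ?H \<Longrightarrow> (m' |` ?H) p = None" for p and m' :: "party \<rightharpoonup> 'a msg" by simp
  let ?pre = "\<lambda>p. case p of Server \<Rightarrow> server_pre P t | Client j \<Rightarrow> client_pre P j t"
  let ?post = "\<lambda>p. case p of Server \<Rightarrow> server_post P t | Client j \<Rightarrow> client_post P j t"
  note simps = hybrid_step_def real_step smpc_step_def client_pre_def server_pre_def client_post_def
    server_post_def
  show ?thesis
  proof (cases "schedule P ! t")
    case Inputs
    have pre: "run_parties (honest P M) ?pre l (m |` ?H) = ireturn (l, \<lambda>p. if p \<in> ?H then
        (case p of Server \<Rightarrow> None | Client j \<Rightarrow> Some (Input (input_of (m p)))) else None)"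
      by (subst run_parties_det[of _ _ l "m |` ?H" l
            "\<lambda>p. case p of Server \<Rightarrow> None | Client j \<Rightarrow> Some (Input (input_of (m p)))"])
        (auto simp: simps Inputs fun_eq_iff split: party.splits intro!: arg_cong[where f = ireturn])
    have post: "run_parties (honest P M) ?post l (Map.empty |` ?H) = ireturn (l, Map.empty)"
      by (rule run_idle) (auto simp: simps Inputs split: party.splits)
    show ?thesis
      unfolding real_step pre
      by (auto simp: smpc_step_def hybrid_step_def Inputs post[simplified] flatten_def override_on_def cli
          input_of_def fun_eq_iff intro!: arg_cong[where f = ireturn])
  next
    case (Shares v)
    let ?L = "\<lambda>g p. case p of Server \<Rightarrow> l p | Client j \<Rightarrow> if j \<in> set (honest_clients P M)
      then (l (Client j))\<lparr>share := (share (l (Client j)))(v := g j)\<rparr> else l p"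
    let ?m = "\<lambda>g p. case p of Server \<Rightarrow> None | Client j \<Rightarrow>
      if j \<in> set (honest_clients P M) then Some (Angle (g j)) else None"
    have pre: "run_parties (honest P M) ?pre l (m |` ?H) =
        imap (\<lambda>g. (?L g, ?m g)) (draw (honest_clients P M) (\<lambda>_. 0))"
    proof -
      have 1: "run_parties (map Client (honest_clients P M)) ?pre l m' = imap (\<lambda>g.
         (?L g, \<lambda>p. case p of Server \<Rightarrow> m' p | Client j \<Rightarrow> if j \<in> set (honest_clients P M)
            then Some (Angle (g j)) else m' p)) (draw (honest_clients P M) (\<lambda>_. 0))" for m'
        by (rule run_parties_draw[where S = "\<lambda>j a. (l (Client j))\<lparr>share := (share (l (Client j)))(v := a)\<rparr>"
              and X = "\<lambda>a. Some (Angle a)"]) (auto simp: simps Shares)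
      let ?mS = "if Server \<in> M then m |` ?H else (m |` ?H)(Server := None)"
      have 2: "run_parties (if Server \<in> M then [] else [Server]) ?pre l (m |` ?H) = ireturn (l, ?mS)"
        by (simp add: simps Shares)
      have 3: "(\<lambda>p. case p of Server \<Rightarrow> ?mS p | Client j \<Rightarrow> if j \<in> set (honest_clients P M)
            then Some (Angle (g j)) else ?mS p) = ?m g" for g
        by (auto simp: fun_eq_iff set_honest set_honest_clients restrict_map_def split: party.splits)
      have "run_parties (honest P M) ?pre l (m |` ?H) =
          run_parties (map Client (honest_clients P M)) ?pre l ?mS"
        by (subst honest_eq) (simp only: run_parties_append 2 ibind_ireturn_left prod.case)
      then show ?thesis by (simp only: 1 3)
    qed
    have post: "run_parties (honest P M) ?post l' Map.empty = ireturn (l', Map.empty)" for l'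
      by (rule run_idle) (auto simp: simps Shares split: party.splits)
    have S: "(\<Sum>j<clients P. angle_of (override_on m (?m g) ?H (Client j))) =
        (\<Sum>j<clients P. if Client j \<in> M then angle_of (m (Client j)) else g j)" for g
      by (intro sum.cong) (auto simp: override_on_def cli set_honest_clients angle_of_def)
    show ?thesis
      unfolding real_step pre
      by (auto simp: smpc_step_def hybrid_step_def Shares post flatten_def imap_ibind ibind_imap ibind_assoc
          Let_def S fun_eq_iff draw_outcome' intro!: ibind_cong arg_cong[where f = ireturn])
  next
    case (Send v)
    have pre: "run_parties (honest P M) ?pre l (m |` ?H) =
        ibind (if Server \<in> ?H then prepare 0 (vq v) else ireturn ()) (\<lambda>_. ireturn (l, Map.empty))"
      by (rule run_server) (auto simp: simps Send split: party.splits)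
    have post: "run_parties (honest P M) ?post l Map.empty = ireturn (l, Map.empty)"
      by (rule run_idle) (auto simp: simps Send split: party.splits)
    show ?thesis
      unfolding real_step pre
      by (simp add: smpc_step_def hybrid_step_def Send post ibind_assoc imap_ibind srv)
  next
    case (Hop v j)
    have j: "j < clients P" using exp by (simp add: Hop)
    have pre: "run_parties (honest P M) ?pre l (m |` ?H) =
        ibind (if Client j \<in> ?H then gate (Rz (share (l (Client j)) v) (vq v)) else ireturn ())
          (\<lambda>_. ireturn (l, Map.empty))"
      by (rule run_server) (auto simp: simps Hop split: party.splits)
    have post: "run_parties (honest P M) ?post l Map.empty = ireturn (l, Map.empty)"
      by (rule run_idle) (auto simp: simps Hop split: party.splits)
    show ?thesis
      unfolding real_step pre using j
      by (simp add: smpc_step_def hybrid_step_def Hop post ibind_assoc imap_ibind cli flatten_def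
          set_honest_clients)
  next
    case (Correction v)
    let ?c = "(smpc_theta s v - smpc_sum s v) mod 8"
    have pre: "run_parties (honest P M) ?pre l (m |` ?H) = ireturn (l, Map.empty)"
      by (rule run_idle) (auto simp: simps Correction split: party.splits)
    have post: "run_parties (honest P M) ?post l ([Server \<mapsto> Angle ?c] |` ?H) =
      ibind (if Server \<in> ?H then gate (Rz ?c (vq v)) else ireturn ()) (\<lambda>_. ireturn (l, Map.empty))"
      by (rule run_server) (auto simp: simps Correction angle_of_def split: party.splits)
    have "override_on [Server \<mapsto> x] Map.empty ?H = (if Server \<in> M then [Server \<mapsto> x] else Map.empty)"
      for x :: "'a msg"
      by (auto simp: override_on_def fun_eq_iff srv)
    then show ?thesis
      unfolding real_step pre
      by (simp add: smpc_step_def hybrid_step_def Correction post ibind_assoc imap_ibind srv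
          flatten_def Let_def del: restrict_fun_upd)
  next
    case Entangle
    have pre: "run_parties (honest P M) ?pre l (m |` ?H) =
        ibind (if Server \<in> ?H then entangle P else ireturn ()) (\<lambda>_. ireturn (l, Map.empty))"
      by (rule run_server) (auto simp: simps Entangle split: party.splits)
    have post: "run_parties (honest P M) ?post l Map.empty = ireturn (l, Map.empty)"
      by (rule run_idle) (auto simp: simps Entangle split: party.splits)
    show ?thesis
      unfolding real_step pre
      by (simp add: smpc_step_def hybrid_step_def Entangle post ibind_assoc imap_ibind srv)
  next
    case (Delta v)
    have pre: "run_parties (honest P M) ?pre l (m |` ?H) = ireturn (l, Map.empty)"
      by (rule run_idle) (auto simp: simps Delta split: party.splits)
    have post: "run_parties (honest P M) ?post l ([Server \<mapsto> Angle d] |` ?H) =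
      ibind (if Server \<in> M then ireturn False else measure_pm d (vq v)) (\<lambda>b. ireturn
        (if Server \<in> M then l else l(Server := (l Server)\<lparr>outcome := (outcome (l Server))(v := b)\<rparr>),
          Map.empty))" for d
    proof (cases "Server \<in> M")
      case True
      have "run_parties (honest P M) ?post l ([Server \<mapsto> Angle d] |` ?H) = ireturn (l, Map.empty)"
        by (rule run_idle) (use True in \<open>auto simp: simps Delta srv split: party.splits\<close>)
      with True show ?thesis by simp
    next
      case False
      have "run_parties (map Client (honest_clients P M)) ?post l' (([Server \<mapsto> Angle d] |` ?H)(Server := None))
          = ireturn (l', Map.empty)" for l'
      proof -
        have "([Server \<mapsto> Angle d] |` ?H)(Server := None) = Map.empty"
          by (auto simp: restrict_map_def fun_eq_iff)
        moreover have "run_parties (map Client (honest_clients P M)) ?post l' Map.empty =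
            ireturn (l', \<lambda>p. if p \<in> Client ` set (honest_clients P M) then None else None)"
          by (subst run_parties_det[of _ _ _ _ l' "\<lambda>_. None"])
            (auto simp: simps Delta distinct_map inj_on_def)
        ultimately show ?thesis by simp
      qed
      moreover have "([Server \<mapsto> Angle d] |` ?H) Server = Some (Angle d :: 'a msg)"
        using False by (simp add: srv del: restrict_fun_upd)
      ultimately show ?thesis using False
        by (subst honest_eq)
          (simp add: run_parties_append simps Delta ibind_assoc angle_of_def del: restrict_fun_upd)
    qed
    have o: "override_on [Server \<mapsto> x] Map.empty ?H = (if Server \<in> M then [Server \<mapsto> x] else Map.empty)"
      for x :: "'a msg"
      by (auto simp: override_on_def fun_eq_iff srv)
    have d: "smpc_delta P s r v = (pattern_angle P True (flatten P M (l, s)) v +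
        hy_theta (flatten P M (l, s)) v + of_bool r * 4) mod 8" for r
    proof -
      have 1: "description P (smpc_input s) = description P (hy_input (flatten P M (l, s)))"
        by (rule description_cong) (simp add: flatten_def)
      have 2: "input_bit P (smpc_input s) v = input_bit P (hy_input (flatten P M (l, s))) v"
        by (rule input_bit_cong) (simp add: flatten_def)
      show ?thesis
        unfolding smpc_delta_def pattern_angle_def 1 2
        by (auto simp: flatten_def algebra_simps split: prod.splits)
    qed
    show ?thesis
      unfolding real_step pre
      by (auto simp: smpc_step_def hybrid_step_def Delta post ibind_assoc imap_ibind ibind_imap o d const_upd
          flatten_def[of P M] fun_eq_iff simp del: restrict_fun_upd
          intro!: ibind_cong arg_cong[where f = ireturn])
  next
    case (Outcome v)
    have pre: "run_parties (honest P M) ?pre l (m |` ?H) = ireturn (l, \<lambda>p. if p = Server \<and> Server \<notin> M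
        then Some (Bit (outcome (l Server) v)) else None)"
      by (subst run_parties_det[of _ _ l "m |` ?H" l
            "\<lambda>p. if p = Server then Some (Bit (outcome (l Server) v)) else None"])
        (auto simp: simps Outcome fun_eq_iff srv restrict_map_def split: party.splits
          intro!: arg_cong[where f = ireturn])
    have post: "run_parties (honest P M) ?post l Map.empty = ireturn (l, Map.empty)"
      by (rule run_idle) (auto simp: simps Outcome split: party.splits)
    show ?thesis
      unfolding real_step pre
      by (auto simp: smpc_step_def hybrid_step_def Outcome post flatten_def override_on_def srv bit_of_def
          fun_eq_iff intro!: arg_cong[where f = ireturn])
  next
    case Outputs
    have pre: "run_parties (honest P M) ?pre l (m |` ?H) = ireturn (l, Map.empty)"
      by (rule run_idle) (auto simp: simps Outputs split: party.splits)
    let ?f = "flatten P M (l, s)"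
    let ?m = "\<lambda>p. case p of Client j \<Rightarrow> if j < clients P
             then Some (Result (classical_output P j (smpc_m s))
               (\<lambda>v. if v \<in> outs P j then smpc_key P s v else (0, False)))
             else None
         | Server \<Rightarrow> None"
    have key: "smpc_key P s = hybrid_key P ?f"
    proof
      fix v
      have 1: "description P (smpc_input s) = description P (hy_input ?f)"
        by (rule description_cong) (simp add: flatten_def)
      have 2: "input_bit P (smpc_input s) v = input_bit P (hy_input ?f) v"
        by (rule input_bit_cong) (simp add: flatten_def)
      show "smpc_key P s v = hybrid_key P ?f v"
        unfolding smpc_key_def hybrid_key_def 1 2 by (auto simp: flatten_def split: prod.splits)
    qed
    let ?I = "\<lambda>p. case p of Server \<Rightarrow> ireturn () | Client j \<Rightarrow> decrypt P (hybrid_key P ?f) j"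
    let ?X = "\<lambda>p. case p of Server \<Rightarrow> None | Client j \<Rightarrow> Some (Output (classical_output P j (smpc_m s)))"
    have "run_parties (honest P M) ?post l (?m |` ?H) = ibind (for_each (honest P M) ?I)
      (\<lambda>_. ireturn (\<lambda>p. if p \<in> ?H then l p else l p, \<lambda>p. if p \<in> ?H then ?X p else (?m |` ?H) p))"
    proof (rule run_parties_seq)
      fix p assume p: "p \<in> ?H"
      show "?post p (l p) ((?m |` ?H) p) = ibind (?I p) (\<lambda>_. ireturn (l p, ?X p))"
      proof (cases p)
        case Server
        then show ?thesis by (simp add: simps Outputs)
      next
        case (Client j)
        have "for_each (filter (\<lambda>v. v \<in> outs P j) (prep_order P)) (\<lambda>v. gate
          ((if snd (if v \<in> outs P j then smpc_key P s v else (0, False)) then X_gate (vq v) else id) \<circ>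
            Rz (- fst (if v \<in> outs P j then smpc_key P s v else (0, False))) (vq v))) =
          decrypt P (hybrid_key P ?f) j"
          unfolding decrypt_def key by (intro for_each_cong) auto
        then show ?thesis using p Client by (simp add: simps Outputs cli)
      qed
    qed simp
    moreover have "for_each (honest P M) ?I =
        for_each (honest_clients P M) (decrypt P (hybrid_key P ?f))"
      by (subst honest_eq) (simp add: for_each_append for_each_map)
    ultimately have post: "run_parties (honest P M) ?post l (?m |` ?H) =
      ibind (for_each (honest_clients P M) (decrypt P (hybrid_key P ?f)))
        (\<lambda>_. ireturn (l, \<lambda>p. if p \<in> ?H then ?X p else None))"
      by (auto intro!: ibind_cong arg_cong[where f = ireturn] simp: fun_eq_iff)
    have out: "override_on ?m (\<lambda>p. if p \<in> ?H then ?X p else None) ?H = hybrid_output P M ?f"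
      by (auto simp: fun_eq_iff override_on_def hybrid_output_def set_honest key split: party.splits)
        (simp_all add: flatten_def)
    show ?thesis
      unfolding real_step pre
      using out by (simp add: smpc_step_def hybrid_step_def Outputs post ibind_assoc imap_ibind)
  qed
qed

subsection \<open>From the protocol to the first hybrid\<close>

definition yields :: "('r, 'o) instrument \<Rightarrow> ('o \<Rightarrow> bool) \<Rightarrow> bool" where
  "yields I Q \<longleftrightarrow> (\<forall>x\<in>fst ` set I. Q x)"

lemma yieldsD: "yields I Q \<Longrightarrow> x \<in> fst ` set I \<Longrightarrow> Q x"
  unfolding yields_def by blast

lemma yieldsI: "(\<And>x. Q x) \<Longrightarrow> yields I Q"
  by (simp add: yields_def)

lemma yields_mono: "yields I Q \<Longrightarrow> (\<And>x. Q x \<Longrightarrow> Q' x) \<Longrightarrow> yields I Q'"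
  unfolding yields_def by blast

lemma yields_ireturn [simp]: "yields (ireturn x) Q \<longleftrightarrow> Q x"
  by (simp add: yields_def ireturn_def)

lemma yields_ibind [simp]: "yields (ibind I J) Q \<longleftrightarrow> yields I (\<lambda>x. yields (J x) Q)"
  by (simp add: yields_def fst_set_ibind)

lemma yields_imap [simp]: "yields (imap g I) Q \<longleftrightarrow> yields I (\<lambda>x. Q (g x))"
  by (simp add: yields_def imap_def split_beta)

lemma hybrid_step_keeps_m:
  "(\<And>v. k \<noteq> Outcome v) \<Longrightarrow> k \<noteq> Outputs \<Longrightarrow>
    yields (hybrid_step P M h W ex k s m) (\<lambda>(s', m'). hy_m s' = hy_m s)"
  by (cases k) (auto simp: hybrid_step_def Let_def case_prod_beta' intro!: yieldsI)

section \<open>Uniformly random angles\<close>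

lemma expect_angles:
  "expect (sample angles) f \<psi> = (\<Sum>a\<in>{0..<8}. f a (\<lambda>b. \<psi> b / complex_of_real (sqrt 8)))"
proof -
  have 1: "set angles = {0..<8}" "distinct angles" "length angles = 8"
    by (auto simp: angles_def)
  show ?thesis
    by (simp add: expect_sample sum_list_distinct_conv_sum_set 1)
qed

lemma sum_shift_mod_8:
  fixes S :: int
  shows "(\<Sum>a\<in>{0..<8}. f ((a + S) mod 8)) = (\<Sum>a\<in>{0..<8}. f a)"
proof (rule sum.reindex_bij_betw)
  show "bij_betw (\<lambda>a. (a + S) mod 8) {0..<8} {0..<8}"
    by (rule bij_betw_byWitness[where f' = "\<lambda>a. (a - S) mod 8"]) (auto simp: mod_simps)
qed

lemma expect_angles_shift:
  "expect (sample angles) (\<lambda>c. f ((c + S) mod 8)) \<psi> = expect (sample angles) f \<psi>"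
  unfolding expect_angles by (rule sum_shift_mod_8)

lemma stage_vert: "well_formed P \<Longrightarrow> t < length (schedule P) \<Longrightarrow> stage P t v \<noteq> 0 \<Longrightarrow> v \<in> verts P"
  unfolding stage_def using accepts_nth(2)[OF accepts_schedule] .

text \<open>The locality part of \<open>is_distinguisher\<close>, with the open wires as a
  parameter. The hybrid games declare empty ports, so their distinguishers are restricted through
  \<open>ow\<close>, the open wires of the real game.\<close>

definition fair :: "'v public_info \<Rightarrow> (nat \<Rightarrow> 'v wire set) \<Rightarrow> (party, 'v wire, 'v msg) distinguisher \<Rightarrow> bool" where
  "fair P ow D \<longleftrightarrow> (\<forall>h. length h \<le> length (schedule P) \<longrightarrow> local_instr (observable ow (length h)) (D h))"

lemma prob_real_hybrid:
  assumes wf: "well_formed P" and D: "fair P ow D"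
  shows "prob_one D (real_game P M) = prob_one D (hybrid P M h [] True)"
proof -
  let ?T = "length (schedule P)"
  let ?A = "hybrid P M h [] True"
  have st: "imap (\<lambda>(s', m'). (flatten P M s', m')) (res_step (real_game P M) t s m) =
      res_step ?A t (flatten P M s) m" if "t < ?T" for t s m
    using flatten_step[OF wf that, of M "fst s" "snd s" m h] by (simp add: hybrid_def)
  interpret simulation ?T ow "real_game P M" ?A "\<lambda>t s. ireturn (flatten P M s)" "\<lambda>_ _. True"
  proof (standard, goal_cases)
    case (3 t u m)
    then show ?case using wf by (intro local_hybrid) auto
  next
    case (4 t s m)
    then show ?case using st[OF 4, of s m] local_hybrid[OF wf, of "[]" t M h True "flatten P M s" m]
      by (simp flip: st)
  next
    case (6 t s f m \<psi>)
    have "expect (res_step ?A t (flatten P M s) m) f \<psi> =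
        expect (res_step (real_game P M) t s m) (\<lambda>(s', m'). f (flatten P M s', m')) \<psi>"
      unfolding st[OF 6(1), symmetric] by (simp add: case_prod_beta')
    then show ?case by simp
  qed (auto simp: complete_def)
  show ?thesis
  proof (rule prob_eq)
    have "flatten P M (res_init (real_game P M)) = res_init ?A"
      by (auto simp: run_by_def attach_def parallel_def smpc_resource_def hybrid_def hybrid_init_def
          flatten_def mcbqc_protocol_def smpc_init_def no_input_def fun_eq_iff)
    then show "expect (ireturn (flatten P M (res_init (real_game P M))))
        (\<lambda>u. if u = res_init ?A then f else (\<lambda>_. 0)) (basis_ket {}) = f (basis_ket {})"
      and "u \<in> fst ` set (ireturn (flatten P M (res_init (real_game P M)))
        :: ('a wire reg, 'a hybrid_state) instrument) \<Longrightarrow> u = res_init ?A" for f u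
      by simp_all
  qed (use D in \<open>auto simp: fair_def hybrid_def run_by_def attach_def smpc_resource_def\<close>)
qed

text \<open>Two changes at once. Drawing the correction angle and adding the sum of the shares is a
  shift of a uniform angle modulo 8. Reading only earlier outcomes makes no difference on time: by
  the invariant every outcome that is set belongs to a finished vertex, and when \<delta>(v) is
  computed these are the earlier ones.\<close>

lemma prob_hybrid_relaxed:
  assumes wf: "well_formed P" and D: "fair P ow D"
  shows "prob_one D (hybrid P M h [] True) = prob_one D (hybrid P M h [] False)"
proof -
  let ?T = "length (schedule P)"
  let ?B = "hybrid P M h [] True" and ?A = "hybrid P M h [] False"
  let ?inv = "\<lambda>t s. \<forall>w. hy_m s w \<longrightarrow> stage P t w = clients P + 5"
  interpret simulation ?T ow ?B ?A "\<lambda>t s. ireturn s" ?inv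
  proof (standard, goal_cases)
    case (3 t u m)
    then show ?case using wf by (intro local_hybrid) auto
  next
    case (4 t s m)
    then show ?case using wf by (intro local_hybrid) auto
  next
    case (5 t s s' m' m)
    note exp = expected_schedule[OF wf 5(1)]
    have wv: "v \<in> set (meas_order P) \<Longrightarrow> v \<in> verts P" "v \<notin> earlier P v" for v
      using wf by (auto simp: well_formed_def earlier_def dest: set_takeWhileD)
    have keep: "hy_m s' = hy_m s" if "\<And>v. schedule P ! t \<noteq> Outcome v" "schedule P ! t \<noteq> Outputs"
      using yieldsD[OF hybrid_step_keeps_m[OF that, of P M h "[]" True s m]] 5(3)
      by (auto simp: hybrid_def)
    show ?case
    proof (cases "schedule P ! t")
      case (Outcome v)
      then show ?thesis using 5 by (auto simp: hybrid_def hybrid_step_def stage_Suc ireturn_def)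
    next
      case (Delta v)
      have "stage P t v = clients P + 3" using exp wv by (simp add: Delta)
      then show ?thesis using 5 keep by (auto simp: Delta stage_Suc)
    next
      case Outputs
      then have "yields (res_step ?B t s m) (\<lambda>(s', m'). s' = s)"
        by (auto simp: hybrid_def hybrid_step_def intro!: yieldsI)
      then show ?thesis using 5 Outputs by (auto dest!: yieldsD simp: stage_Suc)
    qed (use 5 keep exp in \<open>auto simp: stage_Suc\<close>)
  next
    case (6 t s f m \<psi>)
    note exp = expected_schedule[OF wf 6(1)]
    have "expect (res_step ?B t s m) f \<psi> = expect (res_step ?A t s m) f \<psi>"
    proof (cases "schedule P ! t")
      case (Shares v)
      then show ?thesis
        by (simp add: hybrid_def hybrid_step_def Let_def, intro expect_cong[of "draw _ _"])
          (rule expect_angles_shift[symmetric])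
    next
      case (Delta v)
      have "w \<in> earlier P v" if "hy_m s w" for w
      proof -
        have "stage P t w = clients P + 5" using 6(2) that by auto
        moreover from this have "w \<in> verts P" using stage_vert[OF wf 6(1)] by simp
        ultimately show ?thesis using exp by (simp add: Delta split: if_splits)
      qed
      then have "(\<lambda>w. (True \<or> w \<in> earlier P v) \<and> hy_m s w) =
          (\<lambda>w. (False \<or> w \<in> earlier P v) \<and> hy_m s w)" by auto
      then have "pattern_angle P True s v = pattern_angle P False s v"
        unfolding pattern_angle_def by (rule arg_cong)
      then show ?thesis by (simp add: hybrid_def hybrid_step_def Delta)
    qed (simp_all add: hybrid_def hybrid_step_def)
    then show ?case by (simp add: case_prod_beta')
  qed (auto simp: complete_def)
  show ?thesis
    by (rule prob_eq) (use D in \<open>auto simp: fair_def hybrid_def hybrid_init_def\<close>)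
qed

subsection \<open>Postponing the secrets of one vertex\<close>

text \<open>The eight outcomes of \<open>probe\<close> play the role of the uniformly random rotation angle of client \<open>h\<close>.\<close>

definition probe :: "'r \<Rightarrow> ('r, int) instrument" where
  "probe q = map (\<lambda>a. (a, \<lambda>\<psi> b. bra a q \<psi> b / 2)) angles"

lemma local_instr_probe: "q \<in> R \<Longrightarrow> local_instr R (probe q)"
proof (rule local_instrI)
  fix x K assume q: "q \<in> R" and "(x, K) \<in> set (probe q)"
  then have "K = (\<lambda>\<psi> b. (1 / 2) * \<psi> b) \<circ> bra x q" by (auto simp: probe_def comp_def)
  then show "local_op R K" using q by (simp only: local_op_compose local_op_const local_op_bra)
qed

text \<open>The factor 1/2 arises because the eight projections form four orthonormal bases, each
  taken with probability 1/4.\<close>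

lemma expect_probe:
  "expect (probe q) f \<psi> = (\<Sum>a\<in>{0..<8}. f a (\<lambda>b. bra a q \<psi> b / 2))"
proof -
  have "set angles = {0..<8}" "distinct angles" by (auto simp: angles_def)
  then show ?thesis
    by (simp add: probe_def expect_def comp_def sum_list_distinct_conv_sum_set)
qed

lemma expect_bool:
  "expect (sample [False, True]) f \<psi> = (\<Sum>r\<in>{False, True}. f r (\<lambda>b. \<psi> b / complex_of_real (sqrt 2)))"
  by (simp add: expect_sample)

lemma bra_cong: "a mod 8 = b mod 8 \<Longrightarrow> bra a q = bra b q"
proof -
  assume "a mod 8 = b mod 8"
  then have "phase a = phase b" by (rule phase_cong)
  then show ?thesis unfolding bra_def by (rule arg_cong)
qed

lemma bra_scale: "bra a q (\<lambda>b. \<psi> b / c) = (\<lambda>b. bra a q \<psi> b / c)"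
  by (intro ext) (simp add: bra_def add_divide_distrib mult.commute)

lemma mod_8_cancel: "((x + (k + c)) mod 8 - k - c) mod 8 = (x :: int) mod 8"
proof -
  have "((x + (k + c)) mod 8 - k - c) mod 8 = ((x + (k + c)) mod 8 - (k + c)) mod 8"
    by (simp only: diff_diff_add)
  also have "\<dots> = (x + (k + c) - (k + c)) mod 8" by (rule mod_diff_left_eq)
  finally show ?thesis by simp
qed

lemma mod_8_assoc: "(p + (t + x) mod 8 + c) mod 8 = (x + (p + t + c)) mod (8 :: int)"
proof -
  have "(p + (t + x) mod 8 + c) mod 8 = ((p + c) + (t + x) mod 8) mod 8" by (simp only: ac_simps)
  also have "\<dots> = ((p + c) + (t + x)) mod 8" by (rule mod_add_right_eq)
  finally show ?thesis by (simp only: ac_simps)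
qed

lemma sqrt_8: "complex_of_real (sqrt 8) = 2 * complex_of_real (sqrt 2)"
proof -
  have "sqrt 8 = sqrt (2 * 2 * 2)" by simp
  also have "\<dots> = 2 * sqrt 2" by (simp only: real_sqrt_mult) simp
  finally show ?thesis by simp
qed

text \<open>The ancilla copies the bit of \<open>q\<close>, so weighting its value 1 with
  \<open>phase a\<close> rotates \<open>q\<close> itself. The 1/2 of the probe times the 1/sqrt 2 of
  the projection is 1/sqrt 8, the amplitude of a uniformly drawn angle.\<close>

lemma bra_cnot:
  assumes "p \<noteq> q"
  shows "(\<lambda>b. bra a p (cnot q p (clear_qubit p s \<psi>)) b / 2) =
    Rz a q (clear_qubit p s (\<lambda>b. \<psi> b / complex_of_real (sqrt 8)))"
  using assms by (intro ext) (auto simp: bra_def cnot_def clear_qubit_def Rz_def set_qubit_def sqrt_8)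

lemma draw_upd:
  "h \<notin> set js \<Longrightarrow> draw js (g(h := a)) = imap (\<lambda>g'. g'(h := a)) (draw js g)"
  by (induction js arbitrary: g) (auto simp: imap_ibind fun_upd_twist)

text \<open>Independent draws commute, so the share of \<open>h\<close> can be taken out of the
  table and drawn first.\<close>

lemma expect_draw_pull:
  assumes "distinct js" "h \<in> set js"
  shows "expect (draw js g) f \<psi> =
    expect (sample angles) (\<lambda>a. expect (draw (removeAll h js) g) (\<lambda>g'. f (g'(h := a)))) \<psi>"
  using assms
proof (induction js arbitrary: g \<psi>)
  case (Cons j js)
  show ?case
  proof (cases "j = h")
    case True
    then have "h \<notin> set js" using Cons.prems by auto
    then show ?thesis using True by (simp add: draw_upd[unfolded fun_upd_def] fun_upd_def)
  next
    case False
    have "expect (draw (j # js) g) f \<psi> = expect (sample angles) (\<lambda>b. expect (sample angles) (\<lambda>a.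
        expect (draw (removeAll h js) (g(j := b))) (\<lambda>g'. f (g'(h := a))))) \<psi>"
      using Cons.prems False by (simp, intro expect_cong Cons.IH) auto
    also have "\<dots> = expect (sample angles) (\<lambda>a. expect (sample angles) (\<lambda>b.
        expect (draw (removeAll h js) (g(j := b))) (\<lambda>g'. f (g'(h := a))))) \<psi>"
      by (rule expect_commute[where R = "{}" and S = "{}"]) auto
    finally show ?thesis using False by (simp add: fun_upd_def)
  qed
qed simp

lemma local_instr_draw [simp]: "local_instr R (draw js g)"
  using instrument_on_draw[of R js g] by (simp only: instrument_on_iff)

lemma local_instr_reset: "q \<in> R \<Longrightarrow> local_instr R (reset q)"
  using instrument_on_reset[of q R] by (simp add: instrument_on_iff)

lemma local_instr_measure_out: "q \<in> R \<Longrightarrow> local_instr R (measure_out a q)"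
  using instrument_on_measure_out[of q R a] by (simp add: instrument_on_iff)

text \<open>Puts the missing share of client \<open>h\<close> back. It enters the sum and \<theta>
  alike, so their difference, the correction angle sent to the server, stays the same.\<close>

definition reveal :: "nat \<Rightarrow> 'v \<Rightarrow> int \<Rightarrow> 'v hybrid_state \<Rightarrow> 'v hybrid_state" where
  "reveal h v a s = s\<lparr>hy_share := (hy_share s)(h := (hy_share s h)(v := a)),
     hy_sum := (hy_sum s)(v := hy_sum s v + a), hy_theta := (hy_theta s)(v := (hy_theta s v + a) mod 8)\<rparr>"

definition out_angle :: "'v public_info \<Rightarrow> 'v \<Rightarrow> 'v hybrid_state \<Rightarrow> int" where
  "out_angle P v s = hy_delta s v - pattern_angle P False s v - hy_theta s v"

text \<open>The same once \<delta>(v) is announced, when \<open>r\<close> determines the share. The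
  fields get the values that the game without postponement stores: 0 in \<open>hy_delta\<close>, and
  an outcome flipped by \<open>r\<close> as soon as it has been reported
  (\<open>fin\<close>).\<close>

definition reveal_out :: "'v public_info \<Rightarrow> nat \<Rightarrow> 'v \<Rightarrow> bool \<Rightarrow> bool \<Rightarrow> 'v hybrid_state \<Rightarrow> 'v hybrid_state" where
  "reveal_out P h v fin r s = (reveal h v ((out_angle P v s - (if r then 4 else 0)) mod 8) s)
     \<lparr>hy_delta := (hy_delta s)(v := 0), hy_r := (hy_r s)(v := (hy_r s v \<noteq> r)),
      hy_m := if fin then (hy_m s)(v := (hy_m s v \<noteq> r)) else hy_m s\<rparr>"

lemma pattern_angle_cong:
  assumes "hy_input s = hy_input s'" "\<And>w. w \<in> earlier P v \<Longrightarrow> hy_m s w = hy_m s' w"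
  shows "pattern_angle P False s v = pattern_angle P False s' v"
proof -
  have "(\<lambda>w. w \<in> earlier P v \<and> hy_m s w) = (\<lambda>w. w \<in> earlier P v \<and> hy_m s' w)"
    using assms(2) by auto
  then show ?thesis by (simp add: pattern_angle_def assms(1))
qed

lemma not_earlier_self [simp]: "v \<notin> earlier P v"
  by (auto simp: earlier_def dest: set_takeWhileD)

lemma earlier_asym:
  assumes "u \<in> earlier P v"
  shows "v \<notin> earlier P u"
proof
  assume "v \<in> earlier P u"
  obtain xs ys where x: "meas_order P = takeWhile (\<lambda>w. w \<noteq> v) (meas_order P) @ ys"
    using takeWhile_dropWhile_id[symmetric] by metis
  have u: "u \<in> set (takeWhile (\<lambda>w. w \<noteq> v) (meas_order P))" using assms by (simp add: earlier_def)
  have "takeWhile (\<lambda>w. w \<noteq> u) (meas_order P) = takeWhile (\<lambda>w. w \<noteq> u) (takeWhile (\<lambda>w. w \<noteq> v) (meas_order P))"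
    by (subst x) (rule takeWhile_append1[OF u], simp)
  then have "v \<in> set (takeWhile (\<lambda>w. w \<noteq> v) (meas_order P))"
    using \<open>v \<in> earlier P u\<close> by (auto simp: earlier_def dest: set_takeWhileD)
  then show False by (auto dest: set_takeWhileD)
qed

definition hybrid_tail :: "'v public_info \<Rightarrow> party set \<Rightarrow> 'v list \<Rightarrow> 'v hybrid_state \<Rightarrow>
    ('v wire reg, 'v hybrid_state \<times> (party \<rightharpoonup> 'v msg)) instrument" where
  "hybrid_tail P M W s = ibind (resolve P W s) (\<lambda>s'.
       ibind (for_each (honest_clients P M) (decrypt P (hybrid_key P s'))) (\<lambda>_.
       ireturn (s', hybrid_output P M s')))"

text \<open>The last round reads keys of output vertices, ancilla angles of postponed vertices, and
  outcomes. The secrets of a measured vertex that is not postponed occur in none of them, so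
  changing them commutes with the round.\<close>

lemma hybrid_tail_irrelevant:
  fixes P :: "'v public_info" and A :: "'v hybrid_state \<Rightarrow> nat \<Rightarrow> 'v \<Rightarrow> int" and C d :: int
    and B :: "'v hybrid_state \<Rightarrow> 'v \<Rightarrow> int" and F :: "'v hybrid_state \<Rightarrow> 'v \<Rightarrow> bool"
  assumes "v \<notin> set W" "v \<notin> out_verts P"
  defines "E \<equiv> \<lambda>s. s\<lparr>hy_share := A s, hy_sum := B s, hy_theta := (hy_theta s)(v := C),
     hy_delta := (hy_delta s)(v := d), hy_r := F s\<rparr>"
  assumes "\<And>s x. A (hy_m_update x s) = A s" "\<And>s x. B (hy_m_update x s) = B s"
    "\<And>s x. F (hy_m_update x s) = F s"
  shows "hybrid_tail P M W (E s) = imap (\<lambda>(s', m'). (E s', m')) (hybrid_tail P M W s)"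
proof -
  have r: "resolve P W (E s) = imap E (resolve P W s)"
    using assms(1)
  proof (induction W arbitrary: s)
    case (Cons w W)
    have p: "pattern_angle P False (E s) w = pattern_angle P False s w"
      by (rule pattern_angle_cong) (simp_all add: E_def)
    have "(E s)\<lparr>hy_m := (hy_m (E s))(w := (hy_m (E s) w \<noteq> r))\<rparr> = E (s\<lparr>hy_m := (hy_m s)(w := (hy_m s w \<noteq> r))\<rparr>)" for r
      by (simp add: E_def assms(4-6))
    moreover have "hy_delta (E s) w = hy_delta s w" "hy_theta (E s) w = hy_theta s w"
      using Cons.prems by (auto simp: E_def)
    moreover have "resolve P W (E s') = imap E (resolve P W s')" for s'
      using Cons.prems by (intro Cons.IH) simp
    ultimately show ?case by (simp only: resolve.simps p imap_ibind)
  qed simp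
  have key: "hybrid_key P (E s') u = hybrid_key P s' u" if "u \<in> outs P j" "j < clients P" for s' u j
    using assms(2) that by (auto simp: E_def hybrid_key_def out_verts_def)
  have m: "hy_m (E s') = hy_m s'" for s' by (simp add: E_def)
  have o: "hybrid_output P M (E s') = hybrid_output P M s'" for s'
    unfolding hybrid_output_def m by (auto simp: fun_eq_iff key split: party.splits)
  have d: "for_each (honest_clients P M) (decrypt P (hybrid_key P (E s'))) =
      for_each (honest_clients P M) (decrypt P (hybrid_key P s'))" for s'
    unfolding decrypt_def
    by (intro for_each_cong refl) (auto simp: key set_honest_clients)
  show ?thesis
    by (simp add: hybrid_tail_def r ibind_imap imap_ibind o d)
qed

lemma expect_swap:
  assumes "local_instr {} I" "local_instr UNIV J"
  shows "expect I (\<lambda>x. expect J (g x)) = expect J (\<lambda>y. expect I (\<lambda>x. g x y))"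
  using expect_commute[OF assms] by auto

text \<open>The shape of a round that leaves the ancilla alone: the owed measurement is exchanged
  with the round, provided that the round takes adjusted states to adjusted states.\<close>

lemma expect_transfer:
  assumes Kf: "yields B (\<lambda>(s', m'). Kf s' = imap (\<lambda>x. R' x s') J)"
    and loc: "local_instr X B" "local_instr Y J" "X \<inter> Y = {}"
    and A: "\<And>x. A (R x) = imap (\<lambda>(s', m'). (R' x s', m')) B"
  shows "expect B (\<lambda>(s', m'). expect (Kf s') (\<lambda>u. f (u, m'))) \<psi> =
    expect (imap R J) (\<lambda>u. expect (A u) f) \<psi>"
proof -
  have "expect B (\<lambda>(s', m'). expect (Kf s') (\<lambda>u. f (u, m'))) \<psi> =
      expect B (\<lambda>o'. expect J (\<lambda>x. f (R' x (fst o'), snd o'))) \<psi>"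
  proof (rule expect_cong)
    fix o' K assume "(o', K) \<in> set B"
    then have "Kf (fst o') = imap (\<lambda>x. R' x (fst o')) J"
      using yieldsD[OF Kf, of o'] by force
    then show "(case o' of (s', m') \<Rightarrow> expect (Kf s') (\<lambda>u. f (u, m'))) (K \<psi>) =
        expect J (\<lambda>x. f (R' x (fst o'), snd o')) (K \<psi>)"
      by (simp add: case_prod_beta')
  qed
  also have "\<dots> = expect J (\<lambda>x. expect B (\<lambda>o'. f (R' x (fst o'), snd o'))) \<psi>"
    by (rule expect_commute[OF loc])
  also have "\<dots> = expect (imap R J) (\<lambda>u. expect (A u) f) \<psi>"
    by (simp add: A case_prod_beta')
  finally show ?thesis .
qed

text \<open>One hop of the hybrid argument, which postpones \<open>v\<close> when exactly the
  vertices after it, those in \<open>W\<close>, have been postponed.\<close>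

locale vertex_hop =
  fixes P :: "'v public_info" and M :: "party set" and h :: nat and us :: "'v list" and v :: 'v
    and W :: "'v list"
  assumes wf: "well_formed P" and meas: "meas_order P = us @ v # W"
    and h: "h < clients P" and honest_h: "Client h \<notin> M"
begin

lemma v_facts: "v \<in> verts P" "v \<notin> set W" "v \<notin> out_verts P" "set (v # W) \<subseteq> verts P" "set W \<subseteq> verts P"
  and earlier_v: "earlier P v = set us"
proof -
  have d: "distinct (us @ v # W)" and s: "set (us @ v # W) = verts P - out_verts P"
    using wf unfolding well_formed_def meas by blast+
  show "v \<in> verts P" "v \<notin> set W" "v \<notin> out_verts P" "set (v # W) \<subseteq> verts P" "set W \<subseteq> verts P"
    using d s by auto
  show "earlier P v = set us" by (rule earlier_append[OF d meas])
qed

definition step_new :: "'v round_kind \<Rightarrow> 'v hybrid_state \<Rightarrow> (party \<rightharpoonup> 'v msg) \<Rightarrow>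
    ('v wire reg, 'v hybrid_state \<times> (party \<rightharpoonup> 'v msg)) instrument" where
  "step_new = hybrid_step P M h (v # W) False"

definition step_old :: "'v round_kind \<Rightarrow> 'v hybrid_state \<Rightarrow> (party \<rightharpoonup> 'v msg) \<Rightarrow>
    ('v wire reg, 'v hybrid_state \<times> (party \<rightharpoonup> 'v msg)) instrument" where
  "step_old = hybrid_step P M h W False"

text \<open>The owed work between the drawing of the share and the hop of client \<open>h\<close>:
  the share is still a plain random number, and the ancilla is yet to be reset.\<close>

definition drawn :: "('v wire reg, int) instrument" where
  "drawn = ibind (sample angles) (\<lambda>x. imap (\<lambda>_. x) (reset (anc P v)))"

lemma shares_step:
  "expect (step_new (Shares v) s m) (\<lambda>(s', m'). expect (imap (\<lambda>x. reveal h v x s') drawn) (\<lambda>u. f (u, m'))) \<psi> =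
   expect (imap (\<lambda>_. s) (reset (anc P v))) (\<lambda>u. expect (step_old (Shares v) u m) f) \<psi>"
proof -
  let ?js = "removeAll h (honest_clients P M)" and ?r = "reset (anc P v)"
  let ?D = "draw ?js (\<lambda>_. 0) :: ('v wire reg, nat \<Rightarrow> int) instrument"
  let ?S = "sample angles :: ('v wire reg, int) instrument"
  let ?sum = "\<lambda>g. \<Sum>j<clients P. if Client j \<in> M then angle_of (m (Client j)) else g j"
  let ?upd = "\<lambda>g c. s\<lparr>hy_share := \<lambda>j. (hy_share s j)(v := g j), hy_sum := (hy_sum s)(v := ?sum g),
         hy_theta := (hy_theta s)(v := (c + ?sum g) mod 8)\<rparr>"
  let ?F = "\<lambda>g c x. f (reveal h v x (?upd g c), Map.empty)"
  have lr: "local_instr UNIV ?r" by (simp add: local_instr_reset)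
  \<comment> \<open>The undrawn entry is 0, so adding the share to the sum is the same as inserting
    it into the table.\<close>
  have upd: "?upd (g(h := x)) c = reveal h v x (?upd g c)" if "g h = 0" for g x c
  proof -
    have "?sum (g(h := x)) = x + (\<Sum>j\<in>{..<clients P} - {h}. if Client j \<in> M then angle_of (m (Client j)) else g j)"
    proof (subst sum.remove[of _ h])
      have "(\<Sum>j\<in>{..<clients P} - {h}. if Client j \<in> M then angle_of (m (Client j)) else (g(h := x)) j) =
          (\<Sum>j\<in>{..<clients P} - {h}. if Client j \<in> M then angle_of (m (Client j)) else g j)"
        by (rule sum.cong) auto
      then show "(if Client h \<in> M then angle_of (m (Client h)) else (g(h := x)) h) +
          (\<Sum>j\<in>{..<clients P} - {h}. if Client j \<in> M then angle_of (m (Client j)) else (g(h := x)) j) =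
          x + (\<Sum>j\<in>{..<clients P} - {h}. if Client j \<in> M then angle_of (m (Client j)) else g j)"
        using honest_h by simp
    qed (use h in auto)
    moreover have "?sum g = (\<Sum>j\<in>{..<clients P} - {h}. if Client j \<in> M then angle_of (m (Client j)) else g j)"
      using h honest_h that by (subst sum.remove[of _ h]) auto
    ultimately have "?sum (g(h := x)) = ?sum g + x" by simp
    then show ?thesis
      by (simp add: reveal_def fun_eq_iff mod_simps add.assoc)
  qed
  have "expect (imap (\<lambda>_. s) ?r) (\<lambda>u. expect (step_old (Shares v) u m) f) \<psi> =
      expect ?r (\<lambda>_. expect (draw (honest_clients P M) (\<lambda>_. 0)) (\<lambda>g. expect ?S (\<lambda>c. f (?upd g c, Map.empty)))) \<psi>"
    using v_facts by (simp add: step_old_def hybrid_step_def Let_def)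
  also have "\<dots> = expect ?r (\<lambda>_. expect ?S (\<lambda>x. expect ?D (\<lambda>g. expect ?S (\<lambda>c. f (?upd (g(h := x)) c, Map.empty))))) \<psi>"
    by (rule expect_cong, rule expect_draw_pull) (use h honest_h in \<open>auto simp: set_honest_clients\<close>)
  also have "\<dots> = expect ?r (\<lambda>_. expect ?S (\<lambda>x. expect ?D (\<lambda>g. expect ?S (\<lambda>c. ?F g c x)))) \<psi>"
  proof (intro expect_cong)
    fix x xa xb K Ka Kb Kc c
    assume "(xb, Kb) \<in> set ?D"
    then have "xb h = 0" by (auto dest: draw_outcome')
    then show "f (?upd (xb(h := xa)) c, Map.empty) (Kc (Kb (Ka (K \<psi>)))) = ?F xb c xa (Kc (Kb (Ka (K \<psi>))))"
      by (simp only: upd)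
  qed
  also have "\<dots> = expect ?S (\<lambda>x. expect ?r (\<lambda>_. expect ?D (\<lambda>g. expect ?S (\<lambda>c. ?F g c x)))) \<psi>"
    by (subst expect_swap[of ?S ?r]) (auto simp: lr)
  also have "\<dots> = expect ?S (\<lambda>x. expect ?D (\<lambda>g. expect ?r (\<lambda>_. expect ?S (\<lambda>c. ?F g c x)))) \<psi>"
    by (subst expect_swap[of ?D ?r]) (auto simp: lr)
  also have "\<dots> = expect ?S (\<lambda>x. expect ?D (\<lambda>g. expect ?S (\<lambda>c. expect ?r (\<lambda>_. ?F g c x)))) \<psi>"
    by (subst expect_swap[of ?S ?r]) (auto simp: lr)
  also have "\<dots> = expect ?D (\<lambda>g. expect ?S (\<lambda>x. expect ?S (\<lambda>c. expect ?r (\<lambda>_. ?F g c x)))) \<psi>"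
    by (subst expect_swap[of ?D ?S]) auto
  also have "\<dots> = expect ?D (\<lambda>g. expect ?S (\<lambda>c. expect ?S (\<lambda>x. expect ?r (\<lambda>_. ?F g c x)))) \<psi>"
    by (subst expect_swap[of ?S ?S]) auto
  finally show ?thesis
    by (simp add: step_new_def hybrid_step_def Let_def drawn_def)
qed

text \<open>\<open>bra_cnot\<close>, applied to both branches of the reset, turns the probed
  controlled-X of one game into the random rotation of the other.\<close>

lemma hop_step:
  "expect (step_new (Hop v h) s m) (\<lambda>(s', m'). expect (imap (\<lambda>x. reveal h v x s') (probe (anc P v))) (\<lambda>u. f (u, m'))) \<psi> =
   expect (imap (\<lambda>x. reveal h v x s) drawn) (\<lambda>u. expect (step_old (Hop v h) u m) f) \<psi>"
proof -
  have "vq v \<noteq> anc P v" by (simp add: anc_def)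
  then show ?thesis using honest_h v_facts
    by (simp add: step_new_def step_old_def hybrid_step_def drawn_def reset_def expect_probe expect_angles
        bra_cnot[OF \<open>vq v \<noteq> anc P v\<close>[symmetric]] sum.distrib reveal_def)
qed

text \<open>The one-time pad. Through \<delta> = x + k + 4 r modulo 8, with \<open>k\<close> free of
  \<open>x\<close> and \<open>r\<close>, pairs of share and flip correspond bijectively to pairs of
  announced angle and flip. Probing \<open>x\<close> and then drawing \<open>r\<close> gives the
  same branches as drawing \<delta> and then measuring \<open>r\<close>.\<close>

lemma delta_step:
  "expect (step_new (Delta v) s m) (\<lambda>(s', m'). expect (imap (\<lambda>r. reveal_out P h v False r s')
     (measure_out (out_angle P v s') (anc P v))) (\<lambda>u. f (u, m'))) \<psi> =
   expect (imap (\<lambda>x. reveal h v x s) (probe (anc P v))) (\<lambda>u. expect (step_old (Delta v) u m) f) \<psi>"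
proof -
  let ?a = "anc P v"
  let ?meas = "\<lambda>d. if Server \<in> M then ireturn False else measure_pm d (vq v)"
  let ?msg = "\<lambda>d. if Server \<in> M then [Server \<mapsto> Angle d] else Map.empty"
  let ?s = "\<lambda>d b. s\<lparr>hy_r := (hy_r s)(v := False), hy_delta := (hy_delta s)(v := d),
         hy_b := (hy_b s)(v := b)\<rparr>"
  let ?k = "pattern_angle P False s v + hy_theta s v"
  let ?four = "\<lambda>r. if r then 4 else 0 :: int"
  let ?G = "\<lambda>d r. expect (?meas d) (\<lambda>b. f (reveal_out P h v False r (?s d b), ?msg d))"
  have pa: "pattern_angle P False (?s d b) v = pattern_angle P False s v" for d b
    by (rule pattern_angle_cong) auto
  have pa': "pattern_angle P False (reveal h v x s) v = pattern_angle P False s v" for x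
    by (rule pattern_angle_cong) (auto simp: reveal_def)
  have oa: "out_angle P v (?s d b) = d - ?k" for d b
    unfolding out_angle_def pa by simp
  have lm: "local_instr (- {?a}) (?meas d)" for d
    using local_instr_measure_pm[of "vq v" "- {?a}" d] by (auto simp: anc_def)
  have lo: "local_instr {?a} (measure_out x ?a)" for x
    by (rule local_instr_measure_out) simp
  have "expect (step_new (Delta v) s m) (\<lambda>(s', m'). expect (imap (\<lambda>r. reveal_out P h v False r s')
     (measure_out (out_angle P v s') ?a)) (\<lambda>u. f (u, m'))) \<psi> =
    expect (sample angles) (\<lambda>d. expect (?meas d) (\<lambda>b. expect (measure_out (d - ?k) ?a)
      (\<lambda>r. f (reveal_out P h v False r (?s d b), ?msg d)))) \<psi>"
    by (simp add: step_new_def hybrid_step_def oa del: fun_upd_apply)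
  also have "\<dots> = expect (sample angles) (\<lambda>d. expect (measure_out (d - ?k) ?a) (\<lambda>r. ?G d r)) \<psi>"
    by (intro expect_cong expect_commute[OF lm lo]) auto
  also have "\<dots> = (\<Sum>d\<in>{0..<8}. \<Sum>r\<in>{False, True}.
      ?G d r (\<lambda>b. bra (d - ?k - ?four r) ?a \<psi> b / complex_of_real (sqrt 8)))"
    by (simp add: expect_angles measure_out_def bra_scale)
  also have "\<dots> = (\<Sum>r\<in>{False, True}. \<Sum>d\<in>{0..<8}.
      ?G d r (\<lambda>b. bra (d - ?k - ?four r) ?a \<psi> b / complex_of_real (sqrt 8)))"
    by (rule sum.swap)
  \<comment> \<open>For fixed \<open>r\<close>, the substitution \<open>d = x + k + 4 r\<close>
    permutes the residues modulo 8.\<close>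
  also have "\<dots> = (\<Sum>r\<in>{False, True}. \<Sum>x\<in>{0..<8}. ?G ((x + (?k + ?four r)) mod 8) r
      (\<lambda>b. bra ((x + (?k + ?four r)) mod 8 - ?k - ?four r) ?a \<psi> b / complex_of_real (sqrt 8)))"
    by (intro sum.cong refl sum_shift_mod_8[symmetric])
  also have "\<dots> = (\<Sum>r\<in>{False, True}. \<Sum>x\<in>{0..<8}. ?G ((x + (?k + ?four r)) mod 8) r
      (\<lambda>b. bra x ?a \<psi> b / 2 / complex_of_real (sqrt 2)))"
  proof (intro sum.cong refl)
    fix r and x :: int
    have "((x + (?k + ?four r)) mod 8 - ?k - ?four r) mod 8 = x mod 8"
      by (rule mod_8_cancel)
    then have "bra ((x + (?k + ?four r)) mod 8 - ?k - ?four r) ?a = bra x ?a" by (rule bra_cong)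
    then show "?G ((x + (?k + ?four r)) mod 8) r
      (\<lambda>b. bra ((x + (?k + ?four r)) mod 8 - ?k - ?four r) ?a \<psi> b / complex_of_real (sqrt 8)) =
      ?G ((x + (?k + ?four r)) mod 8) r (\<lambda>b. bra x ?a \<psi> b / 2 / complex_of_real (sqrt 2))"
      by (simp only: sqrt_8 divide_divide_eq_left)
  qed
  also have "\<dots> = (\<Sum>r\<in>{False, True}. \<Sum>x\<in>{0..<8}.
      expect (?meas ((x + (?k + ?four r)) mod 8)) (\<lambda>b. f ((reveal h v x s)\<lparr>hy_r := (hy_r s)(v := r),
        hy_delta := (hy_delta s)(v := 0), hy_b := (hy_b s)(v := b)\<rparr>, ?msg ((x + (?k + ?four r)) mod 8)))
      (\<lambda>b. bra x ?a \<psi> b / 2 / complex_of_real (sqrt 2)))"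
  proof (intro sum.cong refl)
    fix r and x :: int assume x: "x \<in> {0..<8}"
    let ?d = "(x + (?k + ?four r)) mod 8"
    have "(?d - ?k - ?four r) mod 8 = x mod 8" by (rule mod_8_cancel)
    then have "(?d - ?k - ?four r) mod 8 = x" using x by simp
    then have "reveal_out P h v False r (?s ?d b) = (reveal h v x s)\<lparr>hy_r := (hy_r s)(v := r),
        hy_delta := (hy_delta s)(v := 0), hy_b := (hy_b s)(v := b)\<rparr>" for b
      unfolding reveal_out_def oa by (simp add: reveal_def)
    then show "?G ?d r (\<lambda>b. bra x ?a \<psi> b / 2 / complex_of_real (sqrt 2)) =
      expect (?meas ?d) (\<lambda>b. f ((reveal h v x s)\<lparr>hy_r := (hy_r s)(v := r),
        hy_delta := (hy_delta s)(v := 0), hy_b := (hy_b s)(v := b)\<rparr>, ?msg ?d))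
      (\<lambda>b. bra x ?a \<psi> b / 2 / complex_of_real (sqrt 2))"
      by (simp only:)
  qed
  also have "\<dots> = (\<Sum>x\<in>{0..<8}. \<Sum>r\<in>{False, True}.
      expect (?meas ((x + (?k + ?four r)) mod 8)) (\<lambda>b. f ((reveal h v x s)\<lparr>hy_r := (hy_r s)(v := r),
        hy_delta := (hy_delta s)(v := 0), hy_b := (hy_b s)(v := b)\<rparr>, ?msg ((x + (?k + ?four r)) mod 8)))
      (\<lambda>b. bra x ?a \<psi> b / 2 / complex_of_real (sqrt 2)))"
    by (rule sum.swap)
  also have "\<dots> = expect (imap (\<lambda>x. reveal h v x s) (probe ?a)) (\<lambda>u. expect (step_old (Delta v) u m) f) \<psi>"
  proof -
    have d: "(pattern_angle P False (reveal h v x s) v + hy_theta (reveal h v x s) v + of_bool r * 4) mod 8 =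
      (x + (?k + ?four r)) mod 8" for x r
    proof -
      have "of_bool r * 4 = ?four r" by simp
      moreover have "hy_theta (reveal h v x s) v = (hy_theta s v + x) mod 8" by (simp add: reveal_def)
      ultimately show ?thesis unfolding pa' by (simp only: mod_8_assoc)
    qed
    have st: "hy_r (reveal h v x s) = hy_r s" "hy_delta (reveal h v x s) = hy_delta s"
      "hy_b (reveal h v x s) = hy_b s" for x by (simp_all add: reveal_def)
    have "step_old (Delta v) (reveal h v x s) m = ibind (sample [False, True]) (\<lambda>r.
       ibind (?meas ((x + (?k + ?four r)) mod 8)) (\<lambda>b. ireturn ((reveal h v x s)\<lparr>hy_r := (hy_r s)(v := r),
        hy_delta := (hy_delta s)(v := 0), hy_b := (hy_b s)(v := b)\<rparr>, ?msg ((x + (?k + ?four r)) mod 8))))"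
      for x
      using v_facts(2)
      by (simp only: step_old_def hybrid_step_def round_kind.case ibind_imap if_False prod.case d st)
    then show ?thesis
      by (simp only: expect_imap expect_probe expect_ibind expect_bool expect_ireturn)
  qed
  finally show ?thesis .
qed

text \<open>The ancilla of \<open>v\<close> is the first to be resolved, so its measurement splits
  off. The rest of the round sees the outcome through \<open>hy_m\<close> only, and the final state
  is not read by \<open>f\<close>.\<close>

lemma outputs_step:
  assumes "\<And>u u' m'. f (u, m') = f (u', m')"
  shows "expect (step_new Outputs s m) f \<psi> =
   expect (imap (\<lambda>r. reveal_out P h v True r s) (measure_out (out_angle P v s) (anc P v)))
     (\<lambda>u. expect (step_old Outputs u m) f) \<psi>"
proof -
  have t: "expect (hybrid_tail P M W (reveal_out P h v True r s)) f =
      expect (hybrid_tail P M W (s\<lparr>hy_m := (hy_m s)(v := (hy_m s v \<noteq> r))\<rparr>)) f" for r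
  proof -
    let ?x = "(out_angle P v s - (if r then 4 else 0)) mod 8"
    let ?E = "\<lambda>s'. s'\<lparr>hy_share := (hy_share s')(h := (hy_share s' h)(v := ?x)),
      hy_sum := (hy_sum s')(v := hy_sum s' v + ?x), hy_theta := (hy_theta s')(v := (hy_theta s v + ?x) mod 8),
      hy_delta := (hy_delta s')(v := 0), hy_r := (hy_r s')(v := (hy_r s' v \<noteq> r))\<rparr>"
    have "reveal_out P h v True r s = ?E (s\<lparr>hy_m := (hy_m s)(v := (hy_m s v \<noteq> r))\<rparr>)"
      by (simp add: reveal_out_def reveal_def)
    moreover have "hybrid_tail P M W (?E s') = imap (\<lambda>(s', m'). (?E s', m')) (hybrid_tail P M W s')" for s'
      by (rule hybrid_tail_irrelevant) (use v_facts in auto)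
    moreover have "(\<lambda>x. f (case x of (s', m') \<Rightarrow> (?E s', m'))) = f"
      using assms by (auto simp: fun_eq_iff split: prod.split)
    ultimately show ?thesis by (simp only: expect_imap)
  qed
  have "step_old Outputs = (\<lambda>s m. hybrid_tail P M W s)"
    by (simp add: step_old_def hybrid_step_def hybrid_tail_def fun_eq_iff)
  moreover have "step_new Outputs s m = ibind (measure_out (out_angle P v s) (anc P v))
      (\<lambda>r. hybrid_tail P M W (s\<lparr>hy_m := (hy_m s)(v := (hy_m s v \<noteq> r))\<rparr>))"
    by (simp add: step_new_def hybrid_step_def hybrid_tail_def out_angle_def ibind_assoc)
  ultimately show ?thesis by (simp add: t)
qed

section \<open>Rounds that leave the ancilla of the vertex alone\<close>

lemma local_step_new:
  assumes "expected P k q" "k \<noteq> Hop v h" "k \<noteq> Outputs"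
  shows "local_instr (- {anc P v}) (step_new k s m)"
proof (cases "\<exists>j. k = Hop v j")
  \<comment> \<open>\<open>touched\<close> lists the ancilla for every hop of \<open>v\<close>,
    which is too coarse for the clients other than \<open>h\<close>.\<close>
  case True
  then obtain j where "k = Hop v j" "j \<noteq> h" using assms(2) by auto
  then show ?thesis
    by (auto simp: step_new_def hybrid_step_def anc_def intro!: local_instr_ibind local_op_Rz)
next
  case False
  have "touched P M k \<subseteq> - {anc P v}"
    using False assms v_facts(1) wf
    by (cases k) (auto simp: touched_def anc_def idle_def well_formed_def
        dest!: to_nat_on_inj[THEN iffD1, rotated -1] intro: countable_finite)
  then show ?thesis
    using instrument_on_hybrid_step[OF wf v_facts(4) assms(1)] local_instr_mono
    unfolding step_new_def instrument_on_iff by blast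
qed

text \<open>In these rounds the share of client \<open>h\<close> is not read, except in
  \<open>Correction v\<close>, where it cancels.\<close>

lemma step_reveal:
  assumes "k \<notin> {Inputs, Shares v, Hop v h, Delta v, Outcome v, Outputs}"
  shows "step_old k (reveal h v x s) m = imap (\<lambda>(s', m'). (reveal h v x s', m')) (step_new k s m)"
proof (cases k)
  case (Shares u)
  then have "u \<noteq> v" using assms by auto
  then show ?thesis
    by (auto simp: Shares step_old_def step_new_def hybrid_step_def imap_ibind Let_def reveal_def fun_eq_iff
        intro!: ibind_cong arg_cong[where f = ireturn])
next
  case (Delta u)
  then have "u \<noteq> v" using assms by auto
  moreover have "pattern_angle P False (reveal h v x s) u = pattern_angle P False s u"
    by (rule pattern_angle_cong) (auto simp: reveal_def)
  ultimately show ?thesis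
    by (auto simp: Delta step_old_def step_new_def hybrid_step_def imap_ibind ibind_imap Let_def reveal_def
        fun_eq_iff intro!: ibind_cong arg_cong[where f = ireturn])
next
  case (Hop u j)
  then have "\<not> (u = v \<and> j = h)" using assms by auto
  then show ?thesis
    by (auto simp: Hop step_old_def step_new_def hybrid_step_def imap_ibind reveal_def)
next
  case (Correction u)
  have "((hy_theta s v + x) mod 8 - (hy_sum s v + x)) mod 8 = (hy_theta s v - hy_sum s v) mod 8"
    by (simp add: mod_simps)
  then show ?thesis
    by (auto simp: Correction step_old_def step_new_def hybrid_step_def imap_ibind reveal_def Let_def)
next
  case (Outcome u)
  then have "u \<noteq> v" using assms by auto
  then show ?thesis
    by (auto simp: Outcome step_old_def step_new_def hybrid_step_def reveal_def
        intro!: arg_cong[where f = ireturn])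
qed (use assms in \<open>auto simp: step_old_def step_new_def hybrid_step_def imap_ibind\<close>)

lemma step_untouched:
  assumes "k \<notin> {Shares v, Hop v h, Delta v, Outputs}"
  shows "step_old k s m = imap (\<lambda>(s', m'). (s', m')) (step_new k s m)"
  using assms
  by (cases k) (auto simp: step_old_def step_new_def hybrid_step_def imap_ibind ibind_imap Let_def)

lemma reveal_out_cong:
  assumes "hy_input s = hy_input s'" "\<And>w. w \<in> earlier P v \<Longrightarrow> hy_m s w = hy_m s' w"
    "hy_delta s v = hy_delta s' v" "hy_theta s v = hy_theta s' v"
  shows "out_angle P v s = out_angle P v s'"
  using pattern_angle_cong[of s s' P v] assms by (simp add: out_angle_def)

lemma later_in_W:
  assumes "u \<in> set (meas_order P)" "u \<noteq> v" "v \<in> earlier P u"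
  shows "u \<in> set W"
proof -
  have "v \<notin> set us" using wf by (auto simp: well_formed_def meas)
  have "u \<notin> set us"
  proof
    assume "u \<in> set us"
    then have "takeWhile (\<lambda>w. w \<noteq> u) (us @ v # W) = takeWhile (\<lambda>w. w \<noteq> u) us"
      by (intro takeWhile_append1) auto
    then show False using assms(3) \<open>v \<notin> set us\<close> by (auto simp: earlier_def meas dest: set_takeWhileD)
  qed
  then show ?thesis using assms(1,2) by (auto simp: meas)
qed

text \<open>A vertex \<open>u\<close> measured after \<open>v\<close> is itself postponed: its
  \<delta> is a fresh random number and does not read the unfinished outcome of \<open>v\<close>.
  Conversely, the angle owed for \<open>v\<close> reads only outcomes before
  \<open>v\<close>.\<close>

lemma step_reveal_out:
  assumes "k = Delta u \<or> k = Outcome u" "u \<in> set (meas_order P)" "u \<noteq> v" "v \<in> earlier P u"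
  shows "step_old k (reveal_out P h v fin r s) m =
    imap (\<lambda>(s', m'). (reveal_out P h v fin r s', m')) (step_new k s m)"
    and "yields (step_new k s m) (\<lambda>(s', m'). out_angle P v s' = out_angle P v s)"
proof -
  have e: "u \<notin> earlier P v" using earlier_asym[OF assms(4)] .
  have uW: "u \<in> set W" by (rule later_in_W[OF assms(2-4)])
  let ?d = "\<lambda>r d b. s\<lparr>hy_r := (hy_r s)(u := r), hy_delta := (hy_delta s)(u := d), hy_b := (hy_b s)(u := b)\<rparr>"
  have 1: "out_angle P v (?d r d b) = out_angle P v s" for r d b
    using assms(3) by (intro reveal_out_cong) auto
  have 2: "out_angle P v (s\<lparr>hy_m := (hy_m s)(u := b)\<rparr>) = out_angle P v s" for b
    using e by (intro reveal_out_cong) auto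
  have 3: "reveal_out P h v fin r (?d r' d b) = (reveal_out P h v fin r s)
      \<lparr>hy_r := (hy_r (reveal_out P h v fin r s))(u := r'),
       hy_delta := (hy_delta (reveal_out P h v fin r s))(u := d),
       hy_b := (hy_b (reveal_out P h v fin r s))(u := b)\<rparr>" for r' d b
    unfolding reveal_out_def 1 using assms(3) by (simp add: reveal_def fun_upd_twist)
  have 4: "reveal_out P h v fin r (s\<lparr>hy_m := (hy_m s)(u := b)\<rparr>) = (reveal_out P h v fin r s)
      \<lparr>hy_m := (hy_m (reveal_out P h v fin r s))(u := b)\<rparr>" for b
    unfolding reveal_out_def 2 using assms(3) by (simp add: reveal_def fun_upd_twist)
  have 5: "hy_r (reveal_out P h v fin r s) u = hy_r s u" "hy_b (reveal_out P h v fin r s) = hy_b s"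
    using assms(3) by (simp_all add: reveal_out_def reveal_def)
  show "step_old k (reveal_out P h v fin r s) m =
    imap (\<lambda>(s', m'). (reveal_out P h v fin r s', m')) (step_new k s m)"
    using assms(1)
  proof
    assume "k = Delta u"
    then show ?thesis using uW
      by (simp add: step_old_def step_new_def hybrid_step_def imap_ibind ibind_imap 3)
  next
    assume "k = Outcome u"
    then show ?thesis
      by (simp add: step_old_def step_new_def hybrid_step_def 4 5)
  qed
  show "yields (step_new k s m) (\<lambda>(s', m'). out_angle P v s' = out_angle P v s)"
    using assms(1)
  proof
    assume "k = Delta u"
    then show ?thesis using uW
      by (simp add: step_new_def hybrid_step_def 1) (auto intro!: yieldsI)
  next
    assume "k = Outcome u"
    then show ?thesis by (simp add: step_new_def hybrid_step_def 2)
  qed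
qed

text \<open>The flip by \<open>r\<close> may be applied when the outcome arrives or be added later.
  From this round on \<open>reveal_out\<close> has to flip \<open>hy_m\<close> as well, hence the
  change of its flag.\<close>

lemma step_reveal_outcome:
  shows "step_old (Outcome v) (reveal_out P h v False r s) m =
    imap (\<lambda>(s', m'). (reveal_out P h v True r s', m')) (step_new (Outcome v) s m)"
    and "yields (step_new (Outcome v) s m) (\<lambda>(s', m'). out_angle P v s' = out_angle P v s)"
proof -
  have 2: "out_angle P v (s\<lparr>hy_m := (hy_m s)(v := b)\<rparr>) = out_angle P v s" for b
    by (intro reveal_out_cong) auto
  have 4: "reveal_out P h v True r (s\<lparr>hy_m := (hy_m s)(v := b)\<rparr>) = (reveal_out P h v False r s)
      \<lparr>hy_m := (hy_m (reveal_out P h v False r s))(v := (b \<noteq> r))\<rparr>" for b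
    unfolding reveal_out_def 2 by (simp add: reveal_def)
  have 5: "hy_r (reveal_out P h v False r s) v = (hy_r s v \<noteq> r)" "hy_b (reveal_out P h v False r s) = hy_b s"
    by (simp_all add: reveal_out_def reveal_def)
  have 6: "(x = (y = r)) = ((x = (\<not> y)) = (\<not> r))" for x y by auto
  show "step_old (Outcome v) (reveal_out P h v False r s) m =
    imap (\<lambda>(s', m'). (reveal_out P h v True r s', m')) (step_new (Outcome v) s m)"
    by (simp add: step_old_def step_new_def hybrid_step_def 4 5 6)
  show "yields (step_new (Outcome v) s m) (\<lambda>(s', m'). out_angle P v s' = out_angle P v s)"
    by (simp add: step_new_def hybrid_step_def 2)
qed

text \<open>
  The measurement of the ancilla of \<open>v\<close> that the later hybrid still owes to the earlier one; its
  outcome is the rotation angle of client \<open>h\<close>.  Once \<open>\<delta>(v)\<close> is fixed, only two outcomes are possible,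
  and they are named by \<open>r(v)\<close>.
\<close>

definition pending :: "nat \<Rightarrow> 'v hybrid_state \<Rightarrow> ('v wire reg, 'v hybrid_state) instrument" where
  "pending t s = (let q = stage P t v in
     if t = length (schedule P) then ireturn s
     else if q = 0 then imap (\<lambda>_. s) (reset (anc P v))
     else if q \<le> h + 2 then imap (\<lambda>x. reveal h v x s) drawn
     else if q \<le> clients P + 3 then imap (\<lambda>x. reveal h v x s) (probe (anc P v))
     else imap (\<lambda>r. reveal_out P h v (q = clients P + 5) r s) (measure_out (out_angle P v s) (anc P v)))"

lemma local_drawn: "anc P v \<in> R \<Longrightarrow> local_instr R drawn"
  by (auto simp: drawn_def local_instr_reset intro!: local_instr_ibind)

lemma local_pending: "anc P v \<in> R \<Longrightarrow> local_instr R (pending t s)"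
  by (simp add: pending_def Let_def local_instr_reset local_drawn local_instr_probe local_instr_measure_out)

lemma pending_step:
  assumes t: "t < length (schedule P)"
    and f: "Suc t = length (schedule P) \<Longrightarrow> \<forall>u u' m'. f (u, m') = f (u', m')"
  defines "k \<equiv> schedule P ! t"
  shows "expect (step_new k s m) (\<lambda>(s', m'). expect (pending (Suc t) s') (\<lambda>u. f (u, m'))) \<psi> =
    expect (pending t s) (\<lambda>u. expect (step_old k u m) f) \<psi>"
proof -
  have exp: "expected P k (stage P t)" unfolding k_def by (rule expected_schedule[OF wf t])
  have st: "stage P (Suc t) = advance (clients P) k (stage P t)" unfolding k_def by (rule stage_Suc[OF t])
  have last: "k = Outputs \<longleftrightarrow> Suc t = length (schedule P)"
    unfolding k_def by (rule schedule_Outputs_iff[OF t])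
  have vm: "v \<in> set (meas_order P)" by (simp add: meas)
  note loc = local_step_new[OF exp]
  consider "k = Outputs" | "k = Shares v" | "k = Hop v h" | "k = Delta v" | "k = Outcome v" |
    "k \<notin> {Outputs, Shares v, Hop v h, Delta v, Outcome v}" by auto
  then show ?thesis
  proof cases
    case 1
    have "stage P t v = clients P + 5" using exp v_facts(1) vm by (simp add: 1)
    moreover have "\<And>u u' m'. f (u, m') = f (u', m')" using f last 1 by blast
    ultimately show ?thesis using 1 last t h outputs_step[of f s m \<psi>]
      by (auto simp: pending_def Let_def case_prod_beta')
  next
    case 2
    have "stage P t v = 0" using exp by (simp add: 2)
    then show ?thesis using 2 last t st shares_step[of s m f \<psi>] by (simp add: pending_def Let_def)
  next
    case 3
    have "stage P t v = h + 2" using exp by (simp add: 3)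
    then show ?thesis using 3 last t st h hop_step[of s m f \<psi>] by (simp add: pending_def Let_def)
  next
    case 4
    have "stage P t v = clients P + 3" using exp v_facts(1) by (simp add: 4)
    then show ?thesis using 4 last t st h delta_step[of s m f \<psi>] by (simp add: pending_def Let_def)
  next
    case 5
    have q: "stage P t v = clients P + 4" using exp v_facts(1) by (simp add: 5)
    have "pending t s = imap (\<lambda>r. reveal_out P h v False r s) (measure_out (out_angle P v s) (anc P v))"
      using q t h by (simp add: pending_def Let_def)
    moreover have "yields (step_new k s m) (\<lambda>(s', m'). pending (Suc t) s' =
        imap (\<lambda>r. reveal_out P h v True r s') (measure_out (out_angle P v s) (anc P v)))"
      using step_reveal_outcome(2)[of s m] unfolding 5
      by (rule yields_mono) (use q t h st 5 last in \<open>auto simp: pending_def Let_def\<close>)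
    ultimately show ?thesis
      by (simp only:) (rule expect_transfer[where R' = "\<lambda>r s'. reveal_out P h v True r s'" and
            X = "- {anc P v}" and Y = "{anc P v}"],
          use loc 5 step_reveal_outcome(1) in \<open>auto simp: local_instr_measure_out\<close>)
  next
    case 6
    then have nl: "Suc t \<noteq> length (schedule P)" using last by auto
    have lk: "local_instr (- {anc P v}) (step_new k s m)" using 6 by (intro loc) auto
    \<comment> \<open>The stage of \<open>v\<close> fixes the form of the owed work before and after
      the round; at stage \<open>h + 2\<close> the qubit is on its way to client
      \<open>h\<close>.\<close>
    consider "stage P t v = 0" | "0 < stage P t v" "stage P t v \<le> h + 2" |
      "h + 3 \<le> stage P t v" "stage P t v \<le> clients P + 3" | "clients P + 3 < stage P t v" by linarith
    then show ?thesis
    proof cases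
      case 1
      then have "stage P (Suc t) v = 0" using 6 exp unfolding st by (cases k) auto
      then have "pending (Suc t) s' = imap (\<lambda>_. s') (reset (anc P v))" for s'
        using nl by (simp add: pending_def)
      moreover have "pending t s = imap (\<lambda>_. s) (reset (anc P v))" using 1 t by (simp add: pending_def)
      moreover have "step_old k s m = imap (\<lambda>(s', m'). (s', m')) (step_new k s m)"
        by (rule step_untouched) (use 6 in auto)
      ultimately show ?thesis
        by (simp only:) (rule expect_transfer[where R' = "\<lambda>_ s'. s'" and X = "- {anc P v}" and Y = "{anc P v}"],
          use lk in \<open>auto simp: local_instr_reset intro: yieldsI\<close>)
    next
      case 2
      have r: "step_old k (reveal h v x s) m = imap (\<lambda>(s', m'). (reveal h v x s', m')) (step_new k s m)" for x
        by (rule step_reveal) (use 2 6 exp in auto)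
      have "0 < stage P (Suc t) v \<and> stage P (Suc t) v \<le> h + 2"
        using 2 6 exp h unfolding st by (cases k) (auto simp: idle_def)
      then have "pending (Suc t) s' = imap (\<lambda>x. reveal h v x s') drawn" for s'
        using nl by (simp add: pending_def Let_def)
      moreover have "pending t s = imap (\<lambda>x. reveal h v x s) drawn" using 2 t by (simp add: pending_def Let_def)
      ultimately show ?thesis
        by (simp only:) (rule expect_transfer[where R' = "\<lambda>x s'. reveal h v x s'" and X = "- {anc P v}" and Y = "{anc P v}"],
          use lk r in \<open>auto simp: local_drawn intro: yieldsI\<close>)
    next
      case 3
      have r: "step_old k (reveal h v x s) m = imap (\<lambda>(s', m'). (reveal h v x s', m')) (step_new k s m)" for x
        by (rule step_reveal) (use 3 6 exp in auto)
      have "h + 3 \<le> stage P (Suc t) v \<and> stage P (Suc t) v \<le> clients P + 3"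
        using 3 6 exp h unfolding st by (cases k) (auto simp: idle_def)
      then have "pending (Suc t) s' = imap (\<lambda>x. reveal h v x s') (probe (anc P v))" for s'
        using nl by (simp add: pending_def Let_def)
      moreover have "pending t s = imap (\<lambda>x. reveal h v x s) (probe (anc P v))"
        using 3 t by (simp add: pending_def Let_def)
      ultimately show ?thesis
        by (simp only:) (rule expect_transfer[where R' = "\<lambda>x s'. reveal h v x s'" and X = "- {anc P v}" and Y = "{anc P v}"],
          use lk r in \<open>auto simp: local_instr_probe intro: yieldsI\<close>)
    next
      case 4
      have idle: "u = v \<or> stage P t v = 0 \<or> stage P t v = clients P + 3" if "idle P u (stage P t)" for u
        using that by (auto simp: idle_def)
      obtain u where u: "k = Delta u \<or> k = Outcome u" "u \<in> set (meas_order P)" "u \<noteq> v" "v \<in> earlier P u"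
        and q: "stage P t v = clients P + 5"
        using 4 6 exp v_facts(1) by (cases k) (auto dest!: idle split: if_splits)
      have q': "stage P (Suc t) v = clients P + 5" using q u unfolding st by auto
      have "yields (step_new k s m) (\<lambda>(s', m'). pending (Suc t) s' =
          imap (\<lambda>r. reveal_out P h v True r s') (measure_out (out_angle P v s) (anc P v)))"
        using step_reveal_out(2)[OF u, of s m]
        by (rule yields_mono) (use q' nl h in \<open>auto simp: pending_def Let_def\<close>)
      moreover have "pending t s = imap (\<lambda>r. reveal_out P h v True r s) (measure_out (out_angle P v s) (anc P v))"
        using q t h by (simp add: pending_def Let_def)
      ultimately show ?thesis
        by (simp only:) (rule expect_transfer[where R' = "\<lambda>r s'. reveal_out P h v True r s'" and
            X = "- {anc P v}" and Y = "{anc P v}"],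
          use lk step_reveal_out(1)[OF u] in \<open>auto simp: local_instr_measure_out\<close>)
    qed
  qed
qed

lemma prob_hop:
  assumes D: "fair P ow D"
  shows "prob_one D (hybrid P M h (v # W) False) = prob_one D (hybrid P M h W False)"
proof -
  let ?T = "length (schedule P)"
  let ?B = "hybrid P M h (v # W) False" and ?A = "hybrid P M h W False"
  have AB: "res_step ?A t = step_old (schedule P ! t)" "res_step ?B t = step_new (schedule P ! t)" for t
    by (simp_all add: hybrid_def step_old_def step_new_def fun_eq_iff)
  interpret simulation ?T ow ?B ?A pending "\<lambda>_ _. True"
  proof (standard, goal_cases)
    case (1 t s)
    show ?case by (rule local_pending) (auto simp: observable_def anc_def)
  next
    case (2 s)
    show ?case by (simp add: pending_def)
  next
    case (3 t u m)
    then show ?case using wf v_facts by (intro local_hybrid) auto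
  next
    case (4 t s m)
    then show ?case using wf v_facts by (intro local_hybrid) auto
  next
    case (6 t s f m \<psi>)
    show ?case unfolding AB by (rule pending_step[OF 6(1,4)])
  qed simp
  have p0: "pending 0 s = imap (\<lambda>_. s) (reset (anc P v))" for s
    using schedule_pos[of P] by (auto simp: pending_def stage_0)
  \<comment> \<open>On the vacuum one branch of the reset does nothing and the other vanishes, where
    a quadratic functional is 0.\<close>
  have b: "clear_qubit q False (basis_ket {}) = basis_ket {}" "clear_qubit q True (basis_ket {}) = (\<lambda>b. 0 * basis_ket {} b)"
    for q :: "'v wire reg" by (auto simp: clear_qubit_def basis_ket_def fun_eq_iff)
  show ?thesis
  proof (rule prob_eq)
    fix g :: "'v wire reg ket \<Rightarrow> real" assume "quadratic g"
    then have "g (\<lambda>b. 0 * basis_ket {} b) = 0" unfolding quadratic_def by (metis mult_zero_left norm_zero zero_power2)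
    then show "expect (pending 0 (res_init ?B)) (\<lambda>u. if u = res_init ?A then g else (\<lambda>_. 0)) (basis_ket {}) =
        g (basis_ket {})"
      by (simp add: p0 reset_def b hybrid_def)
  next
    fix u assume "u \<in> fst ` set (pending 0 (res_init ?B))"
    then show "u = res_init ?A" by (auto simp: p0 hybrid_def)
  qed (use D in \<open>auto simp: fair_def hybrid_def\<close>)
qed

end

lemma prob_hybrid_postponed:
  assumes wf: "well_formed P" and h: "h < clients P" "Client h \<notin> M" and D: "fair P ow D"
  shows "prob_one D (hybrid P M h [] False) = prob_one D (hybrid P M h (meas_order P) False)"
proof -
  have "meas_order P = us @ W \<Longrightarrow> prob_one D (hybrid P M h [] False) = prob_one D (hybrid P M h W False)" for us W
  proof (induction W arbitrary: us)
    case (Cons v W)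
    interpret vertex_hop P M h us v W using wf h Cons.prems by unfold_locales auto
    show ?case using Cons.IH[of "us @ [v]"] Cons.prems prob_hop[OF D] by simp
  qed simp
  then show ?thesis by (metis append_Nil)
qed

section \<open>The simulator\<close>

subsection \<open>Exchanging registers\<close>

definition exchange :: "'a set \<Rightarrow> ('a \<Rightarrow> 'r) \<Rightarrow> ('a \<Rightarrow> 'r) \<Rightarrow> 'r \<Rightarrow> 'r" where
  "exchange A f g r = (if r \<in> f ` A then g (inv_into A f r)
     else if r \<in> g ` A then f (inv_into A g r) else r)"

locale exchangeable =
  fixes V :: "'a set" and f g :: "'a \<Rightarrow> 'r"
  assumes inj_f: "inj_on f V" and inj_g: "inj_on g V" and disj: "f ` V \<inter> g ` V = {}"
begin

lemma exchange_f:
  assumes "A \<subseteq> V" "a \<in> V"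
  shows "exchange A f g (f a) = (if a \<in> A then g a else f a)"
proof -
  have "f a \<in> f ` A \<longleftrightarrow> a \<in> A" by (rule inj_on_image_mem_iff[OF inj_f assms(2,1)])
  moreover have "f a \<notin> g ` A" using disj assms by blast
  moreover have "a \<in> A \<Longrightarrow> inv_into A f (f a) = a"
    by (rule inv_into_f_f[OF inj_on_subset[OF inj_f assms(1)]])
  ultimately show ?thesis by (simp add: exchange_def)
qed

lemma exchange_g:
  assumes "A \<subseteq> V" "a \<in> V"
  shows "exchange A f g (g a) = (if a \<in> A then f a else g a)"
proof -
  have "g a \<in> g ` A \<longleftrightarrow> a \<in> A" by (rule inj_on_image_mem_iff[OF inj_g assms(2,1)])
  moreover have "g a \<notin> f ` A" using disj assms by blast
  moreover have "a \<in> A \<Longrightarrow> inv_into A g (g a) = a"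
    by (rule inv_into_f_f[OF inj_on_subset[OF inj_g assms(1)]])
  ultimately show ?thesis by (simp add: exchange_def)
qed

lemma exchange_other: "r \<notin> f ` A \<Longrightarrow> r \<notin> g ` A \<Longrightarrow> exchange A f g r = r"
  by (simp add: exchange_def)

text \<open>Swaps of disjoint pairs commute and are involutions, so a pair swapped by both factors
  is left in place. The bookkeeping of where a qubit resides reduces to symmetric
  differences.\<close>

lemma exchange_comp:
  assumes "A \<subseteq> V" "B \<subseteq> V"
  shows "exchange A f g \<circ> exchange B f g = exchange ((A - B) \<union> (B - A)) f g"
proof
  fix r
  have D: "(A - B) \<union> (B - A) \<subseteq> V" using assms by blast
  consider a where "a \<in> V" "r = f a" | a where "a \<in> V" "r = g a" | "r \<notin> f ` V" "r \<notin> g ` V" by blast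
  then show "(exchange A f g \<circ> exchange B f g) r = exchange ((A - B) \<union> (B - A)) f g r"
  proof cases
    case (1 a)
    then show ?thesis using exchange_f[OF D] by (simp add: exchange_f exchange_g assms)
  next
    case (2 a)
    then show ?thesis using exchange_g[OF D] by (simp add: exchange_f exchange_g assms)
  next
    case 3
    have "exchange X f g r = r" if "X \<subseteq> V" for X
      by (rule exchange_other) (use 3 that in blast)+
    then show ?thesis using assms D by simp
  qed
qed

lemma exchange_empty: "exchange {} f g = id"
  by (auto simp: exchange_def)

lemma exchange_involution: "A \<subseteq> V \<Longrightarrow> exchange A f g (exchange A f g r) = r"
  using exchange_comp[of A A] by (simp add: exchange_empty fun_eq_iff)

lemma bij_exchange: "A \<subseteq> V \<Longrightarrow> bij (exchange A f g)"
  by (rule bij_involution) (rule exchange_involution)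

lemma inv_exchange: "A \<subseteq> V \<Longrightarrow> inv (exchange A f g) = exchange A f g"
  by (rule inv_unique_comp) (simp_all add: exchange_comp exchange_empty)

lemma instrument_on_exchange:
  "A \<subseteq> V \<Longrightarrow> finite A \<Longrightarrow> f ` A \<union> g ` A \<subseteq> R \<Longrightarrow> instrument_on R (gate (rename (exchange A f g)))"
  by (rule instrument_on_rename[OF bij_exchange, where F = "f ` A \<union> g ` A"]) (auto intro: exchange_other)

end

subsection \<open>Classical memory of the simulator\<close>

definition encode_state :: "'v public_info \<Rightarrow> 'v hybrid_state \<Rightarrow> 'v msg list" where
  "encode_state P s = [Result [] (\<lambda>v. (hy_theta s v, hy_m s v)), Result [] (\<lambda>v. (hy_sum s v, hy_b s v)),
     Result [] (\<lambda>v. (hy_delta s v, hy_r s v))] @ map (\<lambda>j. Result [] (\<lambda>v. (hy_share s j v, False))) [0..<clients P]"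

definition lookup :: "'v msg list \<Rightarrow> nat \<Rightarrow> 'v \<Rightarrow> int \<times> bool" where
  "lookup c i = (if i < length c then (case c ! i of Result _ key \<Rightarrow> key | _ \<Rightarrow> (\<lambda>_. (0, False)))
     else (\<lambda>_. (0, False)))"

definition decode_state :: "'v public_info \<Rightarrow> 'v msg list \<Rightarrow> 'v hybrid_state" where
  "decode_state P c = \<lparr>hy_input = \<lambda>_. no_input,
     hy_share = \<lambda>j. if j < clients P then (\<lambda>v. fst (lookup c (j + 3) v)) else (\<lambda>_. 0),
     hy_theta = \<lambda>v. fst (lookup c 0 v), hy_sum = \<lambda>v. fst (lookup c 1 v),
     hy_delta = \<lambda>v. fst (lookup c 2 v), hy_r = \<lambda>v. snd (lookup c 2 v),
     hy_m = \<lambda>v. snd (lookup c 0 v), hy_b = \<lambda>v. snd (lookup c 1 v)\<rparr>"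

lemma length_encode_state [simp]: "length (encode_state P s) = clients P + 3"
  by (simp add: encode_state_def)

lemma decode_encode_state:
  assumes "\<And>j. clients P \<le> j \<Longrightarrow> hy_share s j = (\<lambda>_. 0)" "hy_input s = (\<lambda>_. no_input)"
  shows "decode_state P (encode_state P s) = s"
proof -
  have e: "lookup (encode_state P s) 0 = (\<lambda>v. (hy_theta s v, hy_m s v))"
    "lookup (encode_state P s) 1 = (\<lambda>v. (hy_sum s v, hy_b s v))"
    "lookup (encode_state P s) 2 = (\<lambda>v. (hy_delta s v, hy_r s v))"
    "j < clients P \<Longrightarrow> lookup (encode_state P s) (j + 3) = (\<lambda>v. (hy_share s j v, False))" for j
    by (simp_all add: lookup_def encode_state_def numeral_2_eq_2 numeral_3_eq_3 del: upt_Suc)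
  note e = e e(2)[unfolded One_nat_def]
  have "hy_share (decode_state P (encode_state P s)) = hy_share s"
    using assms(1) by (auto simp: decode_state_def e fun_eq_iff not_less)
  then show ?thesis
    using assms(2) by (intro hybrid_state.equality) (simp_all add: decode_state_def e)
qed

text \<open>A set containing all messages due to malicious clients in the last round. Keys reduced
  modulo 8 and trivial outside the finite vertex set make it countable, as the unary encoding
  requires.\<close>

definition results_msgs :: "'v public_info \<Rightarrow> 'v msg set" where
  "results_msgs P = (\<lambda>(y, key). Result y key) ` (UNIV \<times>
     {key. \<forall>v. (v \<in> verts P \<longrightarrow> key v \<in> {0..<8} \<times> UNIV) \<and> (v \<notin> verts P \<longrightarrow> key v = (0, False))})"

lemma countable_results_msgs: "finite (verts P) \<Longrightarrow> countable (results_msgs P)"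
  unfolding results_msgs_def
  by (intro countable_image countable_SIGMA countableI_type countable_finite[OF finite_set_of_finite_funs]) auto

text \<open>The resource hands a bit string to every client; the message is recovered from its length.\<close>

definition encode_msg :: "'v public_info \<Rightarrow> 'v msg option \<Rightarrow> bool list" where
  "encode_msg P x = replicate (to_nat_on (results_msgs P) (the x)) True"

definition decode_msg :: "'v public_info \<Rightarrow> bool list \<Rightarrow> 'v msg" where
  "decode_msg P y = from_nat_into (results_msgs P) (length y)"

lemma decode_encode_msg:
  "finite (verts P) \<Longrightarrow> x \<in> results_msgs P \<Longrightarrow> decode_msg P (encode_msg P (Some x)) = x"
  by (simp add: decode_msg_def encode_msg_def countable_results_msgs)

lemma hybrid_output_in_results:
  assumes "well_formed P" "Client j \<in> M" "j < clients P"
  shows "\<exists>x\<in>results_msgs P. hybrid_output P M s (Client j) = Some x"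
proof -
  have "outs P j \<subseteq> verts P" using assms by (auto simp: well_formed_def out_verts_def)
  then have "Result (classical_output P j (hy_m s)) (\<lambda>v. if v \<in> outs P j then hybrid_key P s v else (0, False))
      \<in> results_msgs P"
    unfolding results_msgs_def
    by (intro image_eqI[of _ _ "(_, _)"]) (auto simp: hybrid_key_def split: prod.splits)
  then show ?thesis using assms by (simp add: hybrid_output_def)
qed

subsection \<open>Who holds the qubits\<close>

text \<open>The owner just before round \<open>t\<close>. Stage \<open>j + 2\<close> means on the
  way to client \<open>j\<close>; before sending and after the last hop the qubit counts as the
  server's.\<close>

definition holder :: "'v public_info \<Rightarrow> nat \<Rightarrow> 'v \<Rightarrow> party" where
  "holder P t v = (if 2 \<le> stage P t v \<and> stage P t v < clients P + 2 then Client (stage P t v - 2) else Server)"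

definition transit :: "'v round_kind \<Rightarrow> 'v set" where
  "transit k = (case k of Send v \<Rightarrow> {v} | Hop v j \<Rightarrow> {v} | _ \<Rightarrow> {})"

definition kept :: "'v public_info \<Rightarrow> party set \<Rightarrow> nat \<Rightarrow> 'v set" where
  "kept P M t = {v \<in> verts P. holder P t v \<notin> M}"

definition incoming :: "'v public_info \<Rightarrow> party set \<Rightarrow> nat \<Rightarrow> 'v set" where
  "incoming P M t = {v \<in> transit (schedule P ! t). holder P t v \<in> M}"

definition outgoing :: "'v public_info \<Rightarrow> party set \<Rightarrow> nat \<Rightarrow> 'v set" where
  "outgoing P M t = {v \<in> transit (schedule P ! t). holder P (Suc t) v \<in> M}"

text \<open>The qubits that reside with the simulator while it plays the round. A qubit that travels
  between two malicious parties merely passes through.\<close>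

definition working :: "'v public_info \<Rightarrow> party set \<Rightarrow> nat \<Rightarrow> 'v set" where
  "working P M t = kept P M t \<union> transit (schedule P ! t)"

lemma holder_server:
  assumes "well_formed P" "t < length (schedule P)" "v \<in> verts P" "v \<notin> transit (schedule P ! t)"
  shows "holder P t v = Server" "holder P (Suc t) v = Server"
proof -
  note e = expected_schedule[OF assms(1,2)]
  have idle: "u = v \<or> stage P t v = 0 \<or> stage P t v = clients P + 3" if "idle P u (stage P t)" for u
    using that by (auto simp: idle_def)
  show "holder P t v = Server"
    using e assms(3,4) by (cases "schedule P ! t") (auto simp: holder_def transit_def dest!: idle)
  show "holder P (Suc t) v = Server"
    using e assms(3,4) unfolding holder_def stage_Suc[OF assms(2)]
    by (cases "schedule P ! t") (auto simp: transit_def dest!: idle)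
qed

lemma transit_verts:
  "well_formed P \<Longrightarrow> t < length (schedule P) \<Longrightarrow> transit (schedule P ! t) \<subseteq> verts P"
  using expected_schedule[of P t] by (cases "schedule P ! t") (auto simp: transit_def idle_def)

text \<open>In terms of swaps: with the kept qubits at home, taking in the incoming ones gives the
  working set.\<close>

lemma working_incoming:
  assumes "well_formed P" "t < length (schedule P)"
  shows "kept P M t = (working P M t - incoming P M t) \<union> (incoming P M t - working P M t)"
  using transit_verts[OF assms] by (auto simp: working_def kept_def incoming_def)

lemma working_outgoing:
  assumes "well_formed P" "t < length (schedule P)"
  shows "kept P M (Suc t) = (working P M t - outgoing P M t) \<union> (outgoing P M t - working P M t)"
proof -
  have "holder P (Suc t) v = holder P t v" if "v \<in> verts P" "v \<notin> transit (schedule P ! t)" for v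
    using holder_server[OF assms that] by simp
  then show ?thesis
    using transit_verts[OF assms] unfolding working_def kept_def outgoing_def by fastforce
qed

lemma incoming_channel:
  assumes "well_formed P" "t < length (schedule P)" "v \<in> incoming P M t"
  shows "holder P t v \<in> M" "Qubit v \<in> channel_in P t (holder P t v)"
  using expected_schedule[OF assms(1,2)] assms(3)
  by (cases "schedule P ! t"; auto simp: incoming_def transit_def channel_in_def holder_def)+

lemma outgoing_channel:
  assumes "well_formed P" "t < length (schedule P)" "v \<in> outgoing P M t" "clients P \<ge> 1"
  shows "holder P (Suc t) v \<in> M" "Qubit v \<in> channel_out P t (holder P (Suc t) v)"
  using expected_schedule[OF assms(1,2)] assms(3,4)
  by (cases "schedule P ! t"; auto simp: outgoing_def transit_def channel_out_def holder_def stage_Suc[OF assms(2)])+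

lemma open_wires_real:
  "open_wires (real_game P M) t = (if t < length (schedule P)
      then \<Union>p. if p \<in> set (honest P M) then {} else channel_in P t p else {}) \<union>
    (if t = 0 then {} else \<Union>p. if p \<in> set (honest P M) then output_port P p (t - 1) else channel_out P (t - 1) p)"
  by (simp add: open_wires_def run_by_def attach_def parallel_def smpc_resource_def mcbqc_protocol_def if_distrib
      cong: if_cong)
lemma open_wires_end: "open_wires (real_game P M) (length (schedule P)) \<subseteq> Qubit ` out_verts P"
proof -
  have "schedule P ! (length (schedule P) - 1) = Outputs" by (rule schedule_last)
  moreover have "output_wires P p \<subseteq> Qubit ` out_verts P" for p
    by (cases p) (auto simp: output_wires_def out_verts_def intro!: imageI)
  ultimately show ?thesis
    using schedule_pos[of P] by (auto simp: open_wires_real output_port_def channel_out_def split: if_splits)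
qed

text \<open>This is why the relocation goes unnoticed: the wire of a qubit in honest hands is closed
  to the distinguisher.\<close>

lemma kept_not_open:
  assumes "well_formed P" "t < length (schedule P)" "clients P \<ge> 1" "v \<in> kept P M t"
  shows "Qubit v \<notin> open_wires (real_game P M) t"
proof
  assume "Qubit v \<in> open_wires (real_game P M) t"
  note e = expected_schedule[OF assms(1,2)]
  have hold: "holder P t v \<notin> M" "v \<in> verts P" using assms(4) by (auto simp: kept_def)
  consider p where "p \<notin> set (honest P M)" "Qubit v \<in> channel_in P t p"
    | p where "t > 0" "p \<in> set (honest P M)" "Qubit v \<in> output_port P p (t - 1)"
    | p where "t > 0" "p \<notin> set (honest P M)" "Qubit v \<in> channel_out P (t - 1) p"
    using \<open>Qubit v \<in> open_wires (real_game P M) t\<close> by (auto simp: open_wires_real split: if_splits)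
  then show False
  proof cases
    case 1
    show ?thesis
    proof (cases "schedule P ! t")
      case Outputs
      then have "p = Server" using 1 by (auto simp: channel_in_def split: if_splits)
      moreover have "holder P t v = Server" using holder_server[OF assms(1,2) hold(2)] Outputs by (simp add: transit_def)
      ultimately show ?thesis using 1 hold by (simp add: set_honest)
    qed (use 1 e hold in \<open>auto simp: channel_in_def holder_def set_honest split: if_splits\<close>)
  next
    case 2
    then have "schedule P ! (t - 1) = Outputs" by (auto simp: output_port_def split: if_splits)
    moreover have "t - 1 < length (schedule P)" using assms(2) by simp
    ultimately show ?thesis using schedule_Outputs_iff[of "t - 1" P] 2 assms(2) by simp
  next
    case 3
    have t1: "t - 1 < length (schedule P)" "Suc (t - 1) = t" using 3 assms(2) by auto
    note e1 = expected_schedule[OF assms(1) t1(1)]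
    note s1 = stage_Suc[OF t1(1), unfolded t1(2)]
    show ?thesis
    proof (cases "schedule P ! (t - 1)")
      case Outputs
      then show ?thesis using schedule_Outputs_iff[OF t1(1)] t1(2) assms(2) by simp
    qed (use 3 e1 s1 hold assms(3) in \<open>auto simp: channel_out_def holder_def set_honest split: if_splits\<close>)
  qed
qed

subsection \<open>Simulation of the last hybrid by the ideal resource\<close>

lemma yields_gate [simp]: "yields (gate U) Q \<longleftrightarrow> Q ()"
  by (simp add: yields_def gate_def)

abbreviation ideal_game :: "'v public_info \<Rightarrow> party set \<Rightarrow>
    (party, 'v wire, 'v msg, (party \<Rightarrow> unit) \<times> 'v ideal_state) resource" where
  "ideal_game P M \<equiv> run_by (honest P M) (mcbqc_filter P) (mcbqc_resource P)"

definition filter_msg :: "'v round_kind \<Rightarrow> party \<Rightarrow> 'v msg option \<Rightarrow> 'v msg option" where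
  "filter_msg k p x = (case (k, p) of
     (Inputs, Client j) \<Rightarrow> Some (FlaggedInput False (input_of x))
   | (Inputs, Server) \<Rightarrow> Some (Flag False)
   | _ \<Rightarrow> None)"

lemma ideal_step:
  "res_step (ideal_game P M) t (fs, s) m =
    imap (\<lambda>(s', m'). ((fs, s'), m')) (mcbqc_step P t s
      (\<lambda>p. if p \<in> set (honest P M) then filter_msg (schedule P ! t) p (m p) else m p))"
proof -
  let ?H = "set (honest P M)"
  let ?m = "\<lambda>p. if p \<in> ?H then filter_msg (schedule P ! t) p (m p) else m p"
  have fs: "(\<lambda>p. if p \<in> ?H then () else fs' p) = fs'" for fs' by auto
  have pre: "run_parties (honest P M) (\<lambda>p. filter_pre P p t) fs (m |` ?H) =
      ireturn (fs, \<lambda>p. if p \<in> ?H then filter_msg (schedule P ! t) p (m p) else None)"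
    by (subst run_parties_det[of _ _ _ _ "\<lambda>_. ()" "\<lambda>p. filter_msg (schedule P ! t) p (m p)"])
      (auto simp: filter_pre_def filter_msg_def fun_eq_iff restrict_map_def intro!: arg_cong[where f = ireturn])
  have o: "override_on m (\<lambda>p. if p \<in> ?H then filter_msg (schedule P ! t) p (m p) else None) ?H = ?m"
    by (auto simp: override_on_def fun_eq_iff)
  have post: "run_parties (honest P M) (\<lambda>p s x. ireturn ((), x)) fs (m2 |` ?H) = ireturn (fs, m2 |` ?H)" for m2
    by (subst run_parties_det[of _ _ _ _ "\<lambda>_. ()" m2])
      (auto simp: fun_eq_iff restrict_map_def intro!: arg_cong[where f = ireturn])
  have o2: "override_on m2 (m2 |` ?H) ?H = m2" for m2 :: "party \<rightharpoonup> 'a msg"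
    by (auto simp: override_on_def fun_eq_iff)
  show ?thesis
    by (simp add: run_by_def attach_def parallel_def mcbqc_filter_def mcbqc_resource_def pre post o o2
        imap_eq_ibind case_prod_beta')
qed

text \<open>The wires \<open>Psi p0\<close> of some malicious party carry the whole quantum memory
  of the simulator to the resource. The empty coalition has no such wires and is treated
  separately.\<close>

locale relocation =
  fixes P :: "'v public_info" and M :: "party set" and h :: nat and p0 :: party
  assumes wf: "well_formed P" and h: "h < clients P" and honest_h: "Client h \<notin> M"
    and M: "M \<subseteq> set (parties P)" and p0: "p0 \<in> M"
begin

abbreviation T :: nat where "T \<equiv> length (schedule P)"
abbreviation psi :: "nat \<Rightarrow> 'v wire reg" where "psi k \<equiv> Wire (Psi p0 k)"
abbreviation idx :: "'v \<Rightarrow> nat" where "idx \<equiv> to_nat_on (verts P)"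

definition memory :: "nat set" where
  "memory = (\<lambda>v. 2 * idx v) ` verts P \<union> (\<lambda>v. 2 * idx v + 1) ` verts P"

text \<open>This is \<open>kept\<close> in the last round, when every qubit is with the
  server.\<close>

definition own_verts :: "'v set" where
  "own_verts = (if Server \<in> M then {} else verts P)"

definition own_outs :: "'v set" where
  "own_outs = (if Server \<in> M then {} else out_verts P)"

abbreviation sw :: "'v set \<Rightarrow> 'v wire reg \<Rightarrow> 'v wire reg" where "sw X \<equiv> exchange X vq (home P)"
abbreviation Z :: "'v wire reg \<Rightarrow> 'v wire reg" where "Z \<equiv> exchange memory SimMem psi"
text \<open>With an honest server the output qubits reach the last round inside
  \<open>\<psi>\<close>, and the attack has to put them onto the wires where the clients receive
  them. A malicious server delivers them on these wires itself.\<close>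

abbreviation Y :: "'v wire reg \<Rightarrow> 'v wire reg" where "Y \<equiv> exchange own_outs (\<lambda>v. psi (2 * idx v)) vq"

lemma fin: "finite (verts P)" "out_verts P \<subseteq> verts P" "finite (out_verts P)"
  using wf by (auto simp: well_formed_def intro: finite_subset)

lemma idx_inj: "u \<in> verts P \<Longrightarrow> v \<in> verts P \<Longrightarrow> idx u = idx v \<longleftrightarrow> u = v"
  by (simp add: fin countable_finite)

sublocale sw: exchangeable "verts P" vq "home P"
  by unfold_locales (auto simp: home_def idx_inj inj_on_def)

sublocale Z: exchangeable UNIV SimMem psi
  by unfold_locales (auto simp: inj_on_def)

sublocale Y: exchangeable "verts P" "\<lambda>v. psi (2 * idx v)" vq
  by unfold_locales (auto simp: idx_inj inj_on_def)

lemma subs: "own_verts \<subseteq> verts P" "own_outs \<subseteq> verts P" "kept P M t \<subseteq> verts P"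
  "finite own_outs" "finite memory"
  using fin by (auto simp: own_verts_def own_outs_def kept_def memory_def)

definition hstep :: "'v round_kind \<Rightarrow> 'v hybrid_state \<Rightarrow> (party \<rightharpoonup> 'v msg) \<Rightarrow>
    ('v wire reg, 'v hybrid_state \<times> (party \<rightharpoonup> 'v msg)) instrument" where
  "hstep = hybrid_step P M h (meas_order P) False"

definition cut :: "(nat \<Rightarrow> 'v client_input) \<Rightarrow> nat \<Rightarrow> 'v client_input" where
  "cut x = (\<lambda>j. if j < clients P then x j else no_input)"

text \<open>
  In the last round the simulator hands all its registers to the resource as \<open>\<psi>\<close>, and the attack
  plays the last round of the hybrid game on them.  The messages for malicious clients are encoded
  in their classical outputs.
\<close>

definition attack :: "'v msg list \<Rightarrow> 'v attack_map" where
  "attack c x = ibind (conjugate (Z \<circ> sw own_verts)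
       (hstep Outputs ((decode_state P c)\<lparr>hy_input := cut x\<rparr>) Map.empty)) (\<lambda>(s, m).
     ibind (gate (rename Y)) (\<lambda>_. ireturn (\<lambda>j. if Client j \<in> M then encode_msg P (m (Client j))
       else (case m (Client j) of Some (Output y) \<Rightarrow> y | _ \<Rightarrow> []))))"

text \<open>The game produces the message for the server before the resource is called, but only
  \<open>sim_post\<close> can deliver it. It travels as one extra entry behind the encoded state, at
  position \<open>clients P + 3\<close>.\<close>

definition sim_pre :: "nat \<Rightarrow> 'v msg list \<Rightarrow> (party \<rightharpoonup> 'v msg) \<Rightarrow>
    ('v wire reg, 'v msg list \<times> (party \<rightharpoonup> 'v msg)) instrument" where
  "sim_pre t c m = (if schedule P ! t = Inputs then
       ireturn (c, \<lambda>p. case p of Server \<Rightarrow> Some (Flag True)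
         | Client j \<Rightarrow> Some (FlaggedInput True (input_of (m p))))
     else if schedule P ! t = Outputs then
       ibind (gate (rename Z)) (\<lambda>_. ireturn (c, \<lambda>_. Some (Attack (attack c))))
     else ibind (gate (rename (sw (incoming P M t)))) (\<lambda>_.
       ibind (conjugate (sw (working P M t)) (hstep (schedule P ! t) (decode_state P c) m)) (\<lambda>(s, m').
       ireturn (encode_state P s @ (case m' Server of None \<Rightarrow> [] | Some x \<Rightarrow> [x]), Map.empty))))"

definition sim_post :: "nat \<Rightarrow> 'v msg list \<Rightarrow> (party \<rightharpoonup> 'v msg) \<Rightarrow>
    ('v wire reg, 'v msg list \<times> (party \<rightharpoonup> 'v msg)) instrument" where
  "sim_post t c m = (if schedule P ! t = Inputs then ireturn (c, Map.empty)
     else if schedule P ! t = Outputs then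
       ireturn (c, \<lambda>p. case m p of Some (Output y) \<Rightarrow> Some (decode_msg P y) | _ \<Rightarrow> None)
     else ibind (gate (rename (sw (outgoing P M t)))) (\<lambda>_.
       ireturn (take (clients P + 3) c,
         \<lambda>p. if p = Server \<and> clients P + 3 < length c then Some (c ! (clients P + 3)) else None)))"

definition simulator :: "(party, 'v wire, 'v msg, 'v msg list) converter" where
  "simulator = \<lparr>conv_in = channel_in P, conv_out = channel_out P,
     conv_init = encode_state P hybrid_init, conv_pre = sim_pre, conv_post = sim_post\<rparr>"

lemma clients_pos: "clients P \<ge> 1"
  using h by simp

lemma expected_last: "\<exists>q. expected P Outputs q"
proof
  show "expected P Outputs (stage P (T - 1))"
    using expected_schedule[OF wf, of "T - 1"] schedule_last[of P] schedule_pos[of P] by simp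
qed

lemma meas_sub: "set (meas_order P) \<subseteq> verts P"
  using wf by (auto simp: well_formed_def)

lemma instrument_hstep: "expected P k q \<Longrightarrow> instrument_on (touched P M k) (hstep k s m)"
  unfolding hstep_def by (rule instrument_on_hybrid_step[OF wf meas_sub])

lemma Z_sw: "bij (Z \<circ> sw own_verts)"
  by (intro bij_comp sw.bij_exchange Z.bij_exchange subs) simp

text \<open>The ancillas always go to \<open>\<psi>\<close>, and so do the output qubits of an
  honest server. Those of a malicious server stay on their wires, which an admissible map may
  access.\<close>

lemma attack_registers:
  "(Z \<circ> sw own_verts) ` touched P M Outputs \<subseteq> range psi \<union> vq ` out_verts P"
proof -
  have "Z (sw own_verts (anc P v)) \<in> range psi" if "v \<in> verts P" for v
  proof -
    have "sw own_verts (anc P v) = anc P v"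
      by (rule sw.exchange_other) (auto simp: anc_def home_def, presburger)
    then show ?thesis using Z.exchange_f[of memory "2 * idx v + 1"] that by (auto simp: anc_def memory_def)
  qed
  moreover have "Z (sw own_verts (vq v)) \<in> range psi \<union> vq ` out_verts P" if "v \<in> out_verts P" for v
  proof (cases "Server \<in> M")
    case True
    then have "Z (sw own_verts (vq v)) = vq v"
      by (auto simp: own_verts_def sw.exchange_empty intro!: Z.exchange_other)
    then show ?thesis using that by simp
  next
    case False
    then have "sw own_verts (vq v) = home P v"
      using that fin(2) by (subst sw.exchange_f) (auto simp: own_verts_def)
    then show ?thesis using Z.exchange_f[of memory "2 * idx v"] that fin(2) by (auto simp: home_def memory_def)
  qed
  ultimately show ?thesis by (auto simp: touched_def)
qed

lemma hstep_outputs: "yields (hstep Outputs s m) (\<lambda>(s', m'). m' = hybrid_output P M s')"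
  by (auto simp: hstep_def hybrid_step_def intro!: yieldsI)

text \<open>The resource would replace an inadmissible map by the target map. Unary encodings of
  arbitrary length are admissible, as they go to malicious clients only.\<close>

lemma valid_attack: "valid_attack P M (attack c)"
  unfolding valid_attack_def
proof (intro allI conjI)
  fix x
  let ?R = "Wire ` ({Psi p k |p k. p \<in> M} \<union> Qubit ` out_verts P)"
  have R: "range psi \<union> vq ` out_verts P \<subseteq> ?R" using p0 by auto
  obtain q where q: "expected P Outputs q" using expected_last by blast
  show "instrument_on ?R (attack c x)"
    unfolding attack_def
  proof (intro instrument_on_ibind)
    show "instrument_on ?R (conjugate (Z \<circ> sw own_verts)
       (hstep Outputs ((decode_state P c)\<lparr>hy_input := cut x\<rparr>) Map.empty))"
      using attack_registers R by (intro instrument_on_conjugate[OF Z_sw instrument_hstep[OF q]]) blast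
  next
    fix z
    have "instrument_on ?R (gate (rename Y))"
      using subs fin p0 by (intro Y.instrument_on_exchange) (auto simp: own_outs_def)
    then show "instrument_on ?R (case z of (s, m) \<Rightarrow> ibind (gate (rename Y)) (\<lambda>_. ireturn (\<lambda>j.
       if Client j \<in> M then encode_msg P (m (Client j))
       else (case m (Client j) of Some (Output y) \<Rightarrow> y | _ \<Rightarrow> []))))"
      by (auto split: prod.split intro!: instrument_on_ibind)
  qed
  have "yields (attack c x) (\<lambda>y. \<forall>j<clients P. Client j \<notin> M \<longrightarrow>
      length (y j) = length (classical_output P j (\<lambda>_. False)))"
  proof -
    have "yields (conjugate (Z \<circ> sw own_verts)
       (hstep Outputs ((decode_state P c)\<lparr>hy_input := cut x\<rparr>) Map.empty))
       (\<lambda>(s', m'). m' = hybrid_output P M s')"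
      using hstep_outputs unfolding yields_def by simp
    then show ?thesis
      unfolding attack_def yields_ibind
      by (rule yields_mono) (auto simp: hybrid_output_def classical_output_def)
  qed
  then show "\<forall>(y, K)\<in>set (attack c x). \<forall>j<clients P. Client j \<notin> M \<longrightarrow>
      length (y j) = length (classical_output P j (\<lambda>_. False))"
    unfolding yields_def by fastforce
qed

text \<open>Every wire on which an honest party acts in the round belongs to the working set, so
  conjugation by the swap sends it to its home register.\<close>

lemma work_registers:
  assumes t: "t < T" and k: "schedule P ! t \<noteq> Outputs"
  shows "sw (working P M t) ` touched P M (schedule P ! t) \<subseteq> range SimMem"
proof -
  have W: "working P M t \<subseteq> verts P"
    using transit_verts[OF wf t] by (auto simp: working_def kept_def)
  have a: "sw (working P M t) (anc P v) = anc P v" for v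
    by (rule sw.exchange_other) (auto simp: anc_def home_def, presburger)
  have q: "sw (working P M t) (vq v) = home P v" if "v \<in> working P M t" for v
    using that W by (subst sw.exchange_f) auto
  show ?thesis
  proof (rule image_subsetI)
    fix r assume r: "r \<in> touched P M (schedule P ! t)"
    then consider v where "r = vq v" | v where "r = anc P v"
      using k by (cases "schedule P ! t") (auto simp: touched_def split: if_splits)
    then show "sw (working P M t) r \<in> range SimMem"
    proof cases
      case (1 v)
      then have "v \<in> working P M t"
        using r k expected_schedule[OF wf t] holder_server(1)[OF wf t, of v]
        by (cases "schedule P ! t")
          (auto simp: touched_def working_def kept_def transit_def anc_def split: if_splits)
      then show ?thesis using q 1 by (simp add: home_def)
    qed (simp add: a, simp add: anc_def)
  qed
qed

lemma is_simulator: "is_simulator M (ideal_game P M) simulator"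
  unfolding is_simulator_def
proof (intro allI impI conjI)
  fix t c m assume "t < rounds (ideal_game P M)"
  then have t: "t < T" by (simp add: run_by_def attach_def mcbqc_resource_def)
  have W: "working P M t \<subseteq> verts P"
    using transit_verts[OF wf t] by (auto simp: working_def kept_def)
  have fw: "finite X" if "X \<subseteq> verts P" for X using that fin(1) by (rule finite_subset)
  have i: "incoming P M t \<subseteq> verts P" "outgoing P M t \<subseteq> verts P"
    using transit_verts[OF wf t] by (auto simp: incoming_def outgoing_def)
  have p0': "in_port (ideal_game P M) t p0 = range (Psi p0)" if "schedule P ! t = Outputs"
    using that p0 M by (auto simp: run_by_def attach_def mcbqc_resource_def set_honest)
  let ?R = "range SimMem \<union> Wire ` (\<Union>p\<in>M. conv_in simulator t p \<union> in_port (ideal_game P M) t p)"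
  let ?S = "range SimMem \<union> Wire ` (\<Union>p\<in>M. conv_out simulator t p \<union> out_port (ideal_game P M) t p)"
  have 1: "instrument_on ?R (gate (rename (sw (incoming P M t))))"
  proof (rule sw.instrument_on_exchange[OF i(1) fw[OF i(1)]])
    have "vq v \<in> ?R" if "v \<in> incoming P M t" for v
      using incoming_channel[OF wf t that] by (auto simp: simulator_def)
    then show "vq ` incoming P M t \<union> home P ` incoming P M t \<subseteq> ?R" by (auto simp: home_def)
  qed
  have 2: "instrument_on ?S (gate (rename (sw (outgoing P M t))))"
  proof (rule sw.instrument_on_exchange[OF i(2) fw[OF i(2)]])
    have "vq v \<in> ?S" if "v \<in> outgoing P M t" for v
      using outgoing_channel[OF wf t that clients_pos] by (auto simp: simulator_def)
    then show "vq ` outgoing P M t \<union> home P ` outgoing P M t \<subseteq> ?S" by (auto simp: home_def)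
  qed
  have 3: "instrument_on ?R (gate (rename Z))" if "schedule P ! t = Outputs"
  proof (rule Z.instrument_on_exchange)
    have "psi k \<in> ?R" for k using p0 p0'[OF that] by (intro UnI2 imageI UN_I[of p0]) auto
    then show "SimMem ` memory \<union> psi ` memory \<subseteq> ?R" by auto
  qed (use subs in auto)
  have 4: "instrument_on ?R (conjugate (sw (working P M t)) (hstep (schedule P ! t) (decode_state P c) m))"
    if "schedule P ! t \<noteq> Outputs"
    using work_registers[OF t that]
    by (intro instrument_on_conjugate[OF sw.bij_exchange[OF W] instrument_hstep[OF expected_schedule[OF wf t]]]) blast
  show "instrument_on ?R (conv_pre simulator t c m)"
    using 1 3 4 by (auto simp: simulator_def sim_pre_def intro!: instrument_on_ibind split: prod.split)
  show "instrument_on ?S (conv_post simulator t c m)"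
    using 2 by (auto simp: simulator_def sim_post_def intro!: instrument_on_ibind)
qed

section \<open>The simulated game round by round\<close>

lemma yields_draw: "yields (draw js g) (\<lambda>g'. \<forall>i. i \<notin> set js \<longrightarrow> g' i = g i)"
  unfolding yields_def
proof (intro ballI allI impI)
  fix g' i assume "g' \<in> fst ` set (draw js g)" "i \<notin> set js"
  then show "g' i = g i" by (rule draw_outcome)
qed

text \<open>This is why a simulator can play the middle rounds: with all measured vertices
  postponed, no \<delta> is computed from the inputs.\<close>

lemma hstep_input:
  assumes "k \<noteq> Inputs" "k \<noteq> Outputs" "expected P k q"
  shows "hstep k (s\<lparr>hy_input := x\<rparr>) m = imap (\<lambda>(s', m'). (s'\<lparr>hy_input := x\<rparr>, m')) (hstep k s m)"
  using assms
  by (cases k) (auto simp: hstep_def hybrid_step_def imap_ibind ibind_imap Let_def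
      intro!: ibind_cong arg_cong[where f = ireturn])

lemma hstep_restrict:
  assumes "k \<noteq> Inputs" "k \<noteq> Outputs"
  shows "hstep k s (m |` M) = hstep k s m"
proof (cases k)
  case (Shares v)
  have "(if Client j \<in> M then angle_of ((m |` M) (Client j)) else g j) =
      (if Client j \<in> M then angle_of (m (Client j)) else g j)" for g j by simp
  then show ?thesis by (simp only: Shares hstep_def hybrid_step_def round_kind.case)
qed (use assms in \<open>simp_all add: hstep_def hybrid_step_def\<close>)

text \<open>The conditions under which the classical state survives encoding. As at most the server
  receives a message, one extra list entry suffices.\<close>

lemma hstep_yields:
  assumes "k \<noteq> Inputs" "k \<noteq> Outputs" "\<And>j. clients P \<le> j \<Longrightarrow> hy_share s j = (\<lambda>_. 0)"
  shows "yields (hstep k s m) (\<lambda>(s', m'). (\<forall>j. clients P \<le> j \<longrightarrow> hy_share s' j = (\<lambda>_. 0)) \<and>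
    hy_input s' = hy_input s \<and> m' = (\<lambda>p. if p = Server \<and> Server \<in> M then m' Server else None))"
proof (cases k)
  case (Shares v)
  have "yields (draw (if v \<in> set (meas_order P) then removeAll h (honest_clients P M)
      else honest_clients P M) (\<lambda>_. 0)) (\<lambda>g. \<forall>j. clients P \<le> j \<longrightarrow> g j = 0)"
    by (rule yields_mono[OF yields_draw]) (auto simp: set_honest_clients)
  then show ?thesis
    unfolding Shares hstep_def hybrid_step_def Let_def round_kind.case yields_ibind yields_ireturn
    by (rule yields_mono) (auto intro!: yieldsI simp: assms(3) fun_eq_iff)
qed (use assms in \<open>auto simp: hstep_def hybrid_step_def Let_def case_prod_beta' fun_eq_iff intro!: yieldsI\<close>)

text \<open>The inverse of the relocation \<open>Y \<circ> Z \<circ> sw own_verts\<close> performed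
  in the last round.\<close>

definition final_perm :: "'v wire reg \<Rightarrow> 'v wire reg" where
  "final_perm = sw own_verts \<circ> Z \<circ> Y"

text \<open>The postponed work is a mere relabelling of qubits. The classical state of the hybrid
  game is read off from the memory of the simulator and from the inputs stored in the ideal
  resource.\<close>

definition undo :: "nat \<Rightarrow> 'v msg list \<times> (party \<Rightarrow> unit) \<times> 'v ideal_state \<Rightarrow>
    ('v wire reg, 'v hybrid_state) instrument" where
  "undo t z = ibind (gate (rename (if t = T then final_perm else sw (kept P M t))))
     (\<lambda>_. ireturn ((decode_state P (fst z))\<lparr>hy_input := cut (ideal_input (snd (snd z)))\<rparr>))"

lemma bij_final: "bij final_perm"
  unfolding final_perm_def by (intro bij_comp sw.bij_exchange Z.bij_exchange Y.bij_exchange subs) simp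

definition final_regs :: "'v wire reg set" where
  "final_regs = vq ` (verts P - out_verts P) \<union> home P ` verts P \<union> SimMem ` memory \<union> psi ` memory"

text \<open>The output wires, which the distinguisher sees at the end, must be fixed. With an honest
  server the three swaps lead from the wire to \<open>\<psi>\<close>, to the home register and back
  to the wire.\<close>

lemma final_fixed:
  assumes "r \<notin> final_regs"
  shows "final_perm r = r"
proof (cases "\<exists>v\<in>out_verts P. r = vq v")
  case True
  then obtain v where v: "v \<in> out_verts P" "v \<in> verts P" "r = vq v" using fin by auto
  show ?thesis
  proof (cases "Server \<in> M")
    case True
    have "Z r = r" by (rule Z.exchange_other) (auto simp: v)
    then show ?thesis
      using True by (simp add: final_perm_def own_verts_def own_outs_def sw.exchange_empty Y.exchange_empty)
  next
    case False
    have "Y r = psi (2 * idx v)" using v False subs by (simp add: own_outs_def Y.exchange_g)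
    moreover have "Z (psi (2 * idx v)) = home P v"
      using v Z.exchange_g[of memory "2 * idx v"] by (auto simp: memory_def home_def)
    moreover have "sw own_verts (home P v) = vq v"
      using v False by (simp add: own_verts_def sw.exchange_g)
    ultimately show ?thesis by (simp add: final_perm_def v)
  qed
next
  case False
  have "(\<lambda>v. psi (2 * idx v)) ` own_outs \<subseteq> psi ` memory"
    using subs(2) by (auto simp: memory_def)
  then have "r \<notin> (\<lambda>v. psi (2 * idx v)) ` own_outs" using assms unfolding final_regs_def by blast
  then have "Y r = r"
    by (rule Y.exchange_other) (use False in \<open>auto simp: own_outs_def split: if_splits\<close>)
  moreover have "Z r = r" by (rule Z.exchange_other) (use assms in \<open>auto simp: final_regs_def\<close>)
  moreover have "sw own_verts r = r"
    by (rule sw.exchange_other) (use False assms in \<open>auto simp: own_verts_def final_regs_def split: if_splits\<close>)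
  ultimately show ?thesis by (simp add: final_perm_def)
qed

lemma local_final: "final_regs \<subseteq> R \<Longrightarrow> local_op R (rename final_perm)"
  using fin subs by (intro local_op_rename[OF bij_final, of final_regs] final_fixed) (auto simp: final_regs_def)

lemma undo_complete: "complete (undo T z)"
  unfolding undo_def
  by (intro complete_ibind) (simp_all add: norm2_rename bij_final local_final)

abbreviation game :: "(party, 'v wire, 'v msg, 'v msg list \<times> (party \<Rightarrow> unit) \<times> 'v ideal_state) resource" where
  "game \<equiv> attach M simulator (ideal_game P M)"

lemma game_step:
  "res_step game t (c, fs, si) m =
    ibind (sim_pre t c (m |` M)) (\<lambda>(c1, m1).
    ibind (mcbqc_step P t si (\<lambda>p. if p \<in> M then m1 p else if p \<in> set (honest P M)
      then filter_msg (schedule P ! t) p (m p) else m p)) (\<lambda>(si', m2).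
    ibind (sim_post t c1 (m2 |` M)) (\<lambda>(c2, m3).
    ireturn ((c2, fs, si'), override_on m2 m3 M))))"
proof -
  have "(\<lambda>p. if p \<in> set (honest P M) then filter_msg k p (override_on m m1 M p) else override_on m m1 M p) =
      (\<lambda>p. if p \<in> M then m1 p else if p \<in> set (honest P M) then filter_msg k p (m p) else m p)" for k m1
    by (auto simp: fun_eq_iff override_on_def set_honest)
  then show ?thesis
    by (simp add: attach_def simulator_def ideal_step ibind_imap case_prod_beta')
qed

lemma rename_cancel:
  assumes "t < T"
  shows "rename (sw (kept P M (Suc t))) (rename (sw (outgoing P M t)) (rename (sw (working P M t)) \<phi>)) = \<phi>"
    and "rename (inv (sw (working P M t))) (rename (sw (incoming P M t)) \<phi>) = rename (sw (kept P M t)) \<phi>"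
proof -
  have W: "working P M t \<subseteq> verts P" "incoming P M t \<subseteq> verts P" "outgoing P M t \<subseteq> verts P"
    using transit_verts[OF wf assms] by (auto simp: working_def kept_def incoming_def outgoing_def)
  have "sw (kept P M (Suc t)) = sw (working P M t) \<circ> sw (outgoing P M t)"
    using sw.exchange_comp[OF W(1,3)] by (simp add: working_outgoing[OF wf assms])
  then have "sw (kept P M (Suc t)) \<circ> (sw (outgoing P M t) \<circ> sw (working P M t)) = id"
    by (simp add: fun_eq_iff sw.exchange_involution W)
  then show "rename (sw (kept P M (Suc t))) (rename (sw (outgoing P M t)) (rename (sw (working P M t)) \<phi>)) = \<phi>"
    by (simp add: rename_rename comp_assoc)
  show "rename (inv (sw (working P M t))) (rename (sw (incoming P M t)) \<phi>) = rename (sw (kept P M t)) \<phi>"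
    using sw.exchange_comp[OF W(1,2)]
    by (simp add: sw.inv_exchange W rename_rename working_incoming[OF wf assms])
qed

lemma middle_step:
  assumes t: "t < T" and k: "schedule P ! t \<noteq> Inputs" "schedule P ! t \<noteq> Outputs"
  shows "expect (res_step game t (c, fs, si) m) (\<lambda>(s', m'). expect (undo (Suc t) s') (\<lambda>u. f (u, m'))) \<psi> =
    expect (undo t (c, fs, si)) (\<lambda>u. expect (hstep (schedule P ! t) u m) f) \<psi>"
proof -
  let ?k = "schedule P ! t" and ?s = "decode_state P c" and ?x = "cut (ideal_input si)"
  have nl: "Suc t \<noteq> T" using schedule_Outputs_iff[OF t] k by auto
  have m: "mcbqc_step P t si x = ireturn (si, Map.empty)" for x
    using k by (cases ?k) (auto simp: mcbqc_step_def)
  have y: "yields (hstep ?k ?s m) (\<lambda>(s', m'). (\<forall>j. clients P \<le> j \<longrightarrow> hy_share s' j = (\<lambda>_. 0)) \<and>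
    hy_input s' = hy_input ?s \<and> m' = (\<lambda>p. if p = Server \<and> Server \<in> M then m' Server else None))"
    by (rule hstep_yields[OF k]) (simp add: decode_state_def)
  let ?c = "\<lambda>s' m'. encode_state P s' @ (case m' Server of None \<Rightarrow> [] | Some x \<Rightarrow> [x])"
  let ?m = "\<lambda>c1. override_on Map.empty (\<lambda>p. if p = Server \<and> clients P + 3 < length c1
      then Some (c1 ! (clients P + 3)) else None) M"
  have "expect (res_step game t (c, fs, si) m) (\<lambda>(s', m'). expect (undo (Suc t) s') (\<lambda>u. f (u, m'))) \<psi> =
    expect (hstep ?k ?s m) (\<lambda>(s', m'). f ((decode_state P (take (clients P + 3) (?c s' m')))\<lparr>hy_input := ?x\<rparr>,
       ?m (?c s' m'))) (rename (sw (kept P M t)) \<psi>)"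
    using k t nl
    by (simp add: game_step sim_pre_def sim_post_def m expect_conjugate hstep_restrict undo_def case_prod_beta'
        rename_cancel cong: if_cong)
  also have "\<dots> = expect (hstep ?k ?s m) (\<lambda>(s', m'). f (s'\<lparr>hy_input := ?x\<rparr>, m')) (rename (sw (kept P M t)) \<psi>)"
  proof (rule expect_cong_pair)
    fix s' m' K assume "((s', m'), K) \<in> set (hstep ?k ?s m)"
    then have f: "\<forall>j. clients P \<le> j \<longrightarrow> hy_share s' j = (\<lambda>_. 0)" "hy_input s' = hy_input ?s"
      "m' = (\<lambda>p. if p = Server \<and> Server \<in> M then m' Server else None)"
      using yieldsD[OF y, of "(s', m')"] by force+
    have "decode_state P (take (clients P + 3) (?c s' m')) = s'"
      using f(1,2) by (simp add: decode_encode_state decode_state_def[of P c])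
    moreover have "?m (?c s' m') p = m' p" for p
    proof -
      have 1: "p \<noteq> Server \<or> Server \<notin> M \<Longrightarrow> m' p = None"
        using fun_cong[OF f(3), of p] by auto
      show ?thesis
      proof (cases "m' Server")
        case None
        then show ?thesis using 1 by (cases "p = Server") (simp_all add: override_on_def)
      next
        case (Some x)
        then show ?thesis using 1 by (cases "p = Server") (auto simp: override_on_def nth_append)
      qed
    qed
    ultimately show "f ((decode_state P (take (clients P + 3) (?c s' m')))\<lparr>hy_input := ?x\<rparr>,
       ?m (?c s' m')) (K (rename (sw (kept P M t)) \<psi>)) =
       f (s'\<lparr>hy_input := ?x\<rparr>, m') (K (rename (sw (kept P M t)) \<psi>))"
      by (simp only: ext[of "?m (?c s' m')" m'])
  qed
  also have "\<dots> = expect (undo t (c, fs, si)) (\<lambda>u. expect (hstep ?k u m) f) \<psi>"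
    using t by (simp add: undo_def hstep_input[OF k expected_schedule[OF wf t]] case_prod_beta')
  finally show ?thesis .
qed

lemma first_step:
  "expect (res_step game 0 (c, fs, si) m) (\<lambda>(s', m'). expect (undo (Suc 0) s') (\<lambda>u. f (u, m'))) \<psi> =
    expect (undo 0 (c, fs, si)) (\<lambda>u. expect (hstep Inputs u m) f) \<psi>"
  and first_inv: "yields (res_step game 0 (c, fs, si) m) (\<lambda>(s', m'). malicious (snd (snd s')) = M)"
proof -
  have n: "Suc 0 \<noteq> T" using schedule_first[of P] schedule_last[of P] by auto
  let ?msg = "\<lambda>p. if p \<in> M then (case p of Server \<Rightarrow> Some (Flag True)
         | Client j \<Rightarrow> Some (FlaggedInput True (input_of ((m |` M) p))))
      else if p \<in> set (honest P M) then filter_msg Inputs p (m p) else m p"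
  let ?x = "\<lambda>j. restrict_input P j (flagged_input_of (?msg (Client j)))"
  have kept: "kept P M (Suc 0) = kept P M 0"
    using working_outgoing[OF wf schedule_pos, of M]
    by (auto simp: working_def outgoing_def transit_def schedule_first)
  have flag: "{p \<in> set (parties P). flag_of (?msg p)} = M"
  proof (rule set_eqI)
    fix p
    have "p \<in> M \<Longrightarrow> flag_of (?msg p)" by (cases p) (simp_all add: flag_of_def)
    moreover have "p \<in> set (parties P) \<Longrightarrow> p \<notin> M \<Longrightarrow> \<not> flag_of (?msg p)"
      by (cases p) (simp_all add: flag_of_def filter_msg_def honest_def)
    ultimately show "p \<in> {p \<in> set (parties P). flag_of (?msg p)} \<longleftrightarrow> p \<in> M" using M by blast
  qed
  have inp: "cut ?x = (\<lambda>j. if j < clients P then restrict_input P j (input_of (m (Client j))) else no_input)"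
    by (auto simp: cut_def flagged_input_of_def filter_msg_def set_honest fun_eq_iff)
  have st: "res_step game 0 (c, fs, si) m = ireturn ((c, fs, \<lparr>ideal_input = ?x, malicious = M\<rparr>), Map.empty)"
  proof -
    have "mcbqc_step P 0 si ?msg = ireturn (\<lparr>ideal_input = ?x, malicious = M\<rparr>, Map.empty)"
      by (simp only: mcbqc_step_def schedule_first round_kind.case flag)
    then show ?thesis
      by (simp only: game_step sim_pre_def sim_post_def schedule_first simp_thms if_True ibind_ireturn_left
          prod.case override_empty)
  qed
  show "yields (res_step game 0 (c, fs, si) m) (\<lambda>(s', m'). malicious (snd (snd s')) = M)"
    by (simp add: st)
  show "expect (res_step game 0 (c, fs, si) m) (\<lambda>(s', m'). expect (undo (Suc 0) s') (\<lambda>u. f (u, m'))) \<psi> =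
    expect (undo 0 (c, fs, si)) (\<lambda>u. expect (hstep Inputs u m) f) \<psi>"
    using n schedule_pos[of P] by (auto simp: st undo_def inp kept hstep_def hybrid_step_def)
qed

end

section \<open>Locality and attacks of the ideal resource\<close>

lemma local_measure_pattern:
  "set vs \<subseteq> V \<Longrightarrow> instrument_on (vq ` V) (measure_pattern P \<phi> f vs m)"
  by (induction vs arbitrary: m) (auto intro!: instrument_on_ibind)

lemma instrument_on_target_map:
  assumes "well_formed P"
  shows "instrument_on (vq ` verts P) (target_map P x)"
  unfolding target_map_def
  using assms local_measure_pattern[of "meas_order P" "verts P" P]
  by (auto split: prod.split intro!: instrument_on_ibind instrument_on_for_each instrument_on_entangle
      instrument_on_key_gate simp: well_formed_def)

lemma instrument_on_mcbqc_step:
  assumes "well_formed P"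
  shows "instrument_on UNIV (mcbqc_step P t s m)"
proof -
  have t: "instrument_on UNIV (target_map P x)" for x
    using instrument_on_mono[OF instrument_on_target_map[OF assms] subset_UNIV] .
  have "instrument_on UNIV (joint_attack P mal m x)" for mal x
    using t instrument_on_mono[OF _ subset_UNIV]
    by (fastforce simp: joint_attack_def valid_attack_def split: list.split)
  then show ?thesis
    using t by (auto simp: mcbqc_step_def split: round_kind.split intro!: instrument_on_ibind)
qed

lemma mcbqc_step_keeps:
  "schedule P ! t \<noteq> Inputs \<Longrightarrow> yields (mcbqc_step P t s m) (\<lambda>(s', m'). s' = s)"
  by (cases "schedule P ! t") (auto simp: mcbqc_step_def intro!: yieldsI)

text \<open>The simulator lets every malicious party send the same map, so the first one found is
  this map.\<close>

lemma joint_attack_unanimous: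
  assumes "\<And>p. p \<in> M \<Longrightarrow> m p = Some (Attack E)" "M \<subseteq> set (parties P)" "M \<noteq> {}" "valid_attack P M E"
  shows "joint_attack P M m = E"
proof -
  let ?L = "concat (map (\<lambda>p. case m p of Some (Attack E) \<Rightarrow> if p \<in> M then [E] else [] | _ \<Rightarrow> []) (parties P))"
  have *: "x = E" if "x \<in> set ?L" for x
    using that assms(1) by (fastforce split: option.splits msg.splits if_splits)
  obtain p where "p \<in> M" using assms(3) by blast
  then have "E \<in> set ?L" using assms(1)[of p] assms(2) by (auto intro!: bexI[of _ p])
  then obtain x xs where "?L = x # xs" by (cases ?L) auto
  moreover from this have "x = E" by (intro *) simp
  ultimately show ?thesis using assms(4) by (simp add: joint_attack_def)
qed

context relocation
begin

lemma last_cancel: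
  "rename final_perm (rename Y (rename (Z \<circ> sw own_verts) \<phi>)) = \<phi>"
  "rename (inv (Z \<circ> sw own_verts)) (rename Z \<phi>) = rename (sw own_verts) \<phi>"
proof -
  have "final_perm \<circ> (Y \<circ> (Z \<circ> sw own_verts)) = id"
    by (simp add: fun_eq_iff final_perm_def Y.exchange_involution[OF subs(2)] Z.exchange_involution
        sw.exchange_involution[OF subs(1)])
  then show "rename final_perm (rename Y (rename (Z \<circ> sw own_verts) \<phi>)) = \<phi>"
    by (simp add: rename_rename)
  have "inv (Z \<circ> sw own_verts) = sw own_verts \<circ> Z"
    by (rule inv_unique_comp) (simp_all add: fun_eq_iff Z.exchange_involution sw.exchange_involution[OF subs(1)])
  moreover have "sw own_verts \<circ> Z \<circ> Z = sw own_verts" by (simp add: fun_eq_iff Z.exchange_involution)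
  ultimately show "rename (inv (Z \<circ> sw own_verts)) (rename Z \<phi>) = rename (sw own_verts) \<phi>"
    by (simp add: rename_rename)
qed

lemma last_step:
  assumes t: "Suc t = T" and si: "malicious si = M" and f: "\<And>u u' m'. f (u, m') = f (u', m')"
  shows "expect (res_step game t (c, fs, si) m) (\<lambda>(s', m'). expect (undo (Suc t) s') (\<lambda>u. f (u, m'))) \<psi> =
    expect (undo t (c, fs, si)) (\<lambda>u. expect (hstep (schedule P ! t) u m) f) \<psi>"
proof -
  have tT: "t < T" using t by simp
  have k: "schedule P ! t = Outputs" using schedule_Outputs_iff[OF tT] t by simp
  let ?x = "ideal_input si"
  let ?s = "(decode_state P c)\<lparr>hy_input := cut ?x\<rparr>"
  have kept: "kept P M t = own_verts"
    using holder_server(1)[OF wf tT] by (auto simp: k transit_def kept_def own_verts_def)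
  let ?msg = "\<lambda>p. if p \<in> M then Some (Attack (attack c)) else if p \<in> set (honest P M)
      then filter_msg (schedule P ! t) p (m p) else m p"
  have att: "joint_attack P M ?msg = attack c"
    by (rule joint_attack_unanimous) (use M p0 valid_attack in auto)
  let ?out = "\<lambda>y p. case p of Client j \<Rightarrow> if j < clients P then Some (Output (y j) :: 'v msg) else None | Server \<Rightarrow> None"
  have "mcbqc_step P t si ?msg = ibind (attack c ?x) (\<lambda>y. ireturn (si, ?out y))"
  proof -
    have "(M = {}) = False" using p0 by auto
    then show ?thesis by (simp only: mcbqc_step_def k round_kind.case si att[unfolded k] if_False)
  qed
  then have g: "res_step game t (c, fs, si) m = ibind (gate (rename Z)) (\<lambda>_. ibind (attack c ?x) (\<lambda>y.
      ireturn ((c, fs, si), override_on (?out y)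
        (\<lambda>p. case (?out y |` M) p of Some (Output y) \<Rightarrow> Some (decode_msg P y) | _ \<Rightarrow> None) M)))"
    by (simp only: game_step sim_pre_def sim_post_def k round_kind.distinct if_True if_False simp_thms
        ibind_assoc ibind_ireturn_left prod.case)
  let ?y = "\<lambda>m' j. if Client j \<in> M then encode_msg P (m' (Client j))
      else (case m' (Client j) of Some (Output y) \<Rightarrow> y | _ \<Rightarrow> [])"
  \<comment> \<open>The messages after encoding by the attack and decoding by the simulator; for
    malicious clients this round trip is the identity by \<open>decode_encode_msg\<close>.\<close>
  let ?fin = "\<lambda>m'. override_on (?out (?y m'))
        (\<lambda>p. case (?out (?y m') |` M) p of Some (Output y) \<Rightarrow> Some (decode_msg P y) | _ \<Rightarrow> None) M"
  have fin: "?fin (hybrid_output P M s') = hybrid_output P M s'" for s'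
  proof
    fix p
    show "?fin (hybrid_output P M s') p = hybrid_output P M s' p"
    proof (cases p)
      case Server
      then show ?thesis by (simp add: override_on_def hybrid_output_def restrict_map_def)
    next
      case (Client j)
      show ?thesis
      proof (cases "j < clients P")
        case False
        then show ?thesis using Client by (simp add: override_on_def hybrid_output_def restrict_map_def)
      next
        case True
        show ?thesis
        proof (cases "Client j \<in> M")
          case False
          then show ?thesis using Client True by (simp add: override_on_def hybrid_output_def)
        next
          case inM: True
          obtain x where "x \<in> results_msgs P" "hybrid_output P M s' (Client j) = Some x"
            using hybrid_output_in_results[OF wf inM True] by blast
          then show ?thesis using Client True inM fin(1) by (simp add: override_on_def decode_encode_msg)
        qed
      qed
    qed
  qed
  \<comment> \<open>The functional ignores the state in the last round, so any value may stand in
    its place.\<close>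
  define f' where "f' = (\<lambda>m'. f (undefined, m'))"
  have f0: "f (u, m') = f' m'" for u m' unfolding f'_def by (rule f)
  have "expect (res_step game t (c, fs, si) m) (\<lambda>(s', m'). expect (undo (Suc t) s') (\<lambda>u. f (u, m'))) \<psi> =
    expect (hstep Outputs ?s Map.empty) (\<lambda>(s', m'). f (s', ?fin m')) (rename (sw own_verts) \<psi>)"
    unfolding g
    by (simp add: attack_def expect_conjugate case_prod_beta' undo_def t last_cancel f0 cong: if_cong)
  also have "\<dots> = expect (hstep Outputs ?s Map.empty) f (rename (sw own_verts) \<psi>)"
  proof -
    have "expect (hstep Outputs ?s Map.empty) (\<lambda>(s', m'). f (s', ?fin m')) (rename (sw own_verts) \<psi>) =
      expect (hstep Outputs ?s Map.empty) (\<lambda>(s', m'). f (s', m')) (rename (sw own_verts) \<psi>)"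
    proof (rule expect_cong_pair)
      fix s' m' K assume "((s', m'), K) \<in> set (hstep Outputs ?s Map.empty)"
      then have "m' = hybrid_output P M s'" using yieldsD[OF hstep_outputs, of "(s', m')"] by force
      then show "f (s', ?fin m') (K (rename (sw own_verts) \<psi>)) = f (s', m') (K (rename (sw own_verts) \<psi>))"
        using fin[of s'] by (simp only:)
    qed
    then show ?thesis by (simp add: case_prod_beta')
  qed
  also have "\<dots> = expect (undo t (c, fs, si)) (\<lambda>u. expect (hstep (schedule P ! t) u m) f) \<psi>"
    using tT by (simp add: undo_def kept k) (simp add: hstep_def hybrid_step_def)
  finally show ?thesis .
qed

lemma final_regs_not_open: "r \<in> final_regs \<Longrightarrow> r \<notin> observable (open_wires (real_game P M)) T"
  using open_wires_end[of P M] by (auto simp: observable_def final_regs_def home_def)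

lemma prob_relocated:
  assumes D: "fair P (open_wires (real_game P M)) D"
  shows "prob_one D game = prob_one D (hybrid P M h (meas_order P) False)"
proof -
  let ?A = "hybrid P M h (meas_order P) False" and ?ow = "open_wires (real_game P M)"
  \<comment> \<open>The flags are recorded in round 0, so the invariant starts with round 1.\<close>
  let ?inv = "\<lambda>t (z :: 'v msg list \<times> (party \<Rightarrow> unit) \<times> 'v ideal_state). t > 0 \<longrightarrow> malicious (snd (snd z)) = M"
  have A: "res_step ?A t = hstep (schedule P ! t)" for t
    by (simp add: hybrid_def hstep_def fun_eq_iff)
  have im: "rounds (ideal_game P M) = T" by (simp add: run_by_def attach_def mcbqc_resource_def)
  interpret simulation T ?ow game ?A undo ?inv
  proof (standard, goal_cases)
    case (1 t s)
    have "local_op (- observable ?ow t) (rename (if t = T then final_perm else sw (kept P M t)))"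
    proof (cases "t = T")
      case True
      then show ?thesis using final_regs_not_open by (auto intro!: local_final)
    next
      case False
      then have "instrument_on (- observable ?ow t) (gate (rename (sw (kept P M t))))"
        using 1 kept_not_open[OF wf _ clients_pos, of t _ M] fin(1) subs(3)
        by (intro sw.instrument_on_exchange) (auto simp: observable_def home_def intro: finite_subset)
      with False show ?thesis by (simp add: instrument_on_iff)
    qed
    then show ?case by (simp add: undo_def local_instr_ibind)
  next
    case (2 s)
    show ?case by (rule undo_complete)
  next
    case (3 t u m)
    then show ?case using wf meas_sub by (intro local_hybrid)
  next
    case (4 t s m)
    obtain c fs si where s: "s = (c, fs, si)" by (cases s) auto
    have "instrument_on UNIV (sim_pre t c' m')" "instrument_on UNIV (sim_post t c' m')" for c' m'
      using is_simulator 4 instrument_on_mono[OF _ subset_UNIV]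
      unfolding is_simulator_def im simulator_def converter.simps by blast+
    then have "instrument_on UNIV (res_step game t s m)"
      unfolding s game_step
      by (auto intro!: instrument_on_ibind instrument_on_mcbqc_step[OF wf] split: prod.split)
    then show ?case by (simp add: instrument_on_iff)
  next
    case (5 t s s' m' m)
    obtain c fs si where s: "s = (c, fs, si)" by (cases s) auto
    have "yields (res_step game t s m) (\<lambda>(s', m'). malicious (snd (snd s')) = M)"
    proof (cases "t = 0")
      case True
      then show ?thesis using first_inv by (simp add: s)
    next
      case False
      then have "schedule P ! t \<noteq> Inputs" "malicious si = M" using schedule_Inputs_iff[OF 5(1)] 5(2) by (auto simp: s)
      then show ?thesis
        unfolding s game_step yields_ibind split_beta
        by - (rule yieldsI, rule yields_mono[OF mcbqc_step_keeps], auto simp: split_beta intro!: yieldsI)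
    qed
    then show ?case using 5(3) by (auto dest!: yieldsD)
  next
    case (6 t s f m \<psi>)
    obtain c fs si where s: "s = (c, fs, si)" by (cases s) auto
    consider "t = 0" | "t > 0" "Suc t \<noteq> T" | "t > 0" "Suc t = T" by blast
    then show ?case
    proof cases
      case 1
      then show ?thesis using first_step[of c fs si m f \<psi>] by (simp add: s A schedule_first)
    next
      case 2
      then show ?thesis
        unfolding A s using schedule_Inputs_iff[OF 6(1)] schedule_Outputs_iff[OF 6(1)]
        by (intro middle_step[OF 6(1)]) auto
    next
      case 3
      then show ?thesis unfolding A s using 6(2,4) by (intro last_step) (auto simp: s)
    qed
  qed
  have ini: "undo 0 (res_init game) = ibind (gate (rename (sw (kept P M 0)))) (\<lambda>_. ireturn (res_init ?A))"
  proof -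
    have "(decode_state P (encode_state P hybrid_init))\<lparr>hy_input := cut (\<lambda>_. (\<lambda>_. False, []))\<rparr> = hybrid_init"
      by (subst decode_encode_state) (simp_all add: hybrid_init_def cut_def no_input_def cong: if_cong)
    then show ?thesis using schedule_pos[of P]
      by (auto simp: undo_def attach_def simulator_def run_by_def mcbqc_resource_def hybrid_def)
  qed
  have b: "rename \<tau> (basis_ket {}) = basis_ket {}" if "bij \<tau>" for \<tau> :: "'v wire reg \<Rightarrow> 'v wire reg"
  proof -
    have "\<tau> -` b = {} \<longleftrightarrow> b = {}" for b using that by (metis bij_is_surj surj_image_vimage_eq image_empty vimage_empty)
    then show ?thesis by (auto simp: rename_def basis_ket_def fun_eq_iff)
  qed
  show ?thesis
  proof (rule prob_eq)
    fix g :: "'v wire reg ket \<Rightarrow> real"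
    show "expect (undo 0 (res_init game)) (\<lambda>u. if u = res_init ?A then g else (\<lambda>_. 0)) (basis_ket {}) = g (basis_ket {})"
      by (simp add: ini b sw.bij_exchange subs)
  next
    fix u assume "u \<in> fst ` set (undo 0 (res_init game))"
    moreover have "yields (undo 0 (res_init game)) (\<lambda>u. u = res_init ?A)" by (simp add: ini)
    ultimately show "u = res_init ?A" by (rule yieldsD[rotated])
  next
    show "rounds game = T" by (simp add: attach_def im)
  qed (use D in \<open>auto simp: fair_def hybrid_def\<close>)
qed

end

section \<open>Correctness\<close>

subsection \<open>The plain measurement pattern\<close>

type_synonym 'v plain_state = "(nat \<Rightarrow> 'v client_input) \<times> ('v \<Rightarrow> bool)"

definition byproduct :: "'v public_info \<Rightarrow> 'v plain_state \<Rightarrow> 'v \<Rightarrow> 'v wire reg ket \<Rightarrow> 'v wire reg ket" where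
  "byproduct P s v = (case (description P (fst s), s) of ((\<phi>, f), (x, m)) \<Rightarrow>
     (if s_X P f m v then X_gate (vq v) else id) \<circ> Rz (if s_Z P f m v then 4 else 0) (vq v))"

definition out_list :: "'v public_info \<Rightarrow> 'v list" where
  "out_list P = filter (\<lambda>v. v \<in> out_verts P) (prep_order P)"

definition plain_output :: "'v public_info \<Rightarrow> ('v \<Rightarrow> bool) \<Rightarrow> party \<rightharpoonup> 'v msg" where
  "plain_output P m p = (case p of
     Client j \<Rightarrow> if j < clients P then Some (Output (classical_output P j m)) else None
   | Server \<Rightarrow> None)"

text \<open>The pattern is stretched over the schedule of the protocol, each vertex being prepared
  in its \<open>Send\<close> round and measured in its \<open>Delta\<close> round, for a comparison
  round by round.\<close>

definition plain_mid :: "'v public_info \<Rightarrow> 'v round_kind \<Rightarrow> 'v plain_state \<Rightarrow> ('v wire reg, 'v plain_state) instrument" where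
  "plain_mid P k s = (case k of
     Send v \<Rightarrow> ibind (prepare (if input_bit P (fst s) v then 4 else 0) (vq v)) (\<lambda>_. ireturn s)
   | Entangle \<Rightarrow> ibind (entangle P) (\<lambda>_. ireturn s)
   | Delta v \<Rightarrow> (case description P (fst s) of (\<phi>, f) \<Rightarrow>
       imap (\<lambda>b. (fst s, (snd s)(v := b))) (measure_pm (corrected_angle P \<phi> f (snd s) v) (vq v)))
   | _ \<Rightarrow> ireturn s)"

definition plain_step :: "'v public_info \<Rightarrow> 'v round_kind \<Rightarrow> 'v plain_state \<Rightarrow> (party \<rightharpoonup> 'v msg) \<Rightarrow>
    ('v wire reg, 'v plain_state \<times> (party \<rightharpoonup> 'v msg)) instrument" where
  "plain_step P k s m = (if k = Inputs then
       ireturn ((\<lambda>j. if j < clients P then restrict_input P j (input_of (m (Client j))) else no_input, snd s), Map.empty)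
     else if k = Outputs then
       ibind (for_each (out_list P) (\<lambda>v. gate (byproduct P s v))) (\<lambda>_. ireturn (s, plain_output P (snd s)))
     else imap (\<lambda>s'. (s', Map.empty)) (plain_mid P k s))"

definition plain :: "'v public_info \<Rightarrow> (party, 'v wire, 'v msg, 'v plain_state) resource" where
  "plain P = \<lparr>rounds = length (schedule P), in_port = \<lambda>_ _. {}, out_port = \<lambda>_ _. {},
     res_init = (\<lambda>_. no_input, \<lambda>_. False), res_step = \<lambda>t. plain_step P (schedule P ! t)\<rparr>"

lemma instrument_on_byproduct: "vq v \<in> R \<Longrightarrow> instrument_on R (gate (byproduct P s v))"
  by (auto simp: byproduct_def instrument_on_key_gate split: prod.splits)

lemma instrument_on_plain_mid:
  assumes "well_formed P" "expected P k q"
  shows "instrument_on (vq ` verts P) (plain_mid P k s)"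
  using expected_vert[OF assms(2,1)] instrument_on_entangle[OF assms(1)]
  by (cases k) (auto simp: plain_mid_def split: prod.split intro!: instrument_on_ibind)

lemma instrument_on_plain_step:
  assumes "well_formed P" "expected P k q"
  shows "instrument_on (vq ` verts P) (plain_step P k s m)"
proof -
  have "set (out_list P) \<subseteq> verts P" using assms(1) by (auto simp: out_list_def well_formed_def)
  then show ?thesis
    using instrument_on_plain_mid[OF assms]
    by (auto simp: plain_step_def intro!: instrument_on_ibind instrument_on_for_each instrument_on_byproduct)
qed

lemma local_plain:
  assumes "well_formed P" "t < length (schedule P)"
  shows "local_instr UNIV (res_step (plain P) t s m)"
proof -
  have "local_instr (vq ` verts P) (plain_step P (schedule P ! t) s m)"
    using instrument_on_plain_step[OF assms(1) expected_schedule[OF assms]] by (simp add: instrument_on_iff)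
  then have "local_instr UNIV (plain_step P (schedule P ! t) s m)" by (rule local_instr_mono[OF _ subset_UNIV])
  then show ?thesis by (simp add: plain_def)
qed

primrec plain_run :: "'v public_info \<Rightarrow> 'v round_kind list \<Rightarrow> 'v plain_state \<Rightarrow> ('v wire reg, 'v plain_state) instrument" where
  "plain_run P [] s = ireturn s"
| "plain_run P (k # ks) s = ibind (plain_mid P k s) (plain_run P ks)"

lemma plain_run_append: "plain_run P (ks @ ks') s = ibind (plain_run P ks s) (plain_run P ks')"
proof (induction ks arbitrary: s)
  case (Cons k ks)
  then have "plain_run P (ks @ ks') = (\<lambda>s. ibind (plain_run P ks s) (plain_run P ks'))" by auto
  then show ?case by (simp add: ibind_assoc)
qed simp

lemma plain_run_hops: "plain_run P (map (Hop v) js) s = ireturn s"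
  by (induction js) (simp_all add: plain_mid_def)

lemma plain_run_rotations:
  "plain_run P (concat (map (rotation_rounds P) vs)) s =
    ibind (for_each vs (\<lambda>v. prepare (if input_bit P (fst s) v then 4 else 0) (vq v))) (\<lambda>_. ireturn s)"
proof (induction vs)
  case (Cons v vs)
  have "plain_run P (rotation_rounds P v) s =
      ibind (prepare (if input_bit P (fst s) v then 4 else 0) (vq v)) (\<lambda>_. ireturn s)"
    by (simp add: rotation_rounds_def plain_run_append plain_run_hops plain_mid_def ibind_assoc)
  then show ?case using Cons by (simp add: plain_run_append ibind_assoc)
qed simp

lemma plain_run_measurements:
  "plain_run P (concat (map (\<lambda>v. [Delta v, Outcome v]) vs)) (x, m) =
    imap (\<lambda>m. (x, m)) (case description P x of (\<phi>, f) \<Rightarrow> measure_pattern P \<phi> f vs m)"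
proof (induction vs arbitrary: m)
  case (Cons v vs)
  then show ?case
    by (cases "description P x") (simp add: plain_mid_def ibind_imap imap_ibind del: fun_upd_apply)
qed (auto split: prod.split)

lemma target_map_plain:
  assumes "\<And>j. j < clients P \<Longrightarrow> x' j = x j"
  shows "target_map P x = ibind (plain_run P (concat (map (rotation_rounds P) (prep_order P)) @ [Entangle] @
      concat (map (\<lambda>v. [Delta v, Outcome v]) (meas_order P))) (x', \<lambda>_. False)) (\<lambda>s.
    ibind (for_each (out_list P) (\<lambda>v. gate (byproduct P s v))) (\<lambda>_. ireturn (\<lambda>j. classical_output P j (snd s))))"
proof -
  have d: "description P x = description P x'" by (rule description_cong) (simp add: assms)
  have i: "input_bit P x = input_bit P x'" by (rule ext, rule input_bit_cong) (simp add: assms)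
  obtain \<phi> f where e: "description P x' = (\<phi>, f)" by fastforce
  show ?thesis
    by (simp add: target_map_def d i e plain_run_append plain_run_rotations plain_run_measurements plain_mid_def
        ibind_assoc ibind_imap out_list_def byproduct_def)
qed

lemma open_wires_honest:
  assumes "well_formed P" "t < length (schedule P)" "clients P \<ge> 1" "v \<in> verts P"
  shows "Qubit v \<notin> open_wires (real_game P {}) t"
  using kept_not_open[OF assms(1-3), of v "{}"] assms(4) by (simp add: kept_def)

text \<open>Without malicious parties the ideal resource computes only in the last round. Until then
  it owes all rounds of the pattern so far, on wires that are closed to the distinguisher.\<close>

lemma prob_plain_ideal:
  assumes wf: "well_formed P" and n: "clients P \<ge> 1" and D: "fair P (open_wires (real_game P {})) D"
  shows "prob_one D (ideal_game P {}) = prob_one D (plain P)"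
proof -
  let ?T = "length (schedule P)" and ?ow = "open_wires (real_game P {})"
  let ?B = "ideal_game P {}" and ?A = "plain P"
  let ?x = "\<lambda>si j. if j < clients P then ideal_input si j else no_input"
  \<comment> \<open>\<open>tl\<close> drops the input round, whose effect is already stored in the
    resource. At the end any state will do, and the initial one is taken.\<close>
  let ?Kf = "\<lambda>t (z :: (party \<Rightarrow> unit) \<times> 'a ideal_state). if t = 0 \<or> t = ?T then ireturn (res_init ?A)
    else plain_run P (tl (take t (schedule P))) (?x (snd z), \<lambda>_. False)"
  let ?inv = "\<lambda>t (z :: (party \<Rightarrow> unit) \<times> 'a ideal_state). malicious (snd z) = {}"
  have run: "instrument_on (vq ` verts P) (plain_run P ks s)" if "\<forall>k\<in>set ks. \<exists>q. expected P k q" for ks s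
    using that instrument_on_plain_mid[OF wf] by (induction ks arbitrary: s) (auto intro!: instrument_on_ibind)
  have all: "\<forall>k\<in>set (tl (take t (schedule P))). \<exists>q. expected P k q" for t
  proof
    fix k assume "k \<in> set (tl (take t (schedule P)))"
    then have "k \<in> set (schedule P)" by (metis in_set_takeD list.sel(2) list.set_sel(2))
    then show "\<exists>q. expected P k q" using expected_schedule[OF wf] by (auto simp: in_set_conv_nth)
  qed
  have clean: "malicious s' = {}" if "(s', m') \<in> fst ` set (mcbqc_step P t s
      (\<lambda>p. if p \<in> set (honest P {}) then filter_msg (schedule P ! t) p (m p) else m p))" "malicious s = {}" for s' m' t s m
  proof (cases "schedule P ! t = Inputs")
    case True
    have "\<not> flag_of (if p \<in> set (honest P {}) then filter_msg Inputs p (m p) else m p)"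
      if "p \<in> set (parties P)" for p
      using that by - (cases p, auto simp: honest_def filter_msg_def flag_of_def)
    then have "{p \<in> set (parties P). flag_of (if p \<in> set (honest P {}) then filter_msg Inputs p (m p) else m p)} = {}"
      by blast
    then show ?thesis using that(1) unfolding mcbqc_step_def True round_kind.case
      by (simp only: fst_set_ireturn singleton_iff prod.inject) simp
  next
    case False
    then show ?thesis using that yieldsD[OF mcbqc_step_keeps[OF False]] by force
  qed
  interpret simulation ?T ?ow ?B ?A ?Kf ?inv
  proof (standard, goal_cases)
    case (1 t s)
    have "vq ` verts P \<subseteq> - observable ?ow t" if "t < ?T"
      using open_wires_honest[OF wf that n] by (auto simp: observable_def)
    then show ?case using 1 local_instr_mono[OF conjunct1[OF run[OF all, unfolded instrument_on_iff]]] by auto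
  next
    case (2 s)
    show ?case by simp
  next
    case (3 t u m)
    then show ?case using local_plain[OF wf] by blast
  next
    case (4 t s m)
    show ?case using instrument_on_mcbqc_step[OF wf]
      by (cases s) (simp add: ideal_step instrument_on_iff)
  next
    case (5 t s s' m' m)
    obtain fs si where s: "s = (fs, si)" by (cases s)
    have "yields (mcbqc_step P t si (\<lambda>p. if p \<in> set (honest P {}) then filter_msg (schedule P ! t) p (m p)
        else m p)) (\<lambda>(s', m'). malicious s' = {})"
      unfolding yields_def
    proof
      fix x assume "x \<in> fst ` set (mcbqc_step P t si (\<lambda>p. if p \<in> set (honest P {})
          then filter_msg (schedule P ! t) p (m p) else m p))"
      then show "case x of (s', m') \<Rightarrow> malicious s' = {}"
        using clean[of "fst x" "snd x" t si m] 5(2) by (simp add: s split_beta)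
    qed
    then have "yields (res_step ?B t s m) (\<lambda>(s', m'). malicious (snd s') = {})"
      unfolding s ideal_step yields_imap by (rule yields_mono) auto
    then show ?case using yieldsD[OF _ 5(3)] by blast
  next
    case (6 t s f m \<psi>)
    obtain fs si where s: "s = (fs, si)" by (cases s)
    have mal: "malicious si = {}" using 6(2) by (simp add: s)
    let ?msg = "\<lambda>p. if p \<in> set (honest P {}) then filter_msg (schedule P ! t) p (m p) else m p"
    have eq: "expect (res_step ?B t s m) (\<lambda>(s', m'). expect (?Kf (Suc t) s') (\<lambda>u. f (u, m'))) \<psi> =
      expect (mcbqc_step P t si ?msg) (\<lambda>(si', m'). expect (?Kf (Suc t) (fs, si')) (\<lambda>u. f (u, m'))) \<psi>"
      by (simp add: s ideal_step case_prod_beta' cong: if_cong)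
    consider (first) "t = 0" | (mid) "t > 0" "Suc t < ?T" | (last) "t > 0" "Suc t = ?T"
      using 6(1) by linarith
    then show ?case
    proof cases
      case first
      have k0: "schedule P ! 0 = Inputs" by (rule schedule_first)
      have T1: "?T \<noteq> Suc 0" using schedule_first[of P] schedule_last[of P] by auto
      have x: "(\<lambda>j. if j < clients P then restrict_input P j (flagged_input_of (?msg (Client j))) else no_input) =
          (\<lambda>j. if j < clients P then restrict_input P j (input_of (m (Client j))) else no_input)"
        by (auto simp: first k0 filter_msg_def set_honest flagged_input_of_def fun_eq_iff)
      obtain si' where si': "mcbqc_step P t si ?msg = ireturn (si', Map.empty)"
        "ideal_input si' = (\<lambda>j. restrict_input P j (flagged_input_of (?msg (Client j))))"
        unfolding mcbqc_step_def first k0 round_kind.case by (metis ideal_state.select_convs(1))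
      have tk: "tl (take (Suc t) (schedule P)) = []" using first by (cases "schedule P") auto
      have "?x si' = (\<lambda>j. if j < clients P then restrict_input P j (input_of (m (Client j))) else no_input)"
        unfolding si'(2) x ..
      then have "?Kf (Suc t) (fs, si') = ireturn ((\<lambda>j. if j < clients P then restrict_input P j (input_of (m (Client j)))
          else no_input), \<lambda>_. False)"
        unfolding tk snd_conv using T1 by (simp add: first)
      then show ?thesis
        unfolding eq si' expect_ireturn prod.case
        by (simp add: si' first plain_def plain_step_def k0)
    next
      case mid
      note k = schedule_middle[OF mid]
      have m0: "mcbqc_step P t si x = ireturn (si, Map.empty)" for x
        using k by (cases "schedule P ! t") (auto simp: mcbqc_step_def)
      have tk: "tl (take (Suc t) (schedule P)) = tl (take t (schedule P)) @ [schedule P ! t]"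
        using mid 6(1) by (cases "take t (schedule P)") (auto simp: take_Suc_conv_app_nth)
      show ?thesis
        unfolding eq m0
        using mid k by (simp add: s tk plain_run_append plain_def plain_step_def case_prod_beta' cong: if_cong)
    next
      case last
      have k: "schedule P ! t = Outputs" using schedule_last[of P] last by (metis diff_Suc_1)
      have tk: "tl (take t (schedule P)) = concat (map (rotation_rounds P) (prep_order P)) @ [Entangle] @
          concat (map (\<lambda>v. [Delta v, Outcome v]) (meas_order P))"
      proof -
        have "take t (schedule P) = butlast (schedule P)" unfolding butlast_conv_take last(2)[symmetric] by simp
        then show ?thesis by (simp add: schedule_eq butlast_append)
      qed
      define f' where "f' = (\<lambda>m'. f (undefined, m'))"
      have f0: "f (u, m') = f' m'" for u m' unfolding f'_def using 6(4)[OF last(2)] by blast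
      have out: "(\<lambda>p. case p of Client j \<Rightarrow> if j < clients P then Some (Output (classical_output P j m)) else None
         | Server \<Rightarrow> None) = plain_output P m" for m
        by (auto simp: plain_output_def fun_eq_iff)
      have "expect (mcbqc_step P t si ?msg) (\<lambda>(si', m'). expect (?Kf (Suc t) (fs, si')) (\<lambda>u. f (u, m'))) \<psi> =
          expect (target_map P (ideal_input si)) (\<lambda>y. f' (\<lambda>p. case p of Client j \<Rightarrow>
            if j < clients P then Some (Output (y j)) else None | Server \<Rightarrow> None)) \<psi>"
        using mal by (simp add: mcbqc_step_def k last f0)
      also have "\<dots> = expect (plain_run P (tl (take t (schedule P))) (?x si, \<lambda>_. False))
          (\<lambda>u. expect (plain_step P Outputs u m) f) \<psi>"
        unfolding tk by (subst target_map_plain[of P "?x si"]) (simp_all add: plain_step_def f0 case_prod_beta' out)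
      finally show ?thesis
        unfolding eq using last by (simp add: s k plain_def cong: if_cong)
    qed
  qed
  show ?thesis
    by (rule prob_eq) (use D in \<open>auto simp: fair_def plain_def run_by_def attach_def mcbqc_resource_def\<close>)
qed

subsection \<open>Removing the phases\<close>

text \<open>The product of the rotations by \<open>\<alpha> v\<close> over all vertices, as a single
  diagonal operator.\<close>

definition turn :: "'v public_info \<Rightarrow> ('v \<Rightarrow> int) \<Rightarrow> 'v wire reg ket \<Rightarrow> 'v wire reg ket" where
  "turn P \<alpha> \<psi> = (\<lambda>b. phase (\<Sum>v\<in>{v \<in> verts P. vq v \<in> b}. \<alpha> v) * \<psi> b)"

lemma turn_scale: "turn P \<alpha> (\<lambda>b. c * \<psi> b) = (\<lambda>b. c * turn P \<alpha> \<psi> b)"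
  by (simp add: turn_def fun_eq_iff)

lemma norm2_turn: "norm2 (turn P \<alpha> \<psi>) = norm2 \<psi>"
  unfolding turn_def by (rule norm2_phases) simp

lemma quadratic_turn: "quadratic f \<Longrightarrow> quadratic (\<lambda>\<psi>. f (turn P \<alpha> \<psi>))"
  by (simp add: quadratic_def turn_scale)

locale finite_verts =
  fixes P :: "'v public_info"
  assumes fin: "finite (verts P)"
begin

lemma local_turn:
  assumes "\<And>v. v \<in> verts P \<Longrightarrow> \<alpha> v \<noteq> 0 \<Longrightarrow> vq v \<in> R"
  shows "local_op R (turn P \<alpha>)"
  unfolding turn_def
proof (rule local_op_diagonal)
  let ?F = "vq ` {v \<in> verts P. \<alpha> v \<noteq> 0}"
  show "finite ?F" "?F \<subseteq> R" using fin assms by auto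
  fix b
  have "(\<Sum>v\<in>{v \<in> verts P. vq v \<in> b}. \<alpha> v) = (\<Sum>v\<in>{v \<in> verts P. vq v \<in> b \<inter> ?F}. \<alpha> v)"
    using fin by (intro sum.mono_neutral_right) auto
  then show "phase (\<Sum>v\<in>{v \<in> verts P. vq v \<in> b}. \<alpha> v) = phase (\<Sum>v\<in>{v \<in> verts P. vq v \<in> b \<inter> ?F}. \<alpha> v)"
    by simp
qed

lemma turn_cong: "(\<And>v. v \<in> verts P \<Longrightarrow> \<alpha> v mod 8 = \<beta> v mod 8) \<Longrightarrow> turn P \<alpha> = turn P \<beta>"
proof -
  assume *: "\<And>v. v \<in> verts P \<Longrightarrow> \<alpha> v mod 8 = \<beta> v mod 8"
  have "phase (\<Sum>v\<in>{v \<in> verts P. vq v \<in> b}. \<alpha> v) = phase (\<Sum>v\<in>{v \<in> verts P. vq v \<in> b}. \<beta> v)" for b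
  proof (rule phase_cong)
    have "(\<Sum>v\<in>{v \<in> verts P. vq v \<in> b}. \<alpha> v) mod 8 = (\<Sum>v\<in>{v \<in> verts P. vq v \<in> b}. \<alpha> v mod 8) mod 8"
      by (rule mod_sum_eq[symmetric])
    also have "\<dots> = (\<Sum>v\<in>{v \<in> verts P. vq v \<in> b}. \<beta> v mod 8) mod 8"
      by (rule arg_cong[where f = "\<lambda>x. x mod 8"], rule sum.cong) (use * in auto)
    also have "\<dots> = (\<Sum>v\<in>{v \<in> verts P. vq v \<in> b}. \<beta> v) mod 8" by (rule mod_sum_eq)
    finally show "(\<Sum>v\<in>{v \<in> verts P. vq v \<in> b}. \<alpha> v) mod 8 = (\<Sum>v\<in>{v \<in> verts P. vq v \<in> b}. \<beta> v) mod 8" .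
  qed
  then show ?thesis by (simp add: turn_def[abs_def])
qed

lemma turn_split:
  assumes "v \<in> verts P"
  shows "turn P \<alpha> \<psi> = (\<lambda>b. (if vq v \<in> b then phase (\<alpha> v) else 1) * turn P (\<alpha>(v := 0)) \<psi> b)"
proof
  fix b
  have "(\<Sum>u\<in>{u \<in> verts P. vq u \<in> b}. \<alpha> u) =
      (if vq v \<in> b then \<alpha> v else 0) + (\<Sum>u\<in>{u \<in> verts P. vq u \<in> b}. (\<alpha>(v := 0)) u)"
  proof (cases "vq v \<in> b")
    case True
    then have "v \<in> {u \<in> verts P. vq u \<in> b}" using assms by simp
    moreover have "finite {u \<in> verts P. vq u \<in> b}" using fin by simp
    ultimately show ?thesis using True by (simp add: sum.remove)
  next
    case False
    then show ?thesis by (auto intro!: sum.cong)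
  qed
  then show "turn P \<alpha> \<psi> b = (if vq v \<in> b then phase (\<alpha> v) else 1) * turn P (\<alpha>(v := 0)) \<psi> b"
    by (simp add: turn_def phase_add)
qed

lemma turn_Rz: "v \<in> verts P \<Longrightarrow> turn P \<alpha> (Rz a (vq v) \<psi>) = turn P (\<alpha>(v := \<alpha> v + a)) \<psi>"
proof -
  assume v: "v \<in> verts P"
  have "turn P (\<alpha>(v := 0)) (Rz a (vq v) \<psi>) = (\<lambda>b. (if vq v \<in> b then phase a else 1) * turn P (\<alpha>(v := 0)) \<psi> b)"
    by (auto simp: turn_def Rz_def)
  then show ?thesis
    using turn_split[OF v, of \<alpha> "Rz a (vq v) \<psi>"] turn_split[OF v, of "\<alpha>(v := \<alpha> v + a)" \<psi>]
    by (auto simp: phase_add fun_eq_iff)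
qed

lemma turn_set_qubit:
  assumes "\<alpha> v = 0"
  shows "phase (\<Sum>u\<in>{u \<in> verts P. vq u \<in> set_qubit (vq v) s b}. \<alpha> u) =
    phase (\<Sum>u\<in>{u \<in> verts P. vq u \<in> b}. \<alpha> u)"
proof -
  have "(\<Sum>u\<in>{u \<in> verts P. vq u \<in> set_qubit (vq v) s b}. \<alpha> u) = (\<Sum>u\<in>{u \<in> verts P. vq u \<in> b - {vq v}}. \<alpha> u)"
    using fin assms by (intro sum.mono_neutral_right) (auto simp: set_qubit_def split: if_splits)
  moreover have "(\<Sum>u\<in>{u \<in> verts P. vq u \<in> b}. \<alpha> u) = (\<Sum>u\<in>{u \<in> verts P. vq u \<in> b - {vq v}}. \<alpha> u)"
    using fin assms by (intro sum.mono_neutral_right) auto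
  ultimately show ?thesis by simp
qed

lemma turn_at_set_qubit:
  "\<alpha> v = 0 \<Longrightarrow> turn P \<alpha> \<psi> (set_qubit (vq v) s b) =
    phase (\<Sum>u\<in>{u \<in> verts P. vq u \<in> b}. \<alpha> u) * \<psi> (set_qubit (vq v) s b)"
  by (simp only: turn_def turn_set_qubit)

text \<open>A bit flip does not commute with a phase on its own qubit. Decryption rotates before it
  flips, so that phase is already gone when this is applied.\<close>

lemma turn_X:
  assumes "\<alpha> v = 0"
  shows "turn P \<alpha> (X_gate (vq v) \<psi>) = X_gate (vq v) (turn P \<alpha> \<psi>)"
  unfolding X_gate_def turn_at_set_qubit[where v = v and \<alpha> = \<alpha>, OF assms] by (simp add: turn_def)

lemma turn_prepare:
  assumes v: "v \<in> verts P" and \<alpha>: "\<alpha> v = 0" and f: "f' = (\<lambda>\<phi>. f (turn P (\<alpha>(v := c)) \<phi>))"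
  shows "expect (prepare 0 (vq v)) (\<lambda>_. f') \<psi> = expect (prepare c (vq v)) (\<lambda>_. f) (turn P \<alpha> \<psi>)"
proof -
  have "turn P (\<alpha>(v := c)) (\<lambda>b. pm_amp False 0 (vq v \<in> b) * \<psi> (set_qubit (vq v) s b)) =
      (\<lambda>b. pm_amp False c (vq v \<in> b) * turn P \<alpha> \<psi> (set_qubit (vq v) s b))" for s
  proof -
    have "(\<alpha>(v := c))(v := 0) = \<alpha>" using \<alpha> by auto
    then show ?thesis
      unfolding turn_split[OF v, of "\<alpha>(v := c)"] turn_at_set_qubit[where v = v and \<alpha> = \<alpha>, OF \<alpha>]
      by (auto simp: turn_def pm_amp_def fun_eq_iff)
  qed
  then show ?thesis by (simp add: prepare_def f del: set_qubit_simps)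
qed

text \<open>The rotation takes the basis at \<open>a\<close> to the basis at
  \<open>a + \<alpha> v\<close>, and a shift by pi exchanges its two vectors, which flips the
  outcome. The measured qubit stays rotated, so the phase is still owed afterwards.\<close>

lemma turn_measure:
  assumes v: "v \<in> verts P" and \<alpha>: "(a + \<alpha> v) mod 8 = (c + 4 * of_bool r) mod 8"
  shows "expect (measure_pm a (vq v)) (\<lambda>b \<phi>. f (b \<noteq> r) (turn P \<alpha> \<phi>)) \<psi> =
    expect (measure_pm c (vq v)) f (turn P \<alpha> \<psi>)"
proof -
  let ?q = "vq v"
  let ?K = "\<lambda>m a \<psi> b. pm_amp m a (?q \<in> b) * (cnj (pm_amp m a False) * \<psi> (set_qubit ?q False b) +
      cnj (pm_amp m a True) * \<psi> (set_qubit ?q True b))"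
  have p: "pm_amp m (a + \<alpha> v) s = pm_amp (m \<noteq> r) c s" for m s
  proof -
    have "phase (a + \<alpha> v) = phase (c + 4 * of_bool r)" using \<alpha> by (rule phase_cong)
    then show ?thesis by (cases r) (auto simp: pm_amp_def phase_add)
  qed
  have t: "turn P \<alpha> (?K m a \<psi>) = ?K m (a + \<alpha> v) (turn P \<alpha> \<psi>)" for m
  proof
    fix b
    let ?ph = "turn P (\<alpha>(v := 0))"
    have c: "cnj (phase (\<alpha> v)) * phase (\<alpha> v) = 1"
      using phase_cancel(1)[of "\<alpha> v"] by (simp add: phase_minus)
    have 1: "turn P \<alpha> \<psi> (set_qubit ?q s b) = (if s then phase (\<alpha> v) else 1) *
        (phase (\<Sum>u\<in>{u \<in> verts P. vq u \<in> b}. (\<alpha>(v := 0)) u) * \<psi> (set_qubit ?q s b))" for s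
      by (subst turn_split[OF v], subst turn_at_set_qubit) (auto simp: set_qubit_def)
    have 2: "turn P \<alpha> (?K m a \<psi>) b = (if ?q \<in> b then phase (\<alpha> v) else 1) *
        (phase (\<Sum>u\<in>{u \<in> verts P. vq u \<in> b}. (\<alpha>(v := 0)) u) * ?K m a \<psi> b)"
      by (subst turn_split[OF v]) (simp add: turn_def)
    have 3: "cnj (pm_amp m (a + \<alpha> v) True) * (phase (\<alpha> v) * x) = cnj (pm_amp m a True) * x" for x
    proof -
      have "cnj (pm_amp m (a + \<alpha> v) True) * (phase (\<alpha> v) * x) =
          cnj (pm_amp m a True) * ((cnj (phase (\<alpha> v)) * phase (\<alpha> v)) * x)"
        by (simp add: pm_amp_def phase_add)
      then show ?thesis by (simp add: c)
    qed
    show "turn P \<alpha> (?K m a \<psi>) b = ?K m (a + \<alpha> v) (turn P \<alpha> \<psi>) b"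
      unfolding 2 1 if_True if_False mult_1 3
      by (auto simp: pm_amp_def phase_add algebra_simps)
  qed
  show ?thesis
    by (cases r) (simp_all add: measure_pm_def t p del: set_qubit_simps)
qed

lemma turn_byproduct:
  assumes v: "v \<in> verts P" and "k mod 8 = (\<alpha> v + z) mod 8"
  shows "turn P (\<alpha>(v := 0)) (((if s then X_gate (vq v) else id) \<circ> Rz k (vq v)) \<psi>) =
    ((if s then X_gate (vq v) else id) \<circ> Rz z (vq v)) (turn P \<alpha> \<psi>)"
proof -
  have "turn P (\<alpha>(v := 0)) (Rz k (vq v) \<psi>) = turn P (\<alpha>(v := \<alpha> v + z)) \<psi>"
    unfolding turn_Rz[OF v] by (rule arg_cong[of _ _ "\<lambda>g. g \<psi>"], rule turn_cong) (use assms in auto)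
  also have "\<dots> = Rz z (vq v) (turn P \<alpha> \<psi>)"
    using turn_split[OF v, of "\<alpha>(v := \<alpha> v + z)" \<psi>] turn_split[OF v, of \<alpha> \<psi>]
    by (auto simp: Rz_def phase_add fun_eq_iff)
  finally show ?thesis by (simp add: turn_X)
qed

lemma turn_byproducts:
  assumes "distinct vs" "set vs \<subseteq> verts P" "\<And>v. v \<in> set vs \<Longrightarrow> k v mod 8 = (\<alpha> v + z v) mod 8"
  shows "turn P (\<lambda>v. if v \<in> set vs then 0 else \<alpha> v)
      (fold (\<lambda>v. (if s v then X_gate (vq v) else id) \<circ> Rz (k v) (vq v)) vs \<psi>) =
    fold (\<lambda>v. (if s v then X_gate (vq v) else id) \<circ> Rz (z v) (vq v)) vs (turn P \<alpha> \<psi>)"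
  using assms
proof (induction vs arbitrary: \<alpha> \<psi>)
  case (Cons v vs)
  let ?G = "\<lambda>v. (if s v then X_gate (vq v) else id) \<circ> Rz (k v) (vq v)"
  have "(\<lambda>u. if u \<in> set vs then 0 else (\<alpha>(v := 0)) u) = (\<lambda>u. if u \<in> set (v # vs) then 0 else \<alpha> u)"
    by auto
  moreover have "turn P (\<lambda>u. if u \<in> set vs then 0 else (\<alpha>(v := 0)) u) (fold ?G vs (?G v \<psi>)) =
      fold (\<lambda>v. (if s v then X_gate (vq v) else id) \<circ> Rz (z v) (vq v)) vs (turn P (\<alpha>(v := 0)) (?G v \<psi>))"
    using Cons.prems by (intro Cons.IH) auto
  moreover have "turn P (\<alpha>(v := 0)) (?G v \<psi>) =
      ((if s v then X_gate (vq v) else id) \<circ> Rz (z v) (vq v)) (turn P \<alpha> \<psi>)"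
    using Cons.prems by (intro turn_byproduct) auto
  ultimately show ?case by (simp only: fold_simps)
qed simp

end

lemma for_each_gates: "for_each vs (\<lambda>v. gate (G v)) = gate (fold G vs)"
proof (induction vs)
  case Nil
  then show ?case by (simp add: gate_def ireturn_def id_def)
next
  case (Cons v vs)
  then show ?case by (simp add: gate_def ibind_def comp_def)
qed

lemma for_each_nested: "for_each js (\<lambda>j. for_each (vs j) g) = for_each (concat (map vs js)) g"
  by (induction js) (simp_all add: for_each_append)

text \<open>The clients decrypt one after another, whereas the pattern corrects in the order of
  preparation. Gates on different qubits commute, so the multiset of gates decides.\<close>

lemma for_each_gates_mset:
  assumes "mset vs = mset us" "\<And>u v. u \<noteq> v \<Longrightarrow> G u \<circ> G v = G v \<circ> G u"
  shows "for_each vs (\<lambda>v. gate (G v)) = for_each us (\<lambda>v. gate (G v))"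
proof -
  have "fold G vs = fold G us"
  proof (rule fold_multiset_equiv)
    show "G x \<circ> G y = G y \<circ> G x" for x y using assms(2)[of x y] by (cases "x = y") auto
  qed (rule assms(1))
  then show ?thesis by (simp add: for_each_gates)
qed

lemma expect_const:
  assumes "quadratic f"
  shows "expect (draw js g) (\<lambda>_. f) \<psi> = f \<psi>"
  using assms expect_sample_const[of f angles]
proof (induction js arbitrary: g \<psi>)
  case (Cons j js)
  have "expect (draw js g) (\<lambda>_. f) = f" for g using Cons by auto
  then show ?case using Cons.prems by (simp add: angles_def)
qed simp

lemma byproduct_commute: "u \<noteq> v \<Longrightarrow>
    ((if s u then X_gate (vq u) else id) \<circ> Rz (k u) (vq u)) \<circ> ((if s v then X_gate (vq v) else id) \<circ> Rz (k v) (vq v)) =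
    ((if s v then X_gate (vq v) else id) \<circ> Rz (k v) (vq v)) \<circ> ((if s u then X_gate (vq u) else id) \<circ> Rz (k u) (vq u))"
proof -
  assume uv: "u \<noteq> v"
  have l: "local_op {vq w} ((if s w then X_gate (vq w) else id) \<circ> Rz (k w) (vq w))" for w
    using instrument_on_key_gate[of "vq w" "{vq w}" "s w" "k w"] by (simp add: instrument_on_iff)
  show ?thesis using local_op_commute[OF l[of u] l[of v]] uv by auto
qed

text \<open>The pattern knows an outcome from the \<open>Delta\<close> round on, the protocol
  records it only in \<open>Outcome\<close>. At the stage in between it is computed from the result
  of the server and \<open>r\<close>.\<close>

definition cleaned :: "'v public_info \<Rightarrow> nat \<Rightarrow> 'v hybrid_state \<Rightarrow> 'v plain_state" where
  "cleaned P t s = (hy_input s, \<lambda>v. if stage P t v = clients P + 4 then hy_b s v \<noteq> hy_r s v else hy_m s v)"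

text \<open>
  The angle by which the qubit of \<open>v\<close> exceeds its value in the plain pattern, where the input bits are
  already encoded in the prepared state.
\<close>

definition excess :: "'v public_info \<Rightarrow> nat \<Rightarrow> 'v hybrid_state \<Rightarrow> 'v \<Rightarrow> int" where
  "excess P t s v = (let q = stage P t v; x = 4 * of_bool (input_bit P (hy_input s) v) in
     if q \<le> 1 then 0
     else if q \<le> clients P + 2 then (\<Sum>j<q - 2. hy_share s j v) - x
     else if t = length (schedule P) \<and> v \<in> out_verts P then 0
     else hy_theta s v - x)"

definition cleanse :: "'v public_info \<Rightarrow> nat \<Rightarrow> 'v hybrid_state \<Rightarrow> ('v wire reg, 'v plain_state) instrument" where
  "cleanse P t s = ibind (gate (turn P (\<lambda>v. - excess P t s v))) (\<lambda>_. ireturn (cleaned P t s))"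

locale honest_run =
  fixes P :: "'v public_info" and h :: nat
  assumes wf: "well_formed P" and n: "clients P \<ge> 1"
begin

sublocale finite_verts P
  using wf by unfold_locales (simp add: well_formed_def)

abbreviation T :: nat where "T \<equiv> length (schedule P)"

definition hstep :: "'v round_kind \<Rightarrow> 'v hybrid_state \<Rightarrow> (party \<rightharpoonup> 'v msg) \<Rightarrow>
    ('v wire reg, 'v hybrid_state \<times> (party \<rightharpoonup> 'v msg)) instrument" where
  "hstep = hybrid_step P {} h [] True"

text \<open>The correction angle is computed from the sum, the rotations use the single shares; only
  their agreement makes the total rotation equal to \<theta>.\<close>

definition consistent :: "nat \<Rightarrow> 'v hybrid_state \<Rightarrow> bool" where
  "consistent t s \<longleftrightarrow> (\<forall>v. stage P t v \<noteq> 0 \<longrightarrow> hy_sum s v = (\<Sum>j<clients P. hy_share s j v))"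

lemma meas_verts: "set (meas_order P) = verts P - out_verts P"
  using wf by (simp add: well_formed_def)

lemma consistent_step:
  assumes t: "t < T" and c: "consistent t s"
  shows "yields (hstep (schedule P ! t) s m) (\<lambda>(s', m'). consistent (Suc t) s')"
proof -
  have e: "expected P (schedule P ! t) (stage P t)" by (rule expected_schedule[OF wf t])
  have s: "consistent (Suc t) s'" if "hy_sum s' = hy_sum s" "hy_share s' = hy_share s"
    "\<And>v. schedule P ! t \<noteq> Shares v" for s'
    using c e that meas_verts unfolding consistent_def stage_Suc[OF t]
    by (cases "schedule P ! t") (auto dest: subsetD)
  show ?thesis
  proof (cases "schedule P ! t")
    case (Shares v)
    then show ?thesis using c unfolding consistent_def stage_Suc[OF t]
      by (auto simp: hstep_def hybrid_step_def Let_def intro!: yieldsI)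
  qed (auto simp: hstep_def hybrid_step_def Let_def case_prod_beta' intro!: yieldsI s)
qed

lemma turn_entangle: "turn P \<alpha> (CZ_all E \<psi>) = CZ_all E (turn P \<alpha> \<psi>)"
  by (auto simp: turn_def CZ_all_def)

lemma clean_step:
  assumes t: "t < T" and c: "consistent t s" and f: "\<And>x. quadratic (f x)"
    and fc: "Suc t = T \<Longrightarrow> \<forall>u u' m'. f (u, m') = f (u', m')"
  shows "expect (hstep (schedule P ! t) s m) (\<lambda>(s', m'). expect (cleanse P (Suc t) s') (\<lambda>u. f (u, m'))) \<psi> =
    expect (cleanse P t s) (\<lambda>u. expect (plain_step P (schedule P ! t) u m) f) \<psi>"
proof -
  have e: "expected P (schedule P ! t) (stage P t)" by (rule expected_schedule[OF wf t])
  note st = stage_Suc[OF t]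
  let ?x = "\<lambda>v. 4 * of_bool (input_bit P (hy_input s) v) :: int"
  let ?\<alpha> = "\<lambda>v. - excess P t s v"
  have nl: "schedule P ! t \<noteq> Outputs \<Longrightarrow> Suc t \<noteq> T" using schedule_Outputs_iff[OF t] by simp
  have tT: "t \<noteq> T" using t by simp
  have sv: "stage P t v = 0" if "v \<notin> verts P" for v using stage_vert[OF wf t] that by blast
  show ?thesis
  proof (cases "schedule P ! t")
    case Inputs
    then have "stage P t = (\<lambda>_. 0)" "stage P (Suc t) = (\<lambda>_. 0)" using e st by auto
    then have "excess P t' s' = (\<lambda>_. 0)" "cleaned P t' s' = (hy_input s', hy_m s')" if "t' \<in> {t, Suc t}" for t' s'
      using that by (auto simp: excess_def cleaned_def fun_eq_iff)
    then show ?thesis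
      by (simp add: Inputs hstep_def hybrid_step_def cleanse_def plain_step_def)
  next
    case (Shares v)
    let ?s = "\<lambda>g c. s\<lparr>hy_share := \<lambda>j. (hy_share s j)(v := g j), hy_sum := (hy_sum s)(v := \<Sum>j<clients P. g j),
      hy_theta := (hy_theta s)(v := c)\<rparr>"
    have "excess P (Suc t) (?s g c) u = excess P t s u" for g c u
      using e nl tT by (auto simp: excess_def st Shares Let_def)
    moreover have "cleaned P (Suc t) (?s g c) = cleaned P t s" for g c
      using e by (auto simp: cleaned_def st Shares fun_eq_iff)
    moreover have q: "quadratic (\<lambda>\<psi>. f (cleaned P t s, Map.empty) (turn P ?\<alpha> \<psi>))"
      by (rule quadratic_turn[OF f])
    moreover have "expect (sample angles) (\<lambda>_ \<psi>. f (cleaned P t s, Map.empty) (turn P ?\<alpha> \<psi>)) =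
        (\<lambda>\<psi>. f (cleaned P t s, Map.empty) (turn P ?\<alpha> \<psi>))"
      by (rule ext, rule expect_sample_const[OF q]) (simp add: angles_def)
    ultimately show ?thesis
      by (simp add: Shares hstep_def hybrid_step_def cleanse_def plain_step_def plain_mid_def
          expect_const[OF q] del: fun_upd_apply)
  next
    case (Send v)
    have v: "v \<in> verts P" "stage P t v = 1" using e by (auto simp: Send idle_def)
    have "(\<lambda>u. - excess P (Suc t) s u) = ?\<alpha>(v := if input_bit P (hy_input s) v then 4 else 0)"
      using v nl tT by (auto simp: excess_def st Send Let_def fun_eq_iff)
    moreover have "cleaned P (Suc t) s = cleaned P t s"
      using v by (auto simp: cleaned_def st Send fun_eq_iff)
    moreover have "?\<alpha> v = 0" using v by (simp add: excess_def)
    ultimately show ?thesis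
      using turn_prepare[of v ?\<alpha> "\<lambda>\<psi>. f (cleaned P t s, Map.empty) (turn P (?\<alpha>(v :=
          if input_bit P (hy_input s) v then 4 else 0)) \<psi>)" "f (cleaned P t s, Map.empty)"
          "if input_bit P (hy_input s) v then 4 else 0" \<psi>] v(1)
      by (simp add: Send hstep_def hybrid_step_def cleanse_def plain_step_def plain_mid_def cleaned_def[of P t]
          del: fun_upd_apply)
  next
    case (Hop v j)
    have v: "v \<in> verts P" "stage P t v = j + 2" "j < clients P" using e by (auto simp: Hop idle_def)
    have "(\<lambda>u. - excess P (Suc t) s u)(v := - excess P (Suc t) s v + hy_share s j v) = ?\<alpha>"
      using v nl tT by (auto simp: excess_def st Hop Let_def fun_eq_iff)
    moreover have "cleaned P (Suc t) s = cleaned P t s"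
      using v by (auto simp: cleaned_def st Hop fun_eq_iff)
    ultimately show ?thesis
      by (simp add: Hop hstep_def hybrid_step_def cleanse_def plain_step_def plain_mid_def turn_Rz[OF v(1)]
          del: fun_upd_apply)
  next
    case (Correction v)
    have v: "v \<in> verts P" "stage P t v = clients P + 2" using e by (auto simp: Correction idle_def)
    let ?c = "(hy_theta s v - hy_sum s v) mod 8"
    \<comment> \<open>After all hops the excess is the sum of the shares, which the correction
      replaces by \<theta>, up to multiples of 8.\<close>
    have "turn P ((\<lambda>u. - excess P (Suc t) s u)(v := - excess P (Suc t) s v + ?c)) = turn P ?\<alpha>"
    proof (rule turn_cong)
      fix u
      have "hy_sum s v = (\<Sum>j<clients P. hy_share s j v)" using c v(2) by (simp add: consistent_def)
      moreover have "(- (a - x) + (a - b) mod 8) mod 8 = (- (b - x)) mod 8" for a b x :: int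
        unfolding mod_add_right_eq by simp
      ultimately show "((\<lambda>u. - excess P (Suc t) s u)(v := - excess P (Suc t) s v + ?c)) u mod 8 = ?\<alpha> u mod 8"
        using v nl tT by (auto simp: excess_def st Correction Let_def)
    qed
    moreover have "cleaned P (Suc t) s = cleaned P t s"
      using v by (auto simp: cleaned_def st Correction fun_eq_iff)
    ultimately show ?thesis
      by (simp add: Correction hstep_def hybrid_step_def cleanse_def plain_step_def plain_mid_def
          turn_Rz[OF v(1)] Let_def del: fun_upd_apply)
  next
    case Entangle
    have "excess P (Suc t) s = excess P t s" "cleaned P (Suc t) s = cleaned P t s"
      using nl tT by (auto simp: excess_def cleaned_def st Entangle fun_eq_iff)
    then show ?thesis
      by (simp add: Entangle hstep_def hybrid_step_def cleanse_def plain_step_def plain_mid_def entangle_def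
          turn_entangle)
  next
    case (Delta v)
    have v: "v \<in> verts P" "v \<notin> out_verts P" "stage P t v = clients P + 3"
      using e meas_verts by (auto simp: Delta)
    have n4: "stage P t u \<noteq> clients P + 4" for u
      using e sv[of u] by (cases "u \<in> verts P") (auto simp: Delta)
    have cl: "cleaned P t s = (hy_input s, hy_m s)" using n4 by (simp add: cleaned_def)
    obtain \<phi> fl where d: "description P (hy_input s) = (\<phi>, fl)" by fastforce
    let ?a = "corrected_angle P \<phi> fl (hy_m s) v"
    let ?\<delta> = "\<lambda>r. (pattern_angle P True s v + hy_theta s v + of_bool r * 4) mod 8"
    let ?s = "\<lambda>r b. s\<lparr>hy_r := (hy_r s)(v := r), hy_delta := (hy_delta s)(v := 0), hy_b := (hy_b s)(v := b)\<rparr>"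
    have ex: "excess P (Suc t) (?s r b) u = excess P t s u" for r b u
      using v nl tT by (auto simp: excess_def st Delta Let_def)
    have cl': "cleaned P (Suc t) (?s r b) = (hy_input s, (hy_m s)(v := (b \<noteq> r)))" for r b
      using n4 by (auto simp: cleaned_def st Delta fun_eq_iff)
    \<comment> \<open>The announced angle exceeds that of the pattern by \<theta>, 4 r and 4 x, with
      \<open>x\<close> the input bit; removing the excess \<theta> - 4 x leaves 4 r and a multiple
      of 8.\<close>
    have m: "(?\<delta> r + ?\<alpha> v) mod 8 = (?a + 4 * of_bool r) mod 8" for r
    proof -
      have "(?\<delta> r + ?\<alpha> v) mod 8 = (pattern_angle P True s v + hy_theta s v + of_bool r * 4 + ?\<alpha> v) mod 8"
        by (rule mod_add_left_eq)
      also have "pattern_angle P True s v + hy_theta s v + of_bool r * 4 + ?\<alpha> v =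
          ?a + 4 * of_bool r + of_bool (input_bit P (hy_input s) v) * 8"
        using v tT by (simp add: excess_def pattern_angle_def d)
      finally show ?thesis by simp
    qed
    let ?g = "\<lambda>b. f ((hy_input s, (hy_m s)(v := b)), Map.empty)"
    \<comment> \<open>The decrypted outcome no longer depends on \<open>r\<close>, so its draw drops
      out for a quadratic functional.\<close>
    have "quadratic (\<lambda>\<psi>. expect (measure_pm ?a (vq v)) ?g (turn P ?\<alpha> \<psi>))"
      by (rule quadratic_turn, rule quadratic_expect[OF local_instr_measure_pm[of _ UNIV]]) (simp_all add: f)
    then have "expect (sample [False, True]) (\<lambda>r \<psi>. expect (measure_pm ?a (vq v)) ?g (turn P ?\<alpha> \<psi>)) \<psi> =
        expect (measure_pm ?a (vq v)) ?g (turn P ?\<alpha> \<psi>)"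
      by (rule expect_sample_const) simp
    moreover have "expect (hstep (Delta v) s m) (\<lambda>(s', m'). expect (cleanse P (Suc t) s') (\<lambda>u. f (u, m'))) \<psi> =
      expect (sample [False, True]) (\<lambda>r. expect (measure_pm (?\<delta> r) (vq v))
        (\<lambda>b \<phi>. ?g (b \<noteq> r) (turn P ?\<alpha> \<phi>))) \<psi>"
      by (simp add: hstep_def hybrid_step_def cleanse_def ex cl' del: fun_upd_apply)
    moreover have "expect (measure_pm (?\<delta> r) (vq v)) (\<lambda>b \<phi>. ?g (b \<noteq> r) (turn P ?\<alpha> \<phi>)) =
      (\<lambda>\<psi>. expect (measure_pm ?a (vq v)) ?g (turn P ?\<alpha> \<psi>))" for r
      by (rule ext, rule turn_measure[where \<alpha> = ?\<alpha>, OF v(1)], rule m)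
    ultimately show ?thesis
      by (simp add: Delta cleanse_def plain_step_def plain_mid_def cl d del: fun_upd_apply)
  next
    case (Outcome v)
    have v: "v \<in> verts P" "v \<notin> out_verts P" "stage P t v = clients P + 4"
      using e meas_verts by (auto simp: Outcome)
    let ?s = "s\<lparr>hy_m := (hy_m s)(v := (hy_b s v \<noteq> hy_r s v))\<rparr>"
    have "excess P (Suc t) ?s u = excess P t s u" for u
      using v nl tT by (auto simp: excess_def st Outcome Let_def)
    moreover have "cleaned P (Suc t) ?s = cleaned P t s"
      using v by (auto simp: cleaned_def st Outcome fun_eq_iff)
    ultimately show ?thesis
      by (simp add: Outcome hstep_def hybrid_step_def cleanse_def plain_step_def plain_mid_def
          del: fun_upd_apply)
  next
    case Outputs
    have sT: "Suc t = T" using schedule_Outputs_iff[OF t] Outputs by simp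
    define f' where "f' = (\<lambda>m'. f (undefined, m'))"
    have f0: "f (u, m') = f' m'" for u m' unfolding f'_def using fc[OF sT] by blast
    have n4: "stage P t u \<noteq> clients P + 4" for u
      using e sv[of u] by (cases "u \<in> verts P") (auto simp: Outputs)
    have cl: "cleaned P t s = (hy_input s, hy_m s)" using n4 by (simp add: cleaned_def)
    obtain \<phi> fl where d: "description P (hy_input s) = (\<phi>, fl)" by fastforce
    let ?G = "\<lambda>v. (if s_X P fl (hy_m s) v then X_gate (vq v) else id) \<circ> Rz (- fst (hybrid_key P s v)) (vq v)"
    let ?G' = "\<lambda>v. (if s_X P fl (hy_m s) v then X_gate (vq v) else id) \<circ> Rz (if s_Z P fl (hy_m s) v then 4 else 0) (vq v)"
    have dl: "distinct (out_list P)" "set (out_list P) = out_verts P"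
      using wf by (auto simp: out_list_def well_formed_def)
    have hc: "honest_clients P {} = [0..<clients P]" by (simp add: honest_clients_def)
    have "for_each (honest_clients P {}) (decrypt P (hybrid_key P s)) =
        for_each (concat (map (\<lambda>j. filter (\<lambda>v. v \<in> outs P j) (prep_order P)) [0..<clients P])) (\<lambda>v. gate (?G v))"
    proof -
      have "snd (hybrid_key P s v) = s_X P fl (hy_m s) v" for v by (simp add: hybrid_key_def d)
      then show ?thesis unfolding hc decrypt_def by (simp only: for_each_nested)
    qed
    also have "\<dots> = for_each (out_list P) (\<lambda>v. gate (?G v))"
    proof (rule for_each_gates_mset)
      let ?L = "\<lambda>k. concat (map (\<lambda>j. filter (\<lambda>v. v \<in> outs P j) (prep_order P)) [0..<k])"
      have "distinct (?L k) \<and> set (?L k) = (\<Union>j<k. outs P j) \<inter> verts P" if "k \<le> clients P" for k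
        using that
      proof (induction k)
        case (Suc k)
        have "outs P k \<inter> outs P j = {}" if "j < k" for j
          using wf that Suc.prems by (auto simp: well_formed_def disjoint_family_on_def)
        moreover have "distinct (prep_order P)" "set (prep_order P) = verts P"
          using wf by (auto simp: well_formed_def)
        ultimately show ?case using Suc by (auto simp: less_Suc_eq)
      qed simp
      from this[of "clients P"] have "distinct (?L (clients P))" "set (?L (clients P)) = out_verts P"
        using wf by (auto simp: out_verts_def well_formed_def)
      then show "mset (?L (clients P)) = mset (out_list P)"
        using dl set_eq_iff_mset_eq_distinct by metis
    qed (rule byproduct_commute)
    finally have dec: "for_each (honest_clients P {}) (decrypt P (hybrid_key P s)) = gate (fold ?G (out_list P))"
      by (simp only: for_each_gates)
    have ex: "(\<lambda>u. - excess P (Suc t) s u) = (\<lambda>u. if u \<in> set (out_list P) then 0 else ?\<alpha> u)"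
    proof
      fix u
      have "stage P T = stage P t" using st unfolding sT Outputs by simp
      then show "- excess P (Suc t) s u = (if u \<in> set (out_list P) then 0 else ?\<alpha> u)"
        using e sv[of u] dl(2) by (cases "u \<in> verts P") (auto simp: excess_def Outputs sT tT Let_def)
    qed
    have "turn P (\<lambda>u. if u \<in> set (out_list P) then 0 else ?\<alpha> u) (fold ?G (out_list P) \<psi>) =
        fold ?G' (out_list P) (turn P ?\<alpha> \<psi>)"
    proof (rule turn_byproducts)
      fix v assume v: "v \<in> set (out_list P)"
      then have v': "v \<in> verts P" "v \<in> out_verts P" "v \<notin> set (meas_order P)"
        using dl(2) meas_verts wf by (auto simp: well_formed_def)
      then have "excess P t s v = hy_theta s v - ?x v"
        using e tT by (simp add: excess_def Outputs)
      \<comment> \<open>Rotating back by the key reverses the signs of the contributions of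
        \<open>s_Z\<close> and of the input bit; 4 and -4 agree modulo 8.\<close>
      moreover have "- (a mod 8) mod 8 = b mod 8" if "b = - a + k * 8" for a b k :: int
        unfolding that mod_minus_eq by (rule mod_mult_self1[symmetric])
      from this[of _ _ "of_bool (s_Z P fl (hy_m s) v) + of_bool (input_bit P (hy_input s) v)"]
      have "- ((hy_theta s v + (of_bool (s_Z P fl (hy_m s) v) + of_bool (input_bit P (hy_input s) v)) * 4) mod 8) mod 8 =
          (- (hy_theta s v - ?x v) + (if s_Z P fl (hy_m s) v then 4 else 0)) mod 8"
        by (auto simp: of_bool_def)
      ultimately show "- fst (hybrid_key P s v) mod 8 = (?\<alpha> v + (if s_Z P fl (hy_m s) v then 4 else 0)) mod 8"
        by (simp only: hybrid_key_def d prod.case fst_conv)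
    qed (use dl wf in \<open>auto simp: well_formed_def\<close>)
    moreover have "for_each (out_list P) (\<lambda>v. gate (byproduct P (hy_input s, hy_m s) v)) =
        gate (fold ?G' (out_list P))"
      by (simp add: byproduct_def d for_each_gates)
    moreover have "hybrid_output P {} s = plain_output P (hy_m s)"
      by (auto simp: hybrid_output_def plain_output_def fun_eq_iff split: party.splits)
    ultimately show ?thesis
      by (simp add: Outputs hstep_def hybrid_step_def dec cleanse_def ex f0 plain_step_def cl)
  qed
qed

lemma prob_hybrid_plain:
  assumes D: "fair P (open_wires (real_game P {})) D"
  shows "prob_one D (hybrid P {} h [] True) = prob_one D (plain P)"
proof -
  let ?B = "hybrid P {} h [] True" and ?ow = "open_wires (real_game P {})"
  have B: "res_step ?B t = hstep (schedule P ! t)" for t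
    by (simp add: hybrid_def hstep_def fun_eq_iff)
  interpret simulation T ?ow ?B "plain P" "cleanse P" consistent
  proof (standard, goal_cases)
    case (1 t s)
    have "local_op (- observable ?ow t) (turn P (\<lambda>v. - excess P t s v))"
    proof (rule local_turn)
      fix v assume v: "v \<in> verts P" "- excess P t s v \<noteq> 0"
      show "vq v \<in> - observable ?ow t"
      proof (cases "t = T")
        case False
        then show ?thesis using open_wires_honest[OF wf _ n v(1), of t] 1 by (auto simp: observable_def)
      next
        case True
        \<comment> \<open>At the end the output qubits carry no excess; the remaining phases sit on
          measured vertices, whose wires stay closed.\<close>
        have "stage P T v = clients P + (if v \<in> set (meas_order P) then 5 else 3)"
        proof -
          have T1: "T - 1 < T" "Suc (T - 1) = T" using schedule_pos[of P] by linarith+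
          moreover have "expected P Outputs (stage P (T - 1))"
            using expected_schedule[OF wf T1(1)] schedule_last[of P] by simp
          ultimately show ?thesis
            using stage_Suc[OF T1(1)] schedule_last[of P] v(1) unfolding T1(2) by simp
        qed
        then have "v \<notin> out_verts P" using v(2) True by (auto simp: excess_def Let_def split: if_splits)
        then show ?thesis using open_wires_end[of P "{}"] True by (auto simp: observable_def)
      qed
    qed
    then show ?case by (simp add: cleanse_def local_instr_ibind)
  next
    case (2 s)
    show ?case unfolding cleanse_def
      by (intro complete_ibind) (simp_all add: norm2_turn local_turn)
  next
    case (3 t u m)
    then show ?case by (rule local_plain[OF wf])
  next
    case (4 t s m)
    then show ?case using wf by (intro local_hybrid) auto
  next
    case (5 t s s' m' m)
    then show ?case using yieldsD[OF consistent_step[OF 5(1,2)]] unfolding B by fastforce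
  next
    case (6 t s f m \<psi>)
    have "res_step (plain P) t = plain_step P (schedule P ! t)" by (simp add: plain_def)
    then show ?case unfolding B using clean_step[OF 6] by simp
  qed
  have i: "cleanse P 0 hybrid_init = ireturn (\<lambda>_. no_input, \<lambda>_. False)"
  proof -
    have "turn P (\<lambda>v. 0) = (\<lambda>\<psi>. \<psi>)" by (simp add: turn_def[abs_def])
    then show ?thesis
      by (simp add: cleanse_def excess_def cleaned_def stage_0 hybrid_def hybrid_init_def plain_def
          gate_def ireturn_def ibind_def comp_def)
  qed
  show ?thesis
    by (rule prob_eq) (use D in \<open>auto simp: fair_def hybrid_def plain_def i consistent_def stage_0
      simp del: One_nat_def\<close>)
qed

end

section \<open>Secure construction\<close>

text \<open>Ports are functions on the whole type of parties, so \<open>matching\<close> compares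
  them for clients beyond \<open>clients P\<close> as well.\<close>

lemma channel_outside:
  assumes "well_formed P" "clients P \<ge> 1" "t < length (schedule P)" "p \<notin> set (parties P)"
  shows "channel_in P t p = {}" "channel_out P t p = {}"
proof -
  have "p = Client j \<Longrightarrow> \<not> j < clients P" for j using assms(4) by (auto simp: parties_def)
  moreover have "p \<noteq> Server" using assms(4) by (auto simp: parties_def)
  ultimately show "channel_in P t p = {}" "channel_out P t p = {}"
    using expected_schedule[OF assms(1,3)] assms(2)
    by (cases "schedule P ! t"; cases p; auto simp: channel_in_def channel_out_def output_wires_def)+
qed

lemma matching_real_ideal:
  assumes "well_formed P" "clients P \<ge> 1"
    and S: "conv_in S = channel_in P" "conv_out S = channel_out P"
    and M: "M \<subseteq> set (parties P)"
  shows "matching (real_game P M) (attach M S (ideal_game P M))"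
proof -
  have p: "p \<in> set (honest P M) \<longleftrightarrow> p \<in> set (parties P) \<and> p \<notin> M" for p by (auto simp: honest_def)
  have o: "output_port P p t = {}" if "p \<notin> set (parties P)" for p t
    using that by (cases p) (auto simp: output_port_def output_wires_def parties_def)
  show ?thesis
    unfolding matching_def
    using M channel_outside[OF assms(1,2)] o
    by (auto simp: run_by_def attach_def parallel_def smpc_resource_def mcbqc_protocol_def S fun_eq_iff p
        mcbqc_filter_def mcbqc_resource_def)
qed

lemma fair_real:
  "is_distinguisher (real_game P M) D \<Longrightarrow> fair P (open_wires (real_game P M)) D"
  by (auto simp: is_distinguisher_def fair_def instrument_on_iff observable_def run_by_def attach_def
      smpc_resource_def)

text \<open>The simulator for the empty coalition, where soundness reduces to correctness.\<close>

definition idle_converter :: "('p, 'w, 'x, 's list) converter" where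
  "idle_converter = \<lparr>conv_in = \<lambda>_ _. {}, conv_out = \<lambda>_ _. {}, conv_init = [],
     conv_pre = \<lambda>_ s m. ireturn (s, m), conv_post = \<lambda>_ s m. ireturn (s, m)\<rparr>"

lemma attach_idle:
  "res_step (attach {} idle_converter R) t (c, s) m = imap (\<lambda>(s', m'). ((c, s'), m')) (res_step R t s m)"
  by (simp add: attach_def idle_converter_def override_on_def imap_eq_ibind split_beta')

lemma play_idle:
  "play D (attach {} idle_converter R) k h (c, s) = play D R k h s"
  by (induction k arbitrary: h s) (simp_all add: attach_idle ibind_imap split_beta')

lemma prob_idle: "prob_one D (attach {} idle_converter R) = prob_one D R" (is "prob_one D ?A = _")
proof -
  obtain c where "rounds ?A = rounds R" "res_init ?A = (c, res_init R)" by (simp add: attach_def)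
  then show ?thesis by (simp only: prob_one_def play_idle)
qed

lemma matching_idle: "matching A (attach {} idle_converter R) \<longleftrightarrow> matching A R"
  by (simp add: matching_def attach_def)

lemma is_simulator_idle: "is_simulator {} R idle_converter"
  by (simp add: is_simulator_def idle_converter_def)

lemma honest_exists:
  assumes "clients P \<ge> 1" "M \<in> server_and_all_but_one_client P"
  obtains h where "h < clients P" "Client h \<notin> M"
proof -
  have "\<not> Client ` {..<clients P} \<subseteq> M"
  proof
    assume "Client ` {..<clients P} \<subseteq> M"
    then have "Client ` {..<clients P} \<subseteq> M - {Server}" by auto
    moreover have "finite M" using assms(2) finite_subset by (auto simp: server_and_all_but_one_client_def)
    ultimately have "card (Client ` {..<clients P}) \<le> card (M - {Server})" by (intro card_mono) auto
    moreover have "card (Client ` {..<clients P}) = clients P" by (simp add: card_image inj_on_def)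
    ultimately show False using assms by (auto simp: server_and_all_but_one_client_def)
  qed
  then show ?thesis using that by auto
qed

lemma indistinguishable_honest:
  assumes wf: "well_formed P" and n: "clients P \<ge> 1"
  shows "indistinguishable 0 (real_game P {}) (ideal_game P {})"
proof -
  interpret honest_run P 0 using wf n by unfold_locales
  have "prob_one D (real_game P {}) = prob_one D (ideal_game P {})" if "is_distinguisher (real_game P {}) D" for D
    using prob_real_hybrid[OF wf fair_real[OF that]] prob_hybrid_plain[OF fair_real[OF that]]
      prob_plain_ideal[OF wf n fair_real[OF that]] by simp
  moreover have "matching (real_game P {}) (ideal_game P {})"
    using matching_real_ideal[OF wf n, of "\<lparr>conv_in = channel_in P, conv_out = channel_out P, conv_init = (),
      conv_pre = \<lambda>_ s m. ireturn (s, m), conv_post = \<lambda>_ s m. ireturn (s, m)\<rparr>" "{}"]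
    by (simp add: matching_def attach_def)
  ultimately show ?thesis by (simp add: indistinguishable_def)
qed

lemma simulator_exists:
  assumes wf: "well_formed P" and n: "clients P \<ge> 1" and M: "M \<in> server_and_all_but_one_client P"
  shows "\<exists>\<sigma>. is_simulator M (ideal_game P M) \<sigma> \<and> indistinguishable 0 (real_game P M) (attach M \<sigma> (ideal_game P M))"
proof (cases "M = {}")
  case True
  have "indistinguishable 0 (real_game P M) (attach M idle_converter (ideal_game P M))"
    using indistinguishable_honest[OF wf n] by (simp add: True indistinguishable_def matching_idle prob_idle)
  then show ?thesis using True is_simulator_idle by blast
next
  case False
  then obtain p0 where p0: "p0 \<in> M" by blast
  obtain h where hh: "h < clients P" "Client h \<notin> M" by (rule honest_exists[OF n M])
  have sub: "M \<subseteq> set (parties P)" using M by (simp add: server_and_all_but_one_client_def)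
  interpret relocation P M h p0 by unfold_locales (use wf hh sub p0 in auto)
  have "prob_one D (real_game P M) = prob_one D game" if "is_distinguisher (real_game P M) D" for D
    using prob_real_hybrid[OF wf fair_real[OF that]] prob_hybrid_relaxed[OF wf fair_real[OF that]]
      prob_hybrid_postponed[OF wf hh fair_real[OF that]] prob_relocated[OF fair_real[OF that]] by simp
  moreover have "matching (real_game P M) game"
    by (rule matching_real_ideal[OF wf n _ _ sub]) (simp_all add: simulator_def)
  ultimately show ?thesis using is_simulator by (auto simp: indistinguishable_def)
qed

theorem theorem4:
  fixes P :: "'v public_info"
  assumes "clients P \<ge> 1" and "well_formed P"
  shows "securely_constructs 0 (parties P) (server_and_all_but_one_client P)
    (mcbqc_protocol P) (smpc_resource P) (mcbqc_resource P) (mcbqc_filter P)"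
  using indistinguishable_honest[OF assms(2,1)] simulator_exists[OF assms(2,1)]
  by (simp add: securely_constructs_def honest_def[symmetric]) (simp add: honest_def)

end
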